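(* Let $V$ be a superspace of dimension $n|m$ and $0\le r\le n$. The super Plücker map $$G_r(V)=G_{r|0}(V)\to P(\Lambda^r(V)),\qquad L=\mathrm{span}(\mathbf u_1,\dots,\mathbf u_r)\mapsto \text{class of }\mathbf u_1\wedge\dots\wedge\mathbf u_r,$$ is an embedding (i.e. it is invertible on its image).
   Context: All vectors, matrices etc. are taken over arbitrary commutative superalgebras (functor-of-points sense). $G_{r|0}(V)$ is the supermanifold of $r|0$-planes in $V$: the quotient by the left action of $\mathrm{GL}(r)$ of the supermanifold of $r\times(n|m)$ matrices $U=(u_i{}^a\,|\,u_i{}^{\hat\mu})$ ($u_i{}^a$ even, $a=1,\dots,n$; $u_i{}^{\hat\mu}$ odd, $\mu=1,\dots,m$) containing an invertible $r\times r$ submatrix of even columns; the rows are the coordinates of independent even vectors $\mathbf u_1,\dots,\mathbf u_r$ spanning the plane. In the chart where the submatrix $U^{\underline a}$ formed by even columns $\underline a=(a_1<\dots<a_r)$ is invertible, local coordinates are the entries of $(U^{\underline a})^{-1}U$. $\Lambda^r(V)$ is the $r$-th graded component of $\Lambda(V)=T(V)/\langle v\otimes w+(-1)^{\tilde v\tilde w}w\otimes v\rangle$ ($\tilde v$ is the parity of $v$). The projective superspace $P(W)$ of a superspace $W$ is the supermanifold of $1|0$-dimensional subspaces of $W$: homogeneous coordinates are the linear coordinates of an even vector of $W$ with at least one even coordinate invertible, up to a common invertible even factor. The map is well defined since replacing the basis $\mathbf u_i$ by $g\in \mathrm{GL}(r)$ multiplies the multivector by $\det g$, and some component of $\mathbf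 u_1\wedge\dots\wedge\mathbf u_r$ with all indices even is invertible. Up to the factor $r!$ the multivector is the function $(p^1,\dots,p^r)\mapsto\det(\langle\mathbf u_i,p^j\rangle)$ of $r$ covectors. *)

theory Defs
  imports "HOL-Algebra.QuotRing" "HOL-Algebra.Module"
begin

section \<open>Commutative superalgebras\<close>

record ('k, 'u) superalgebra = "('k, 'u) module" +
  even_part :: "'u set"
  odd_part :: "'u set"

text \<open>Parities are natural numbers read modulo 2.\<close>

definition part :: "('k, 'u) superalgebra \<Rightarrow> nat \<Rightarrow> 'u set" where
  "part A p = (if even p then even_part A else odd_part A)"

definition signed :: "('a, 'b) ring_scheme \<Rightarrow> nat \<Rightarrow> 'a \<Rightarrow> 'a" where
  "signed R p a = (if even p then a else \<ominus>\<^bsub>R\<^esub> a)"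

locale comm_superalgebra = module K A + A?: ring A
  for K :: "'k ring" and A :: "('k, 'u) superalgebra" (structure) +
  assumes smult_mult_left:
      "\<lbrakk>c \<in> carrier K; x \<in> carrier A; y \<in> carrier A\<rbrakk> \<Longrightarrow> (c \<odot> x) \<otimes> y = c \<odot> (x \<otimes> y)"
    and smult_mult_right:
      "\<lbrakk>c \<in> carrier K; x \<in> carrier A; y \<in> carrier A\<rbrakk> \<Longrightarrow> x \<otimes> (c \<odot> y) = c \<odot> (x \<otimes> y)"
    and submodule_part: "submodule (part A p) K A"
    and parts_sum: "even_part A <+>\<^bsub>A\<^esub> odd_part A = carrier A"
    and parts_direct: "even_part A \<inter> odd_part A = {\<zero>}"
    and one_even: "\<one> \<in> even_part A"
    and mult_part: "\<lbrakk>x \<in> part A p; y \<in> part A q\<rbrakk> \<Longrightarrow> x \<otimes> y \<in> part A (p + q)"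
    and supercommute: "\<lbrakk>x \<in> part A p; y \<in> part A q\<rbrakk> \<Longrightarrow> x \<otimes> y = signed A (p * q) (y \<otimes> x)"

definition superalgebra_hom ::
    "'k ring \<Rightarrow> ('k, 'u) superalgebra \<Rightarrow> ('k, 'u) superalgebra \<Rightarrow> ('u \<Rightarrow> 'u) set" where
  "superalgebra_hom K A B = {f \<in> ring_hom A B.
     (\<forall>c\<in>carrier K. \<forall>x\<in>carrier A. f (c \<odot>\<^bsub>A\<^esub> x) = c \<odot>\<^bsub>B\<^esub> f x) \<and>
     f ` even_part A \<subseteq> even_part B \<and> f ` odd_part A \<subseteq> odd_part B}"

text \<open>The value is \<open>(-1)^(p|a|) a\<close>, extended additively from homogeneous \<open>a\<close>.\<close>

definition twist :: "('k, 'u) superalgebra \<Rightarrow> nat \<Rightarrow> 'u \<Rightarrow> 'u" where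
  "twist A p a = (if even p then a
     else THE b. \<exists>x\<in>even_part A. \<exists>y\<in>odd_part A. a = x \<oplus>\<^bsub>A\<^esub> y \<and> b = x \<ominus>\<^bsub>A\<^esub> y)"


section \<open>Functors of points\<close>

text \<open>
  Superspaces are given by their functors of points on the commutative superalgebras over \<open>K\<close>
  whose carrier is a subset of the type \<open>'u\<close>. The type \<open>'u\<close> plays the role of a universe and is
  arbitrary in all results. A morphism of superspaces is a natural transformation.
\<close>

record ('k, 'u, 'p) superspace =
  pts :: "('k, 'u) superalgebra \<Rightarrow> 'p set"
  pmap :: "('k, 'u) superalgebra \<Rightarrow> ('k, 'u) superalgebra \<Rightarrow> ('u \<Rightarrow> 'u) \<Rightarrow> 'p \<Rightarrow> 'p"

definition point_functor :: "'k ring \<Rightarrow> ('k, 'u, 'p) superspace \<Rightarrow> bool" where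
  "point_functor K X \<longleftrightarrow>
    (\<forall>A B f x. comm_superalgebra K A \<and> comm_superalgebra K B \<and> f \<in> superalgebra_hom K A B \<and>
        x \<in> pts X A \<longrightarrow> pmap X A B f x \<in> pts X B) \<and>
    (\<forall>A x. comm_superalgebra K A \<and> x \<in> pts X A \<longrightarrow> pmap X A A (\<lambda>a. a) x = x) \<and>
    (\<forall>A B C f g x. comm_superalgebra K A \<and> comm_superalgebra K B \<and> comm_superalgebra K C \<and>
        f \<in> superalgebra_hom K A B \<and> g \<in> superalgebra_hom K B C \<and> x \<in> pts X A \<longrightarrow>
        pmap X A C (\<lambda>a. g (f a)) x = pmap X B C g (pmap X A B f x))"

definition natural ::
    "'k ring \<Rightarrow> ('k, 'u, 'p) superspace \<Rightarrow> ('k, 'u, 'q) superspace \<Rightarrow>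
     (('k, 'u) superalgebra \<Rightarrow> 'p \<Rightarrow> 'q) \<Rightarrow> bool" where
  "natural K X Y F \<longleftrightarrow>
    (\<forall>A x. comm_superalgebra K A \<and> x \<in> pts X A \<longrightarrow> F A x \<in> pts Y A) \<and>
    (\<forall>A B f x. comm_superalgebra K A \<and> comm_superalgebra K B \<and> f \<in> superalgebra_hom K A B \<and>
        x \<in> pts X A \<longrightarrow> F B (pmap X A B f x) = pmap Y A B f (F A x))"

text \<open>
  A subfunctor \<open>U\<close> of \<open>Y\<close> is open (closed) if its inverse image under each \<open>y \<in> Y(A)\<close> is the
  locus where some set of elements of \<open>A\<close> generates the unit ideal (vanishes).
\<close>

definition open_subfunctor ::
    "'k ring \<Rightarrow> ('k, 'u, 'p) superspace \<Rightarrow> (('k, 'u) superalgebra \<Rightarrow> 'p set) \<Rightarrow> bool" where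
  "open_subfunctor K Y U \<longleftrightarrow>
    (\<forall>A. comm_superalgebra K A \<longrightarrow> U A \<subseteq> pts Y A \<and>
      (\<forall>y\<in>pts Y A. \<exists>S\<subseteq>even_part A. \<forall>B f. comm_superalgebra K B \<and> f \<in> superalgebra_hom K A B \<longrightarrow>
         (pmap Y A B f y \<in> U B \<longleftrightarrow> Idl\<^bsub>B\<^esub> (f ` S) = carrier B)))"

definition closed_subfunctor ::
    "'k ring \<Rightarrow> ('k, 'u, 'p) superspace \<Rightarrow> (('k, 'u) superalgebra \<Rightarrow> 'p set) \<Rightarrow> bool" where
  "closed_subfunctor K Y Z \<longleftrightarrow>
    (\<forall>A. comm_superalgebra K A \<longrightarrow> Z A \<subseteq> pts Y A \<and>
      (\<forall>y\<in>pts Y A. \<exists>S\<subseteq>carrier A. \<forall>B f. comm_superalgebra K B \<and> f \<in> superalgebra_hom K A B \<longrightarrow>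
         (pmap Y A B f y \<in> Z B \<longleftrightarrow> f ` S \<subseteq> {\<zero>\<^bsub>B\<^esub>})))"

definition image_pts ::
    "('k, 'u, 'p) superspace \<Rightarrow> (('k, 'u) superalgebra \<Rightarrow> 'p \<Rightarrow> 'q) \<Rightarrow>
     ('k, 'u) superalgebra \<Rightarrow> 'q set" where
  "image_pts X F A = F A ` pts X A"

text \<open>
  An embedding is a morphism that has an inverse morphism on its image, the image being a
  locally closed subspace of the target. The inverse on the image alone only says that \<open>F\<close> is a
  monomorphism; local closedness is what makes the image a subspace.
\<close>

definition embedding ::
    "'k ring \<Rightarrow> ('k, 'u, 'p) superspace \<Rightarrow> ('k, 'u, 'q) superspace \<Rightarrow>
     (('k, 'u) superalgebra \<Rightarrow> 'p \<Rightarrow> 'q) \<Rightarrow> bool" where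
  "embedding K X Y F \<longleftrightarrow>
    point_functor K X \<and> point_functor K Y \<and> natural K X Y F \<and>
    (\<exists>G. natural K (Y\<lparr>pts := image_pts X F\<rparr>) X G \<and>
      (\<forall>A. comm_superalgebra K A \<longrightarrow>
        (\<forall>x\<in>pts X A. G A (F A x) = x) \<and> (\<forall>y\<in>image_pts X F A. F A (G A y) = y))) \<and>
    (\<exists>\<U>. (\<forall>U\<in>\<U>. open_subfunctor K Y U \<and>
              closed_subfunctor K (Y\<lparr>pts := U\<rparr>) (\<lambda>A. U A \<inter> image_pts X F A)) \<and>
          (\<forall>A. comm_superalgebra K A \<longrightarrow> image_pts X F A \<subseteq> (\<Union>U\<in>\<U>. U A)))"


section \<open>The exterior algebra\<close>

text \<open>
  \<open>V\<close> has a basis of vectors \<open>e\<^sub>i\<close> with \<open>i < n + m\<close>, even for \<open>i < n\<close> and odd otherwise.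
  A tensor \<open>t\<close> over \<open>A\<close> is the finite sum of the terms \<open>t w \<cdot> e\<^sub>w\<close>, where \<open>e\<^sub>w\<close> is the tensor
  product of the basis vectors whose indices form the word \<open>w\<close>.
\<close>

definition word_parity :: "nat \<Rightarrow> nat list \<Rightarrow> nat" where
  "word_parity n w = length (filter (\<lambda>i. n \<le> i) w)"

text \<open>The product follows the rule \<open>(a \<cdot> e\<^sub>v) (b \<cdot> e\<^sub>w) = (-1)^(|v||b|) a b \<cdot> e\<^sub>v\<^sub>w\<close>.\<close>

definition tensor_alg :: "nat \<Rightarrow> nat \<Rightarrow> ('k, 'u) superalgebra \<Rightarrow> (nat list \<Rightarrow> 'u) ring" where
  "tensor_alg n m A =
    \<lparr>carrier = {t. (\<forall>w. t w \<in> carrier A) \<and> finite {w. t w \<noteq> \<zero>\<^bsub>A\<^esub>} \<and>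
                   (\<forall>w. t w \<noteq> \<zero>\<^bsub>A\<^esub> \<longrightarrow> set w \<subseteq> {..<n + m})},
     mult = (\<lambda>s t w. \<Oplus>\<^bsub>A\<^esub>k\<in>{..length w}.
               s (take k w) \<otimes>\<^bsub>A\<^esub> twist A (word_parity n (take k w)) (t (drop k w))),
     one = (\<lambda>w. if w = [] then \<one>\<^bsub>A\<^esub> else \<zero>\<^bsub>A\<^esub>),
     zero = (\<lambda>w. \<zero>\<^bsub>A\<^esub>),
     add = (\<lambda>s t w. s w \<oplus>\<^bsub>A\<^esub> t w)\<rparr>"

definition homogeneous_tensors :: "nat \<Rightarrow> nat \<Rightarrow> nat \<Rightarrow> ('k, 'u) superalgebra \<Rightarrow> (nat list \<Rightarrow> 'u) set" where
  "homogeneous_tensors n m r A =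
    {t \<in> carrier (tensor_alg n m A). \<forall>w. t w \<noteq> \<zero>\<^bsub>A\<^esub> \<longrightarrow> length w = r}"

definition vectors :: "nat \<Rightarrow> nat \<Rightarrow> ('k, 'u) superalgebra \<Rightarrow> nat \<Rightarrow> (nat list \<Rightarrow> 'u) set" where
  "vectors n m A p = {v \<in> homogeneous_tensors n m 1 A. \<forall>w. v w \<in> part A (p + word_parity n w)}"

definition ext_relations :: "nat \<Rightarrow> nat \<Rightarrow> ('k, 'u) superalgebra \<Rightarrow> (nat list \<Rightarrow> 'u) set" where
  "ext_relations n m A = (let T = tensor_alg n m A in
     {(v \<otimes>\<^bsub>T\<^esub> w) \<oplus>\<^bsub>T\<^esub> signed T (p * q) (w \<otimes>\<^bsub>T\<^esub> v) | p q v w.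
        v \<in> vectors n m A p \<and> w \<in> vectors n m A q})"

definition ext_ideal :: "nat \<Rightarrow> nat \<Rightarrow> ('k, 'u) superalgebra \<Rightarrow> (nat list \<Rightarrow> 'u) set" where
  "ext_ideal n m A = Idl\<^bsub>tensor_alg n m A\<^esub> (ext_relations n m A)"

definition ext_alg :: "nat \<Rightarrow> nat \<Rightarrow> ('k, 'u) superalgebra \<Rightarrow> (nat list \<Rightarrow> 'u) set ring" where
  "ext_alg n m A = tensor_alg n m A Quot ext_ideal n m A"

definition ext_class ::
    "nat \<Rightarrow> nat \<Rightarrow> ('k, 'u) superalgebra \<Rightarrow> (nat list \<Rightarrow> 'u) \<Rightarrow> (nat list \<Rightarrow> 'u) set" where
  "ext_class n m A t = ext_ideal n m A +>\<^bsub>tensor_alg n m A\<^esub> t"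

definition ext_power ::
    "nat \<Rightarrow> nat \<Rightarrow> nat \<Rightarrow> ('k, 'u) superalgebra \<Rightarrow> (nat list \<Rightarrow> 'u) set set" where
  "ext_power n m r A = ext_class n m A ` homogeneous_tensors n m r A"

text \<open>
  The words that index the standard basis of \<open>\<Lambda>\<^sup>r(V)\<close>: even indices anticommute among themselves
  and with odd ones, odd indices commute among themselves and may be repeated.
\<close>

definition basis_words :: "nat \<Rightarrow> nat \<Rightarrow> nat \<Rightarrow> nat list set" where
  "basis_words n m r =
    {w. length w = r \<and> set w \<subseteq> {..<n + m} \<and> sorted w \<and> distinct (filter (\<lambda>i. i < n) w)}"

text \<open>\<open>c\<close> is the family of coordinates of \<open>\<omega>\<close>, that is, \<open>\<omega> = \<Sum>\<^sub>w c w \<cdot> e\<^sub>w\<close> over basis words.\<close>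

definition ext_coordinates ::
    "nat \<Rightarrow> nat \<Rightarrow> nat \<Rightarrow> ('k, 'u) superalgebra \<Rightarrow> (nat list \<Rightarrow> 'u) set \<Rightarrow> (nat list \<Rightarrow> 'u) \<Rightarrow> bool" where
  "ext_coordinates n m r A \<omega> c \<longleftrightarrow>
    (\<forall>w. c w \<in> carrier A) \<and> (\<forall>w. w \<notin> basis_words n m r \<longrightarrow> c w = \<zero>\<^bsub>A\<^esub>) \<and> \<omega> = ext_class n m A c"


section \<open>The projective superspace of \<open>\<Lambda>\<^sup>r(V)\<close>\<close>

definition even_units :: "('k, 'u) superalgebra \<Rightarrow> 'u set" where
  "even_units A = even_part A \<inter> Units A"

definition scalar :: "('k, 'u) superalgebra \<Rightarrow> 'u \<Rightarrow> nat list \<Rightarrow> 'u" where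
  "scalar A a = (\<lambda>w. if w = [] then a else \<zero>\<^bsub>A\<^esub>)"

definition proj_class ::
    "nat \<Rightarrow> nat \<Rightarrow> ('k, 'u) superalgebra \<Rightarrow> (nat list \<Rightarrow> 'u) set \<Rightarrow> (nat list \<Rightarrow> 'u) set set" where
  "proj_class n m A \<omega> =
    {ext_class n m A (scalar A a) \<otimes>\<^bsub>ext_alg n m A\<^esub> \<omega> | a. a \<in> even_units A}"

definition proj_vectors ::
    "nat \<Rightarrow> nat \<Rightarrow> nat \<Rightarrow> ('k, 'u) superalgebra \<Rightarrow> (nat list \<Rightarrow> 'u) set set" where
  "proj_vectors n m r A = {\<omega> \<in> ext_power n m r A. \<exists>c. ext_coordinates n m r A \<omega> c \<and>
     (\<forall>w. c w \<in> part A (word_parity n w)) \<and>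
     (\<exists>w\<in>basis_words n m r. even (word_parity n w) \<and> c w \<in> Units A)}"

definition proj_ext_power ::
    "nat \<Rightarrow> nat \<Rightarrow> nat \<Rightarrow> ('k, 'u, (nat list \<Rightarrow> 'u) set set) superspace" where
  "proj_ext_power n m r =
    \<lparr>pts = (\<lambda>A. proj_class n m A ` proj_vectors n m r A),
     pmap = (\<lambda>A B f l. \<Union>\<omega>\<in>l. \<Union>t\<in>\<omega>. proj_class n m B (ext_class n m B (\<lambda>w. f (t w))))\<rparr>"


section \<open>The super Grassmannian of \<open>r|0\<close>-planes\<close>

text \<open>
  Matrices are zero outside their index range. The columns \<open>j < n\<close> are even, the columns
  \<open>n \<le> j < n + m\<close> are odd.
\<close>

definition supermatrices :: "nat \<Rightarrow> nat \<Rightarrow> nat \<Rightarrow> ('k, 'u) superalgebra \<Rightarrow> (nat \<Rightarrow> nat \<Rightarrow> 'u) set" where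
  "supermatrices r n m A =
    {U. (\<forall>i<r. \<forall>j<n + m. U i j \<in> (if j < n then even_part A else odd_part A)) \<and>
        (\<forall>i j. \<not> (i < r \<and> j < n + m) \<longrightarrow> U i j = \<zero>\<^bsub>A\<^esub>)}"

definition mat_mult ::
    "('k, 'u) superalgebra \<Rightarrow> nat \<Rightarrow> (nat \<Rightarrow> nat \<Rightarrow> 'u) \<Rightarrow> (nat \<Rightarrow> nat \<Rightarrow> 'u) \<Rightarrow> nat \<Rightarrow> nat \<Rightarrow> 'u" where
  "mat_mult A r g U = (\<lambda>i j. \<Oplus>\<^bsub>A\<^esub>k\<in>{..<r}. g i k \<otimes>\<^bsub>A\<^esub> U k j)"

definition mat_one :: "('k, 'u) superalgebra \<Rightarrow> nat \<Rightarrow> nat \<Rightarrow> nat \<Rightarrow> 'u" where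
  "mat_one A r = (\<lambda>i j. if i < r \<and> i = j then \<one>\<^bsub>A\<^esub> else \<zero>\<^bsub>A\<^esub>)"

definition GL :: "nat \<Rightarrow> ('k, 'u) superalgebra \<Rightarrow> (nat \<Rightarrow> nat \<Rightarrow> 'u) set" where
  "GL r A = {g \<in> supermatrices r r 0 A. \<exists>h\<in>supermatrices r r 0 A.
     mat_mult A r g h = mat_one A r \<and> mat_mult A r h g = mat_one A r}"

definition columns ::
    "('k, 'u) superalgebra \<Rightarrow> nat \<Rightarrow> (nat \<Rightarrow> nat \<Rightarrow> 'u) \<Rightarrow> nat list \<Rightarrow> nat \<Rightarrow> nat \<Rightarrow> 'u" where
  "columns A r U a = (\<lambda>i j. if i < r \<and> j < r then U i (a ! j) else \<zero>\<^bsub>A\<^esub>)"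

definition frames :: "nat \<Rightarrow> nat \<Rightarrow> nat \<Rightarrow> ('k, 'u) superalgebra \<Rightarrow> (nat \<Rightarrow> nat \<Rightarrow> 'u) set" where
  "frames n m r A = {U \<in> supermatrices r n m A.
     \<exists>a. length a = r \<and> sorted_wrt (<) a \<and> set a \<subseteq> {..<n} \<and> columns A r U a \<in> GL r A}"

definition plane ::
    "('k, 'u) superalgebra \<Rightarrow> nat \<Rightarrow> (nat \<Rightarrow> nat \<Rightarrow> 'u) \<Rightarrow> (nat \<Rightarrow> nat \<Rightarrow> 'u) set" where
  "plane A r U = (\<lambda>g. mat_mult A r g U) ` GL r A"

definition super_grassmannian ::
    "nat \<Rightarrow> nat \<Rightarrow> nat \<Rightarrow> ('k, 'u, (nat \<Rightarrow> nat \<Rightarrow> 'u) set) superspace" where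
  "super_grassmannian n m r =
    \<lparr>pts = (\<lambda>A. plane A r ` frames n m r A),
     pmap = (\<lambda>A B f L. \<Union>U\<in>L. plane B r (\<lambda>i j. f (U i j)))\<rparr>"


section \<open>The super Pluecker map\<close>

definition row_vector :: "('k, 'u) superalgebra \<Rightarrow> (nat \<Rightarrow> nat \<Rightarrow> 'u) \<Rightarrow> nat \<Rightarrow> nat list \<Rightarrow> 'u" where
  "row_vector A U i = (\<lambda>w. case w of [j] \<Rightarrow> U i j | _ \<Rightarrow> \<zero>\<^bsub>A\<^esub>)"

definition multivector ::
    "nat \<Rightarrow> nat \<Rightarrow> nat \<Rightarrow> ('k, 'u) superalgebra \<Rightarrow> (nat \<Rightarrow> nat \<Rightarrow> 'u) \<Rightarrow> (nat list \<Rightarrow> 'u) set" where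
  "multivector n m r A U =
    foldr (\<lambda>i \<omega>. ext_class n m A (row_vector A U i) \<otimes>\<^bsub>ext_alg n m A\<^esub> \<omega>) [0..<r] \<one>\<^bsub>ext_alg n m A\<^esub>"

text \<open>
  The union over all frames \<open>U\<close> of \<open>L\<close> can only be a point of the projective superspace if
  the class does not depend on the frame.
\<close>

definition plucker ::
    "nat \<Rightarrow> nat \<Rightarrow> nat \<Rightarrow> ('k, 'u) superalgebra \<Rightarrow>
     (nat \<Rightarrow> nat \<Rightarrow> 'u) set \<Rightarrow> (nat list \<Rightarrow> 'u) set set" where
  "plucker n m r A L = (\<Union>U\<in>L. proj_class n m A (multivector n m r A U))"

end

theory Submission
  imports Defs "HOL-Library.Multiset"
begin

text \<open>
  Call two words equivalent if they are permutations of each other, and let the sorting sign of a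
  word be the Koszul sign of its sorting permutation, or 0 if an even letter is repeated. For a
  tensor \<open>t\<close> the signed sum of the coefficients \<open>t w\<close> over the words \<open>w\<close> equivalent to
  \<open>b\<close> vanishes on the ideal of the exterior algebra, because exchanging two neighbouring letters
  reverses the sign of every summand and 2 is invertible. These sums are therefore coordinates on
  \<open>\<Lambda>\<^sup>r(V)\<close>, and sorting words shows that they determine a multivector.

  If the minor of a frame at the even columns \<open>a\<close> is invertible, the frame may be multiplied by the
  inverse matrix, so that its columns \<open>a\<close> form the identity. Its other entries, odd ones included,
  are then up to sign the coordinates of the multivector at the words obtained from \<open>a\<close> by replacing
  one letter. This gives the inverse of the Pluecker map, and on the open locus where the coordinate
  at \<open>a\<close> is invertible it describes the image by the equations stating that the multivector
  is that of the matrix read off from it.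
\<close>

text \<open>The exterior power is given only as a graded piece of a quotient by a two-sided ideal,
  so independence of the basis words has to be proved: this is what functionals on tensors that kill
  the ideal provide. Invertibility of 2 is needed a second time, since the relations give only
  \<open>v v = - v v\<close> for an even vector.

  The coefficients do not commute, but minors in even columns are even and hence central. The scalar
  by which a square matrix acts on all multivectors serves as its determinant. For a matrix with a
  right inverse it is found to be a unit by evaluation at the frame (1|0), whose leading coordinate
  is 1; Cramer's rule comes from multilinearity in the rows. Odd entries never enter such a minor,
  yet they are visible: a word with one even letter replaced by an odd one contains that odd letter
  once, so its coordinate is linear in the odd entry.

  Local closedness cannot be replaced by closedness along this route: the loci with an invertible
  coordinate at a purely even word cover the image, but in general not the target, where the only
  invertible coordinates may sit at words with a positive even number of odd letters.\<close>

section \<open>Koszul signs of sorting a word\<close>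

definition exchange_sign :: "nat \<Rightarrow> nat \<Rightarrow> nat \<Rightarrow> int" where
  "exchange_sign n a b = (if n \<le> a \<and> n \<le> b then 1 else - 1)"

text \<open>The factor contributed by a letter \<open>a\<close> standing somewhere to the left of
  \<open>b\<close>. The value 0 for a repeated even letter is compatible with the sign -1 that
  \<open>exchange_sign\<close> has there, so the swap rules below hold without exceptions.\<close>

definition passing_sign :: "nat \<Rightarrow> nat \<Rightarrow> nat \<Rightarrow> int" where
  "passing_sign n a b = (if b < a then exchange_sign n a b else if a = b \<and> a < n then 0 else 1)"

text \<open>A product over all pairs of positions, so that no particular way of sorting
  enters.\<close>

fun sorting_sign :: "nat \<Rightarrow> nat list \<Rightarrow> int" where
  "sorting_sign n [] = 1"
| "sorting_sign n (a # w) = prod_list (map (passing_sign n a) w) * sorting_sign n w"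

lemma exchange_sign_square [simp]: "exchange_sign n a b * exchange_sign n a b = 1"
  by (simp add: exchange_sign_def)

lemma passing_sign_swap: "passing_sign n a b = exchange_sign n a b * passing_sign n b a"
  by (auto simp: passing_sign_def exchange_sign_def)

lemma prod_list_mset_cong:
  fixes f :: "'a \<Rightarrow> int"
  shows "mset u = mset v \<Longrightarrow> prod_list (map f u) = prod_list (map f v)"
  by (metis mset_map prod_mset_prod_list)

text \<open>Only the pair formed by the two neighbours changes its factor: a letter further left
  still passes the same multiset of letters, and nothing changes for the letters to the
  right.\<close>

lemma sorting_sign_swap:
  "sorting_sign n (u @ a # b # z) = exchange_sign n a b * sorting_sign n (u @ b # a # z)"
proof (induction u)
  case Nil
  show ?case using passing_sign_swap[of n a b] by (simp add: algebra_simps)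
next
  case (Cons c u)
  have "prod_list (map (passing_sign n c) (u @ a # b # z))
    = prod_list (map (passing_sign n c) (u @ b # a # z))"
    by (rule prod_list_mset_cong) simp
  then show ?case using Cons by (simp add: algebra_simps)
qed

text \<open>With only three values, signs can be carried through any map that respects negation and
  zero.\<close>

lemma sorting_sign_cases: "sorting_sign n w \<in> {-1, 0, 1}"
proof (induction w)
  case (Cons a w)
  have "prod_list (map (passing_sign n a) v) \<in> {-1, 0, 1}" for v
  proof (induction v)
    case (Cons b v)
    have "passing_sign n a b \<in> {-1, 0, 1}"
      by (simp add: passing_sign_def exchange_sign_def)
    with Cons show ?case by auto
  qed simp
  from this[of w] Cons show ?case by auto
qed simp

lemma sorting_sign_nonzero_imp_distinct:
  "sorting_sign n w \<noteq> 0 \<Longrightarrow> distinct (filter (\<lambda>i. i < n) w)"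
proof (induction w)
  case (Cons a w)
  have "a \<notin> set w" if "a < n"
  proof
    assume "a \<in> set w"
    moreover have "passing_sign n a a = 0" using that by (simp add: passing_sign_def)
    ultimately have "prod_list (map (passing_sign n a) w) = 0"
      by (force simp: prod_list_zero_iff)
    with Cons.prems show False by simp
  qed
  with Cons show ?case by auto
qed simp

text \<open>On distinct words the sign is its own inverse. This is what allows a matrix entry to be
  recovered from a signed coordinate.\<close>

lemma sorting_sign_distinct:
  "distinct w \<Longrightarrow> sorting_sign n w * sorting_sign n w = 1"
proof (induction w)
  case (Cons a w)
  have "prod_list (map (passing_sign n a) v) * prod_list (map (passing_sign n a) v) = 1"
    if "a \<notin> set v" for v
    using that
  proof (induction v)
    case (Cons b v)
    have "passing_sign n a b * passing_sign n a b = 1"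
      using Cons.prems by (simp add: passing_sign_def)
    moreover have "(x * y) * (x * y) = (x * x) * (y * y)" for x y :: int by simp
    ultimately show ?case using Cons by (simp only: list.map prod_list.Cons) simp
  qed simp
  from this[of w] Cons show ?case
    by (simp add: algebra_simps)
qed simp

lemma sorting_sign_sorted:
  "sorted w \<Longrightarrow> distinct (filter (\<lambda>i. i < n) w) \<Longrightarrow> sorting_sign n w = 1"
proof (induction w)
  case (Cons a w)
  have "passing_sign n a b = 1" if "b \<in> set w" for b
  proof -
    have "a \<le> b" using Cons.prems(1) that by simp
    moreover have "a \<noteq> b \<or> \<not> a < n" using Cons.prems(2) that by (auto split: if_splits)
    ultimately show ?thesis by (auto simp: passing_sign_def)
  qed
  then have "map (passing_sign n a) w = map (\<lambda>b. 1) w" by simp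
  then have "prod_list (map (passing_sign n a) w) = 1" by (simp add: map_replicate_const)
  with Cons show ?case by (simp split: if_splits)
qed simp

section \<open>Sorting products of supercommuting elements\<close>

lemma (in abelian_group) int_smult_simps:
  assumes "x \<in> carrier G"
  shows "[(k::int)] \<cdot> x \<in> carrier G" "[(1::int)] \<cdot> x = x" "[(- 1::int)] \<cdot> x = \<ominus> x" "[(0::int)] \<cdot> x
    = \<zero>"
    "[k] \<cdot> ([(l::int)] \<cdot> x) = [(k * l)] \<cdot> x"
  using assms add.int_pow_neg[of x 1] add.int_pow_pow[of x k l] int_pow_0[of "add_monoid G" x,
    folded add_pow_def]
  by (simp_all add: mult.commute)

lemma (in abelian_group) int_smult_zero [simp]: "[(k::int)] \<cdot> \<zero> = \<zero>"
  by (rule add.int_pow_one)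

lemma (in abelian_group) int_smult_distrib:
  assumes "x \<in> carrier G" "y \<in> carrier G"
  shows "[(k::int)] \<cdot> (x \<oplus> y) = [k] \<cdot> x \<oplus> [k] \<cdot> y"
  using assms by (rule add.int_pow_distrib)

lemma (in abelian_group) int_smult_finsum:
  "f \<in> I \<rightarrow> carrier G \<Longrightarrow> [(k::int)] \<cdot> (\<Oplus>i\<in>I. f i) = (\<Oplus>i\<in>I. [k] \<cdot> f i)"
proof (induction I rule: infinite_finite_induct)
  case (insert i I)
  then have "f i \<in> carrier G" "f \<in> I \<rightarrow> carrier G" by auto
  with insert show ?case by (simp add: int_smult_distrib int_smult_simps Pi_def)
qed auto

definition word_prod :: "('a, 'b) ring_scheme \<Rightarrow> (nat \<Rightarrow> 'a) \<Rightarrow> nat list \<Rightarrow> 'a" where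
  "word_prod R x w = foldr (\<lambda>i y. x i \<otimes>\<^bsub>R\<^esub> y) w \<one>\<^bsub>R\<^esub>"

lemma word_prod_simps [simp]:
  "word_prod R x [] = \<one>\<^bsub>R\<^esub>"
  "word_prod R x (i # w) = x i \<otimes>\<^bsub>R\<^esub> word_prod R x w"
  by (simp_all add: word_prod_def)

lemma (in ring) word_prod_closed:
  "(\<And>i. i \<in> set w \<Longrightarrow> x i \<in> carrier R) \<Longrightarrow> word_prod R x w \<in> carrier R"
  by (induction w) auto

lemma word_prod_map: "word_prod R x (map f w) = word_prod R (\<lambda>i. x (f i)) w"
  by (induction w) auto

text \<open>Insertion sort, with \<open>ins\<close> moving one factor through a sorted product. It
  serves twice: for the basis vectors of both parities, and for the rows of a frame, where the
  threshold is \<open>r\<close> so that all row indices count as even.\<close>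

lemma (in ring) word_prod_sort:
  assumes x: "\<And>a. a \<in> S \<Longrightarrow> x a \<in> carrier R"
    and comm: "\<And>a b. a \<in> S \<Longrightarrow> b \<in> S \<Longrightarrow> x a \<otimes> x b = [(exchange_sign n a b)] \<cdot> (x b \<otimes> x a)"
    and sq: "\<And>a. a \<in> S \<Longrightarrow> a < n \<Longrightarrow> x a \<otimes> x a = \<zero>"
    and "set w \<subseteq> S"
  shows "word_prod R x w = [(sorting_sign n w)] \<cdot> word_prod R x (sort w)"
proof -
  have cl: "word_prod R x v \<in> carrier R" if "set v \<subseteq> S" for v
    using that x by (auto intro!: word_prod_closed)
  have ins: "x a \<otimes> word_prod R x v = [(prod_list (map (passing_sign n a) v))] \<cdot> word_prod R x
    (insort a v)"
    if "sorted v" "set v \<subseteq> S" "a \<in> S" for a v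
    using that(1,2)
  proof (induction v)
    case Nil
    show ?case using x[OF that(3)] by (simp add: int_smult_simps)
  next
    case (Cons b v)
    then have b: "b \<in> S" "set v \<subseteq> S" by auto
    note c = x[OF that(3)] x[OF b(1)] cl[OF b(2)]
    consider "a < b" | "a = b" "a < n" | "a = b" "n \<le> a" | "b < a" by linarith
    then show ?case
    proof cases
      case 1
      have "map (passing_sign n a) (b # v) = map (\<lambda>b. 1) (b # v)"
        using Cons.prems 1 by (auto simp: passing_sign_def)
      then have "prod_list (map (passing_sign n a) (b # v)) = 1"
        by (simp only:) (simp add: map_replicate_const)
      then show ?thesis using 1 c by (simp add: int_smult_simps del: list.map prod_list.Cons)
    next
      case 2
      then have "passing_sign n a b = 0" by (simp add: passing_sign_def)
      moreover have "x a \<otimes> (x b \<otimes> word_prod R x v) = \<zero>"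
        using c sq[OF that(3)] 2 by (simp flip: m_assoc)
      ultimately show ?thesis using 2 c by (simp add: int_smult_simps)
    next
      case 3
      have "map (passing_sign n a) (b # v) = map (\<lambda>b. 1) (b # v)"
        using Cons.prems 3 by (auto simp: passing_sign_def)
      then have "prod_list (map (passing_sign n a) (b # v)) = 1"
        by (simp only:) (simp add: map_replicate_const)
      then show ?thesis using 3 c by (simp add: int_smult_simps del: list.map prod_list.Cons)
    next
      case 4
      let ?p = "prod_list (map (passing_sign n a) v)"
      have i: "word_prod R x (insort a v) \<in> carrier R"
        by (rule cl) (use b that in \<open>auto simp: set_insort_key\<close>)
      have "x a \<otimes> (x b \<otimes> word_prod R x v) = [(exchange_sign n a b)] \<cdot> (x b \<otimes> x a) \<otimes> word_prod R x v"
        using c comm[OF that(3) b(1)] by (simp flip: m_assoc)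
      also have "\<dots> = [(exchange_sign n a b)] \<cdot> (x b \<otimes> (x a \<otimes> word_prod R x v))"
        using c by (simp add: add_pow_ldistr_int m_assoc)
      also have "x a \<otimes> word_prod R x v = [?p] \<cdot> word_prod R x (insort a v)"
        using Cons b by simp
      also have "x b \<otimes> \<dots> = [?p] \<cdot> (x b \<otimes> word_prod R x (insort a v))"
        using c i by (simp add: add_pow_rdistr_int)
      finally show ?thesis using 4 c i by (simp add: int_smult_simps passing_sign_def[of n a b])
    qed
  qed
  show ?thesis using assms(4)
  proof (induction w)
    case Nil
    show ?case by (simp add: int_smult_simps)
  next
    case (Cons a w)
    then have a: "a \<in> S" "set w \<subseteq> S" by auto
    have s: "word_prod R x (sort w) \<in> carrier R" "word_prod R x (insort a (sort w)) \<in> carrier R"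
      by (rule cl, use a in \<open>auto simp: set_insort_key\<close>)+
    have "x a \<otimes> word_prod R x w = [(sorting_sign n w)] \<cdot> (x a \<otimes> word_prod R x (sort w))"
      using Cons a x s by (simp add: add_pow_rdistr_int)
    also have "x a \<otimes> word_prod R x (sort w)
        = [(prod_list (map (passing_sign n a) (sort w)))] \<cdot> word_prod R x (insort a (sort w))"
      using a by (intro ins) auto
    \<comment> \<open>The recursion of \<open>sorting_sign\<close> compares \<open>a\<close> with
      the unsorted tail, while the insertion meets the sorted one; the product depends on the
      multiset only.\<close>
    also have "prod_list (map (passing_sign n a) (sort w)) = prod_list (map (passing_sign n a) w)"
      by (rule prod_list_mset_cong) simp
    finally show ?case using s by (simp add: int_smult_simps mult.commute)
  qed
qed

section \<open>Superalgebras in which two is invertible\<close>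

text \<open>The ground field is replaced by the one consequence that matters from here on, an even
  element which is half of the unit. Parities remain natural numbers modulo 2.\<close>

locale half_superalgebra = ring A for A :: "('k, 'u) superalgebra" (structure) +
  assumes part_subset: "part A p \<subseteq> carrier A"
    and part_zero: "\<zero> \<in> part A p"
    and part_add: "x \<in> part A p \<Longrightarrow> y \<in> part A p \<Longrightarrow> x \<oplus> y \<in> part A p"
    and part_neg: "x \<in> part A p \<Longrightarrow> \<ominus> x \<in> part A p"
    and part_cases: "x \<in> carrier A \<Longrightarrow> \<exists>y\<in>part A 0. \<exists>z\<in>part A 1. x = y \<oplus> z"
    and part_direct: "x \<in> part A 0 \<Longrightarrow> x \<in> part A 1 \<Longrightarrow> x = \<zero>"
    and part_one: "\<one> \<in> part A 0"
    and part_mult: "x \<in> part A p \<Longrightarrow> y \<in> part A q \<Longrightarrow> x \<otimes> y \<in> part A (p + q)"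
    and part_commute: "x \<in> part A p \<Longrightarrow> y \<in> part A q \<Longrightarrow> x \<otimes> y = signed A (p * q) (y \<otimes> x)"
    and half: "\<exists>h\<in>part A 0. h \<oplus> h = \<one>"

lemma (in comm_superalgebra) half_superalgebra:
  assumes "field K" "[(2::nat)] \<cdot>\<^bsub>K\<^esub> \<one>\<^bsub>K\<^esub> \<noteq> \<zero>\<^bsub>K\<^esub>"
  shows "half_superalgebra A"
proof -
  interpret K: field K by fact
  have sub: "subgroup (part A p) (add_monoid A)" and sm: "c \<in> carrier K \<Longrightarrow> x \<in> part A p
    \<Longrightarrow> c \<odot> x \<in> part A p" for p c x
    using submodule_part[of p] by (auto simp: submodule_def submodule_axioms_def)
  have z: "[(2::nat)] \<cdot>\<^bsub>K\<^esub> \<one>\<^bsub>K\<^esub> = \<one>\<^bsub>K\<^esub> \<oplus>\<^bsub>K\<^esub> \<one>\<^bsub>K\<^esub>"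
    by (simp add: numeral_2_eq_2)
  \<comment> \<open>One half in the field; its multiple of the unit of \<open>A\<close> is the even
    element required by the locale.\<close>
  define k where "k = inv\<^bsub>K\<^esub> (\<one>\<^bsub>K\<^esub> \<oplus>\<^bsub>K\<^esub> \<one>\<^bsub>K\<^esub>)"
  have u: "\<one>\<^bsub>K\<^esub> \<oplus>\<^bsub>K\<^esub> \<one>\<^bsub>K\<^esub> \<in> Units K" using assms(2) z K.field_Units by auto
  then have k: "k \<in> carrier K" "(\<one>\<^bsub>K\<^esub> \<oplus>\<^bsub>K\<^esub> \<one>\<^bsub>K\<^esub>) \<otimes>\<^bsub>K\<^esub> k = \<one>\<^bsub>K\<^esub>"
    by (auto simp: k_def)
  then have kk: "k \<oplus>\<^bsub>K\<^esub> k = \<one>\<^bsub>K\<^esub>"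
    using k by (simp add: semiring.l_distr[OF R.semiring_axioms])
  have p0: "part A 0 = even_part A" and p1: "part A 1 = odd_part A" by (simp_all add: Defs.part_def)
  show ?thesis
  proof
    fix p q x y
    show "part A p \<subseteq> carrier A" using subgroup.subset[OF sub] by simp
    show "\<zero> \<in> part A p" using subgroup.one_closed[OF sub] by simp
    show "x \<in> part A p \<Longrightarrow> y \<in> part A p \<Longrightarrow> x \<oplus> y \<in> part A p"
      using subgroup.m_closed[OF sub] by simp
    show "x \<in> part A p \<Longrightarrow> \<ominus> x \<in> part A p"
      using subgroup.m_inv_closed[OF sub] by (simp add: a_inv_def)
    show "x \<in> carrier A \<Longrightarrow> \<exists>y\<in>part A 0. \<exists>z\<in>part A 1. x = y \<oplus> z"
      using parts_sum unfolding p0 p1 set_add_def set_mult_def by simp blast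
    show "x \<in> part A 0 \<Longrightarrow> x \<in> part A 1 \<Longrightarrow> x = \<zero>"
      using parts_direct unfolding p0 p1 by auto
    show "\<one> \<in> part A 0" using one_even p0 by simp
    show "x \<in> part A p \<Longrightarrow> y \<in> part A q \<Longrightarrow> x \<otimes> y \<in> part A (p + q)" by (rule mult_part)
    show "x \<in> part A p \<Longrightarrow> y \<in> part A q \<Longrightarrow> x \<otimes> y = signed A (p * q) (y \<otimes> x)" by (rule supercommute)
    have one: "\<one> \<in> carrier A" by simp
    have "k \<odot> \<one> \<oplus> k \<odot> \<one> = \<one>"
      using smult_l_distr[OF k(1) k(1) one] kk smult_one[OF one] by simp
    moreover have "k \<odot> \<one> \<in> part A 0" using sm k one_even p0 by auto
    ultimately show "\<exists>h\<in>part A 0. h \<oplus> h = \<one>" by blast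
  qed
qed

context half_superalgebra
begin

lemma part_cong: "even p = even q \<Longrightarrow> part A p = part A q"
  by (simp add: Defs.part_def)

lemma part_carrier: "x \<in> part A p \<Longrightarrow> x \<in> carrier A"
  using part_subset by blast

lemma signed_int: "x \<in> carrier A \<Longrightarrow> signed A p x = [((- 1) ^ p :: int)] \<cdot> x"
  by (cases "even p") (simp_all add: signed_def int_smult_simps)

lemma part_int: "x \<in> part A p \<Longrightarrow> [(k::int)] \<cdot> x \<in> part A p"
proof -
  assume x: "x \<in> part A p"
  have n: "[(int j)] \<cdot> x \<in> part A p" for j
  proof (induction j)
    case 0
    show ?case using part_zero part_carrier[OF x] by (simp add: int_smult_simps)
  next
    case (Suc j)
    have "[(int j + 1)] \<cdot> x = [(int j)] \<cdot> x \<oplus> x"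
      using part_carrier[OF x] by (simp add: add.int_pow_mult int_smult_simps)
    with Suc x show ?case by (simp add: part_add add.commute)
  qed
  show ?thesis
  proof (cases "0 \<le> k")
    case True then show ?thesis using n[of "nat k"] by simp
  next
    case False
    have "[k] \<cdot> x = [(- 1::int)] \<cdot> ([(int (nat (- k)))] \<cdot> x)"
      using False part_carrier[OF x] by (simp add: int_smult_simps)
    also have "\<dots> = \<ominus> ([(int (nat (- k)))] \<cdot> x)"
      by (rule int_smult_simps) (rule part_carrier[OF n])
    finally show ?thesis using part_neg[OF n[of "nat (- k)"]] by (simp only:)
  qed
qed

lemma part_finsum: "(\<And>i. i \<in> I \<Longrightarrow> f i \<in> part A p) \<Longrightarrow> (\<Oplus>i\<in>I. f i) \<in> part A p"
proof (induction I rule: infinite_finite_induct)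
  case (insert i I)
  then have "(\<Oplus>i\<in>insert i I. f i) = f i \<oplus> (\<Oplus>i\<in>I. f i)"
    by (intro finsum_insert) (auto intro: part_carrier)
  with insert show ?case by (simp add: part_add)
qed (simp_all add: part_zero)

lemma even_commute:
  assumes x: "x \<in> part A 0" and y: "y \<in> carrier A"
  shows "x \<otimes> y = y \<otimes> x"
proof -
  obtain y0 y1 where d: "y0 \<in> part A 0" "y1 \<in> part A 1" "y = y0 \<oplus> y1"
    using part_cases[OF y] by blast
  have "x \<otimes> y0 = y0 \<otimes> x" "x \<otimes> y1 = y1 \<otimes> x"
    using part_commute[OF x d(1)] part_commute[OF x d(2)] by (simp_all add: signed_def)
  then show ?thesis using d x part_carrier by (simp add: r_distr l_distr)
qed

lemma diff_zero_imp_eq: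
  assumes "x \<in> carrier A" "y \<in> carrier A" "x \<ominus> y = \<zero>"
  shows "x = y"
proof -
  have "x = (x \<ominus> y) \<oplus> y" using assms(1,2) by (simp add: minus_eq a_assoc l_neg)
  then show ?thesis using assms by simp
qed

lemma double_eq_zero:
  assumes "x \<in> carrier A" "x = \<ominus> x"
  shows "x = \<zero>"
proof -
  obtain h where h: "h \<in> carrier A" "h \<oplus> h = \<one>" using half part_carrier by blast
  have "x \<oplus> x = \<zero>" using assms by (metis r_neg)
  then have "h \<otimes> (x \<oplus> x) = \<zero>" using h by simp
  then have "(h \<oplus> h) \<otimes> x = \<zero>" using h(1) assms(1) by (simp add: l_distr r_distr)
  then show ?thesis using assms(1) unfolding h(2) by simp
qed

text \<open>Let \<open>y\<close> and \<open>z\<close> be the even and odd components of the inverse.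
  Then \<open>x \<otimes> z\<close> is odd, and as the difference of \<open>\<one>\<close> and
  \<open>x \<otimes> y\<close> it is also even; so it vanishes, and \<open>z\<close> with
  it.\<close>

lemma even_unit_inverse:
  assumes x: "x \<in> part A 0" and u: "x \<in> Units A"
  shows "inv x \<in> part A 0"
proof -
  obtain y z where d: "y \<in> part A 0" "z \<in> part A 1" "inv x = y \<oplus> z"
    using part_cases[OF Units_inv_closed[OF u]] by blast
  note c = part_carrier[OF x] part_carrier[OF d(1)] part_carrier[OF d(2)]
  have "x \<otimes> y \<oplus> x \<otimes> z = \<one>"
    using Units_r_inv[OF u] c by (simp add: d(3) r_distr)
  then have "\<ominus> (x \<otimes> y) \<oplus> \<one> = \<ominus> (x \<otimes> y) \<oplus> (x \<otimes> y \<oplus> x \<otimes> z)" by simp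
  then have "x \<otimes> z = \<ominus> (x \<otimes> y) \<oplus> \<one>" using c by (simp add: r_neg1)
  moreover have "\<ominus> (x \<otimes> y) \<oplus> \<one> \<in> part A 0"
    using part_one part_mult[OF x d(1)] by (simp add: part_add part_neg)
  moreover have "x \<otimes> z \<in> part A 1" using part_mult[OF x d(2)] by simp
  ultimately have "x \<otimes> z = \<zero>" using part_direct by metis
  then have "inv x \<otimes> (x \<otimes> z) = \<zero>" using u by simp
  then have "z = \<zero>" using u c by (simp flip: m_assoc)
  then show ?thesis using d c by simp
qed

lemma even_unitI:
  assumes "x \<in> part A 0" "y \<in> carrier A" "x \<otimes> y = \<one>"
  shows "x \<in> Units A"
  unfolding Units_def using assms even_commute[of x y] part_carrier by auto

text \<open>The description in \<open>twist\<close> denotes a value because homogeneous components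
  are unique: the difference of two even components equals, up to sign, the difference of the odd
  ones, and is therefore both even and odd.\<close>

lemma twist_decomp:
  assumes "y \<in> part A 0" "z \<in> part A 1"
  shows "twist A p (y \<oplus> z) = y \<oplus> [((- 1) ^ p :: int)] \<cdot> z"
proof (cases "even p")
  case True
  then show ?thesis using assms part_carrier by (simp add: twist_def int_smult_simps)
next
  case False
  have p: "even_part A = part A 0" "odd_part A = part A 1" by (simp_all add: Defs.part_def)
  have "b = y \<ominus> z"
    if h: "y' \<in> part A 0" "z' \<in> part A 1" "y \<oplus> z = y' \<oplus> z'" "b = y' \<ominus> z'" for b y' z'
  proof -
    note c = assms[THEN part_carrier] h(1,2)[THEN part_carrier]
    have "y \<ominus> y' = z' \<ominus> z"
    proof -
      have "y \<ominus> y' = (y \<oplus> z) \<oplus> (\<ominus> y' \<oplus> \<ominus> z)"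
        using c by (simp add: minus_eq a_ac r_neg r_neg1 r_neg2)
      also have "\<dots> = (y' \<oplus> z') \<oplus> (\<ominus> y' \<oplus> \<ominus> z)" using h by simp
      also have "\<dots> = (y' \<oplus> \<ominus> y') \<oplus> (z' \<oplus> \<ominus> z)" using c by (simp add: a_ac)
      also have "\<dots> = z' \<ominus> z" using c by (simp add: minus_eq r_neg)
      finally show ?thesis .
    qed
    moreover have "y \<ominus> y' \<in> part A 0" "z' \<ominus> z \<in> part A 1"
      using h assms by (simp_all add: minus_eq part_add part_neg)
    ultimately have "y \<ominus> y' = \<zero>" "z' \<ominus> z = \<zero>" using part_direct by metis+
    then have "y = y'" "z = z'" using c diff_zero_imp_eq by auto
    then show ?thesis using h by simp
  qed
  then have "(THE b. \<exists>x\<in>part A 0. \<exists>w\<in>part A 1. y \<oplus> z = x \<oplus> w \<and> b = x \<ominus> w) = y \<ominus> z"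
    using assms by (intro the_equality) blast+
  then show ?thesis using False assms part_carrier
    by (simp add: twist_def p int_smult_simps minus_eq)
qed

lemma twist_part:
  assumes "x \<in> part A q"
  shows "twist A p x = [((- 1) ^ (p * q) :: int)] \<cdot> x"
proof (cases "even q")
  case True
  then have "x \<in> part A 0" using assms part_cong[of q 0] by simp
  then show ?thesis using twist_decomp[OF _ part_zero, of x p] True assms part_carrier
    by (simp add: int_smult_simps)
next
  case False
  then have "x \<in> part A 1" using assms part_cong[of q 1] by simp
  moreover have "(- 1 :: int) ^ (p * q) = (- 1) ^ p" using False by (cases "even p") auto
  ultimately show ?thesis using twist_decomp[OF part_zero, of x p] assms part_carrier[OF assms]
    by (simp add: int_smult_simps)
qed

lemma twist_closed [simp, intro]: "x \<in> carrier A \<Longrightarrow> twist A p x \<in> carrier A"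
proof -
  assume "x \<in> carrier A"
  then obtain y z where "y \<in> part A 0" "z \<in> part A 1" "x = y \<oplus> z" using part_cases by blast
  then show ?thesis by (simp add: twist_decomp part_carrier int_smult_simps)
qed

lemma twist_add:
  assumes "x \<in> carrier A" "y \<in> carrier A"
  shows "twist A p (x \<oplus> y) = twist A p x \<oplus> twist A p y"
proof -
  obtain x0 x1 where x: "x0 \<in> part A 0" "x1 \<in> part A 1" "x = x0 \<oplus> x1"
    using part_cases assms by blast
  obtain y0 y1 where y: "y0 \<in> part A 0" "y1 \<in> part A 1" "y = y0 \<oplus> y1"
    using part_cases assms by blast
  note c = x(1,2)[THEN part_carrier] y(1,2)[THEN part_carrier]
  have "x \<oplus> y = (x0 \<oplus> y0) \<oplus> (x1 \<oplus> y1)" using x y c by (simp add: a_ac)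
  then have "twist A p (x \<oplus> y) = (x0 \<oplus> y0) \<oplus> [((- 1) ^ p :: int)] \<cdot> (x1 \<oplus> y1)"
    using twist_decomp x y by (simp add: part_add)
  then show ?thesis using x y c twist_decomp by (simp add: int_smult_distrib int_smult_simps a_ac)
qed

text \<open>The exponent of the sign is additive in the parity, so the claim holds for homogeneous
  factors and extends bilinearly. Associativity of the tensor product rests on it.\<close>

lemma twist_mult:
  assumes "x \<in> carrier A" "y \<in> carrier A"
  shows "twist A p (x \<otimes> y) = twist A p x \<otimes> twist A p y"
proof -
  have hom: "twist A p (x \<otimes> y) = twist A p x \<otimes> twist A p y"
    if h: "x \<in> part A q" "y \<in> part A s" for x y q s
    using twist_part[OF h(1), of p] twist_part[OF h(2), of p] twist_part[OF part_mult[OF h], of p]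
      h part_carrier
    by (simp add: add_pow_ldistr_int add_pow_rdistr_int int_smult_simps power_add algebra_simps)
  obtain x0 x1 where x: "x0 \<in> part A 0" "x1 \<in> part A 1" "x = x0 \<oplus> x1"
    using part_cases assms by blast
  obtain y0 y1 where y: "y0 \<in> part A 0" "y1 \<in> part A 1" "y = y0 \<oplus> y1"
    using part_cases assms by blast
  note c = x(1,2)[THEN part_carrier] y(1,2)[THEN part_carrier]
  show ?thesis using c
    by (simp add: x(3) y(3) l_distr r_distr twist_add hom[OF x(1) y(1)] hom[OF x(1) y(2)] hom[OF
      x(2) y(1)] hom[OF x(2) y(2)])
qed

lemma twist_twist:
  assumes "x \<in> carrier A"
  shows "twist A p (twist A q x) = twist A (p + q) x"
proof -
  obtain x0 x1 where x: "x0 \<in> part A 0" "x1 \<in> part A 1" "x = x0 \<oplus> x1"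
    using part_cases assms by blast
  then show ?thesis using part_carrier
    by (simp add: twist_decomp twist_decomp[OF x(1) part_int[OF x(2)]] int_smult_simps power_add)
qed

lemma twist_even [simp]: "twist A 0 x = x"
  by (simp add: twist_def)

lemma twist_zero [simp]: "twist A p \<zero> = \<zero>"
  using twist_part[OF part_zero, of p 0] by simp

lemma twist_one [simp]: "twist A p \<one> = \<one>"
  using twist_part[OF part_one, of p] by (simp add: int_smult_simps)

lemma twist_int: "x \<in> carrier A \<Longrightarrow> twist A p ([(k::int)] \<cdot> x) = [k] \<cdot> twist A p x"
proof -
  assume x: "x \<in> carrier A"
  obtain x0 x1 where d: "x0 \<in> part A 0" "x1 \<in> part A 1" "x = x0 \<oplus> x1"
    using part_cases x by blast
  then show ?thesis using part_carrier
    by (simp add: int_smult_distrib twist_decomp twist_decomp[OF part_int[OF d(1)] part_int[OF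
      d(2)]]
        int_smult_simps mult.commute)
qed

end

section \<open>The tensor algebra\<close>

lemma word_parity_simps [simp]:
  "word_parity n [] = 0"
  "word_parity n (a # w) = (if n \<le> a then 1 else 0) + word_parity n w"
  "word_parity n (u @ w) = word_parity n u + word_parity n w"
  by (simp_all add: word_parity_def)

lemma word_parity_mset: "mset u = mset w \<Longrightarrow> word_parity n u = word_parity n w"
  unfolding word_parity_def by (metis mset_filter size_mset)

lemma exchange_sign_parity:
  "exchange_sign n a b = - ((- 1) ^ (word_parity n [a] * word_parity n [b]))"
  by (simp add: exchange_sign_def)

locale super_tensors = half_superalgebra A for A :: "('k, 'u) superalgebra" (structure) +
  fixes n m :: nat
begin

abbreviation T where "T \<equiv> tensor_alg n m A"
abbreviation tensor_mult (infixl "\<star>" 70) where "s \<star> t \<equiv> s \<otimes>\<^bsub>T\<^esub> t"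

lemma T_simps [simp]:
  "\<one>\<^bsub>T\<^esub> = (\<lambda>w. if w = [] then \<one> else \<zero>)"
  "\<zero>\<^bsub>T\<^esub> = (\<lambda>w. \<zero>)"
  "s \<oplus>\<^bsub>T\<^esub> t = (\<lambda>w. s w \<oplus> t w)"
  by (simp_all add: tensor_alg_def)

lemma T_carrier:
  "t \<in> carrier T \<longleftrightarrow> (\<forall>w. t w \<in> carrier A) \<and> finite {w. t w \<noteq> \<zero>} \<and>
    (\<forall>w. t w \<noteq> \<zero> \<longrightarrow> set w \<subseteq> {..<n + m})"
  by (simp add: tensor_alg_def)

lemma T_coeff [simp]: "t \<in> carrier T \<Longrightarrow> t w \<in> carrier A"
  by (simp add: T_carrier)

lemma T_mult:
  "(s \<star> t) w = (\<Oplus>k\<in>{..length w}. s (take k w) \<otimes> twist A (word_parity n (take k w)) (t (drop k w)))"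
  unfolding tensor_alg_def monoid.select_convs by (rule refl)

lemma T_mult_Nil: "s [] \<in> carrier A \<Longrightarrow> t [] \<in> carrier A \<Longrightarrow> (s \<star> t) [] = s [] \<otimes> t []"
  by (simp add: T_mult)

text \<open>The split point 0 gives the first summand; at every other split point the letter
  \<open>a\<close> belongs to the left factor and twists the right one. The hypotheses ask only for
  coefficients in \<open>A\<close>, because the tail families \<open>\<lambda>v. s (a # v)\<close>
  and twisted families are fed back into the same rule.\<close>

lemma T_mult_Cons:
  assumes "\<And>w. s w \<in> carrier A" "\<And>w. t w \<in> carrier A"
  shows "(s \<star> t) (a # w) = s [] \<otimes> t (a # w) \<oplus>
    ((\<lambda>v. s (a # v)) \<star> (\<lambda>v. twist A (word_parity n [a]) (t v))) w"
proof -
  have "(s \<star> t) (a # w) =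
    (\<Oplus>k\<in>{..length w}. s (a # take k w) \<otimes> twist A (word_parity n (a # take k w)) (t (drop k w)))
      \<oplus> s [] \<otimes> t (a # w)"
    unfolding T_mult list.size(4) add_Suc_right add_0_right
    by (subst finsum_Suc2) (use assms in auto)
  also have "(\<Oplus>k\<in>{..length w}. s (a # take k w) \<otimes> twist A (word_parity n (a # take k w)) (t (drop
    k w)))
     = ((\<lambda>v. s (a # v)) \<star> (\<lambda>v. twist A (word_parity n [a]) (t v))) w"
    unfolding T_mult using assms by (intro finsum_cong') (auto simp: twist_twist add.commute)
  finally show ?thesis using assms by (simp add: a_comm T_mult finsum_closed Pi_def)
qed

lemma T_mult_coeff:
  assumes "\<And>w. s w \<in> carrier A" "\<And>w. t w \<in> carrier A"
  shows "(s \<star> t) w \<in> carrier A"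
  unfolding T_mult by (rule finsum_closed) (use assms in auto)

lemma T_mult_add_left:
  assumes "\<And>w. s w \<in> carrier A" "\<And>w. s' w \<in> carrier A" "\<And>w. t w \<in> carrier A"
  shows "((\<lambda>v. s v \<oplus> s' v) \<star> t) w = (s \<star> t) w \<oplus> (s' \<star> t) w"
  unfolding T_mult using assms
  by (subst finsum_addf[symmetric]) (auto intro!: finsum_cong' simp: l_distr)

lemma T_mult_add_right:
  assumes "\<And>w. s w \<in> carrier A" "\<And>w. t w \<in> carrier A" "\<And>w. t' w \<in> carrier A"
  shows "(s \<star> (\<lambda>v. t v \<oplus> t' v)) w = (s \<star> t) w \<oplus> (s \<star> t') w"
  unfolding T_mult using assms
  by (subst finsum_addf[symmetric]) (auto intro!: finsum_cong' simp: r_distr twist_add)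

lemma T_mult_scale:
  assumes "a \<in> carrier A" "\<And>w. s w \<in> carrier A" "\<And>w. t w \<in> carrier A"
  shows "((\<lambda>v. a \<otimes> s v) \<star> t) w = a \<otimes> (s \<star> t) w"
  unfolding T_mult using assms
  by (subst finsum_rdistr) (auto intro!: finsum_cong' simp: m_assoc)

text \<open>The twist of the coefficients is a ring endomorphism of \<open>A\<close> that commutes
  with the twists inside the product.\<close>

lemma T_mult_twist:
  assumes "\<And>w. s w \<in> carrier A" "\<And>w. t w \<in> carrier A"
  shows "((\<lambda>v. twist A p (s v)) \<star> (\<lambda>v. twist A p (t v))) w = twist A p ((s \<star> t) w)"
  using assms
proof (induction w arbitrary: s t)
  case Nil
  then show ?case by (simp add: T_mult_Nil twist_mult)
next
  case (Cons a w)
  have e: "twist A p (twist A q x) = twist A q (twist A p x)" if "x \<in> carrier A" for q x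
    using that by (simp add: twist_twist add.commute)
  have "((\<lambda>v. twist A p (s (a # v))) \<star> (\<lambda>v. twist A (word_parity n [a]) (twist A p (t v)))) w
    = twist A p (((\<lambda>v. s (a # v)) \<star> (\<lambda>v. twist A (word_parity n [a]) (t v))) w)"
    using Cons.IH[of "\<lambda>v. s (a # v)" "\<lambda>v. twist A (word_parity n [a]) (t v)"] Cons.prems
    by (simp only: e) (simp only: e twist_closed)
  then show ?case using Cons.prems
    by (simp only: T_mult_Cons twist_closed)
      (simp add: twist_add twist_mult T_mult_coeff)
qed

text \<open>After peeling off the first letter on both sides, the induction hypothesis is applied to
  the tail of \<open>s\<close> and to the twisted \<open>t\<close> and \<open>u\<close>. The twist
  of the product \<open>t \<star> u\<close> must then be distributed over its factors.\<close>

lemma T_mult_assoc: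
  assumes "\<And>w. s w \<in> carrier A" "\<And>w. t w \<in> carrier A" "\<And>w. u w \<in> carrier A"
  shows "((s \<star> t) \<star> u) w = (s \<star> (t \<star> u)) w"
  using assms
proof (induction w arbitrary: s t u)
  case Nil
  then show ?case by (simp add: T_mult_Nil T_mult_coeff m_assoc)
next
  case (Cons a w)
  let ?p = "word_parity n [a]"
  let ?s = "\<lambda>v. s (a # v)" and ?t = "\<lambda>v. t (a # v)"
  let ?t' = "\<lambda>v. twist A ?p (t v)" and ?u' = "\<lambda>v. twist A ?p (u v)"
  note c = Cons.prems
  have d: "(\<lambda>v. (s \<star> t) (a # v)) = (\<lambda>v. s [] \<otimes> ?t v \<oplus> (?s \<star> ?t') v)"
    using c by (simp only: T_mult_Cons)
  have e: "(\<lambda>v. twist A ?p ((t \<star> u) v)) = ?t' \<star> ?u'"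
    using c by (intro ext) (simp only: T_mult_twist)
  have k: "?s v \<in> carrier A" "?t' v \<in> carrier A" "?u' v \<in> carrier A" "(?s \<star> ?t') v \<in> carrier A"
    "(?t' \<star> ?u') v \<in> carrier A" "(t \<star> u) v \<in> carrier A" "(?t \<star> ?u') v \<in> carrier A"
    "(s \<star> t) v \<in> carrier A" "(?s \<star> (?t' \<star> ?u')) v \<in> carrier A" for v
    using c by (auto intro!: T_mult_coeff)
  have "((s \<star> t) \<star> u) (a # w)
      = (s \<star> t) [] \<otimes> u (a # w) \<oplus> ((\<lambda>v. s [] \<otimes> ?t v \<oplus> (?s \<star> ?t') v) \<star> ?u') w"
    using c k by (simp only: T_mult_Cons[of "s \<star> t"] d)
  also have "((\<lambda>v. s [] \<otimes> ?t v \<oplus> (?s \<star> ?t') v) \<star> ?u') w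
      = s [] \<otimes> (?t \<star> ?u') w \<oplus> (?s \<star> (?t' \<star> ?u')) w"
    using c k Cons.IH[of ?s ?t' ?u'] by (simp add: T_mult_add_left T_mult_scale del:
      word_parity_simps)
  also have "(s \<star> t) [] \<otimes> u (a # w) \<oplus> (s [] \<otimes> (?t \<star> ?u') w \<oplus> (?s \<star> (?t' \<star> ?u')) w)
      = s [] \<otimes> (t [] \<otimes> u (a # w) \<oplus> (?t \<star> ?u') w) \<oplus> (?s \<star> (?t' \<star> ?u')) w"
    using c k by (simp add: T_mult_Nil r_distr m_assoc a_assoc del: word_parity_simps)
  also have "\<dots> = (s \<star> (t \<star> u)) (a # w)"
    using c k by (simp only: T_mult_Cons e)
  finally show ?case .
qed

lemma T_mult_scalar_left:
  assumes "\<And>w. w \<noteq> [] \<Longrightarrow> s w = \<zero>" "s [] \<in> carrier A" "\<And>w. t w \<in> carrier A"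
  shows "(s \<star> t) w = s [] \<otimes> t w"
proof -
  have c: "\<And>w. s w \<in> carrier A" using assms(1,2) zero_closed by metis
  have z: "((\<lambda>v. \<zero>) \<star> t) w = \<zero>" if "\<And>w. t w \<in> carrier A" for t w
    unfolding T_mult by (rule add.finprod_one_eqI) (use that in simp)
  show ?thesis
  proof (cases w)
    case Nil then show ?thesis using assms by (simp add: T_mult_Nil)
  next
    case (Cons a v)
    have "(\<lambda>v. s (a # v)) = (\<lambda>v. \<zero>)" using assms(1) by auto
    then show ?thesis unfolding Cons using c assms z by (simp add: T_mult_Cons)
  qed
qed

lemma T_mult_one_right:
  assumes "\<And>w. s w \<in> carrier A"
  shows "(s \<star> \<one>\<^bsub>T\<^esub>) w = s w"
  using assms
proof (induction w arbitrary: s)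
  case Nil
  then show ?case by (simp add: T_mult_Nil)
next
  case (Cons a w)
  have e: "(\<lambda>v. twist A p (\<one>\<^bsub>T\<^esub> v)) = \<one>\<^bsub>T\<^esub>" for p by auto
  have c: "\<one>\<^bsub>T\<^esub> w \<in> carrier A" for w by simp
  have "(s \<star> \<one>\<^bsub>T\<^esub>) (a # w) = s [] \<otimes> \<one>\<^bsub>T\<^esub> (a # w) \<oplus> ((\<lambda>v. s (a # v)) \<star> \<one>\<^bsub>T\<^esub>) w"
    using Cons.prems c by (simp only: T_mult_Cons e)
  also have "((\<lambda>v. s (a # v)) \<star> \<one>\<^bsub>T\<^esub>) w = s (a # w)"
    by (rule Cons.IH) (rule Cons.prems)
  finally show ?case using Cons.prems by simp
qed

lemma T_mult_closed:
  assumes s: "s \<in> carrier T" and t: "t \<in> carrier T"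
  shows "s \<star> t \<in> carrier T"
proof -
  have supp: "\<exists>u v. w = u @ v \<and> s u \<noteq> \<zero> \<and> t v \<noteq> \<zero>" if "(s \<star> t) w \<noteq> \<zero>" for w
  proof (rule ccontr)
    assume "\<not> ?thesis"
    then have "s (take k w) = \<zero> \<or> t (drop k w) = \<zero>" for k
      by (metis append_take_drop_id)
    then have "s (take k w) \<otimes> twist A (word_parity n (take k w)) (t (drop k w)) = \<zero>" for k
      using s t T_coeff by (metis l_null r_null twist_zero twist_closed)
    then have "(s \<star> t) w = \<zero>" unfolding T_mult by simp
    with that show False by simp
  qed
  have "{w. (s \<star> t) w \<noteq> \<zero>} \<subseteq> (\<lambda>(u, v). u @ v) ` ({w. s w \<noteq> \<zero>} \<times> {w. t w \<noteq> \<zero>})"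
  proof
    fix w assume "w \<in> {w. (s \<star> t) w \<noteq> \<zero>}"
    then obtain u v where "w = u @ v" "s u \<noteq> \<zero>" "t v \<noteq> \<zero>" using supp[of w] by blast
    then show "w \<in> (\<lambda>(u, v). u @ v) ` ({w. s w \<noteq> \<zero>} \<times> {w. t w \<noteq> \<zero>})"
      by (intro image_eqI[of _ _ "(u, v)"]) simp_all
  qed
  then have "finite {w. (s \<star> t) w \<noteq> \<zero>}"
    by (rule finite_subset) (use s t in \<open>simp add: T_carrier\<close>)
  moreover have "set w \<subseteq> {..<n + m}" if nz: "(s \<star> t) w \<noteq> \<zero>" for w
  proof -
    obtain u v where "w = u @ v" "s u \<noteq> \<zero>" "t v \<noteq> \<zero>" using supp[OF nz] by blast
    then show ?thesis using s t by (simp add: T_carrier)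
  qed
  ultimately show ?thesis using s t by (auto simp: T_carrier intro!: T_mult_coeff)
qed

lemma T_ring: "ring T"
proof (rule ringI)
  show "abelian_group T"
  proof (rule abelian_groupI)
    fix s t assume s: "s \<in> carrier T" and t: "t \<in> carrier T"
    have "{w. s w \<oplus> t w \<noteq> \<zero>} \<subseteq> {w. s w \<noteq> \<zero>} \<union> {w. t w \<noteq> \<zero>}" by auto
    then have "finite {w. s w \<oplus> t w \<noteq> \<zero>}"
      using s t by (auto simp: T_carrier intro: finite_subset)
    moreover have "set w \<subseteq> {..<n + m}" if "s w \<oplus> t w \<noteq> \<zero>" for w
      using that s t l_zero unfolding T_carrier by (metis zero_closed)
    ultimately show "s \<oplus>\<^bsub>T\<^esub> t \<in> carrier T" using s t by (auto simp: T_carrier)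
  next
    fix s assume s: "s \<in> carrier T"
    have "(\<lambda>w. \<ominus> s w) \<in> carrier T"
    proof -
      have "\<ominus> s w \<noteq> \<zero> \<longleftrightarrow> s w \<noteq> \<zero>" for w using s by (metis T_coeff minus_minus minus_zero)
      then show ?thesis using s by (auto simp: T_carrier)
    qed
    moreover have "(\<lambda>w. \<ominus> s w) \<oplus>\<^bsub>T\<^esub> s = \<zero>\<^bsub>T\<^esub>" using s by (auto simp: l_neg)
    ultimately show "\<exists>t\<in>carrier T. t \<oplus>\<^bsub>T\<^esub> s = \<zero>\<^bsub>T\<^esub>" by blast
  qed (auto simp: T_carrier a_assoc intro: a_comm)
  show "Group.monoid T"
  proof (rule monoidI)
    show "\<one>\<^bsub>T\<^esub> \<in> carrier T" by (auto simp: T_carrier)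
    fix s t u assume s: "s \<in> carrier T" and t: "t \<in> carrier T" and u: "u \<in> carrier T"
    show "s \<star> t \<in> carrier T" using s t by (rule T_mult_closed)
    show "s \<star> t \<star> u = s \<star> (t \<star> u)"
      using s t u by (intro ext T_mult_assoc) auto
    show "s \<star> \<one>\<^bsub>T\<^esub> = s" by (intro ext T_mult_one_right) (use s in auto)
    show "\<one>\<^bsub>T\<^esub> \<star> s = s" by (intro ext, subst T_mult_scalar_left) (use s in auto)
  qed
  fix s t u assume c: "s \<in> carrier T" "t \<in> carrier T" "u \<in> carrier T"
  show "(s \<oplus>\<^bsub>T\<^esub> t) \<star> u = s \<star> u \<oplus>\<^bsub>T\<^esub> t \<star> u"
    using c by (auto simp: T_mult_add_left)
  show "u \<star> (s \<oplus>\<^bsub>T\<^esub> t) = u \<star> s \<oplus>\<^bsub>T\<^esub> u \<star> t"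
    using c by (auto simp: T_mult_add_right)
qed

end

sublocale super_tensors \<subseteq> T: ring T
  by (rule T_ring)

context super_tensors
begin

lemma T_uminus: "t \<in> carrier T \<Longrightarrow> (\<ominus>\<^bsub>T\<^esub> t) w = \<ominus> t w"
proof -
  assume t: "t \<in> carrier T"
  have "(\<ominus>\<^bsub>T\<^esub> t \<oplus>\<^bsub>T\<^esub> t) w = \<zero>" using T.l_neg[OF t] by simp
  then show ?thesis using t T.a_inv_closed[OF t] by (simp add: minus_equality)
qed

lemma T_minus: "s \<in> carrier T \<Longrightarrow> t \<in> carrier T \<Longrightarrow> (s \<ominus>\<^bsub>T\<^esub> t) w = s w \<ominus> t w"
  by (simp add: T.minus_eq T_uminus minus_eq)

lemma T_signed: "t \<in> carrier T \<Longrightarrow> signed T p t w = [((- 1) ^ p :: int)] \<cdot> t w"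
  by (auto simp: signed_def T_uminus int_smult_simps)

definition monomial :: "'u \<Rightarrow> nat list \<Rightarrow> nat list \<Rightarrow> 'u" where
  "monomial a u = (\<lambda>w. if w = u then a else \<zero>)"

lemma scalar_monomial: "scalar A a = monomial a []"
  by (simp add: scalar_def monomial_def)

lemma monomial_closed: "a \<in> carrier A \<Longrightarrow> set u \<subseteq> {..<n + m} \<Longrightarrow> monomial a u \<in> carrier T"
  by (auto simp: T_carrier monomial_def)

lemma T_scalar_mult:
  "a \<in> carrier A \<Longrightarrow> t \<in> carrier T \<Longrightarrow> scalar A a \<star> t = (\<lambda>w. a \<otimes> t w)"
  by (rule ext, subst T_mult_scalar_left) (auto simp: scalar_def)

lemma monomial_mult:
  assumes "a \<in> carrier A" "\<And>w. t w \<in> carrier A"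
  shows "(monomial a u \<star> t) w =
    (if take (length u) w = u then a \<otimes> twist A (word_parity n u) (t (drop (length u) w)) else \<zero>)"
  using assms(2)
proof (induction u arbitrary: t w)
  case Nil
  then show ?case using assms(1) by (subst T_mult_scalar_left) (auto simp: monomial_def)
next
  case (Cons i u)
  have c: "monomial a v w \<in> carrier A" for v w using assms(1) by (simp add: monomial_def)
  have z: "monomial a (i # u) [] = \<zero>" by (simp add: monomial_def)
  show ?case
  proof (cases w)
    case Nil
    then show ?thesis using z c Cons.prems by (simp add: T_mult_Nil)
  next
    case (Cons j v)
    have "(monomial a (i # u) \<star> t) (j # v)
        = ((\<lambda>v. monomial a (i # u) (j # v)) \<star> (\<lambda>v. twist A (word_parity n [j]) (t v))) v"
      using c z Cons.prems by (subst T_mult_Cons) (simp_all add: T_mult_coeff)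
    also have "\<dots> = (if i = j \<and> take (length u) v = u
        then a \<otimes> twist A (word_parity n u) (twist A (word_parity n [j]) (t (drop (length u) v)))
          else \<zero>)"
    proof (cases "i = j")
      case True
      then have "(\<lambda>v. monomial a (i # u) (j # v)) = monomial a u" by (auto simp: monomial_def)
      then show ?thesis using Cons.IH[of "\<lambda>v. twist A (word_parity n [j]) (t v)" v] Cons.prems True
        by simp
    next
      case False
      then have "(\<lambda>v. monomial a (i # u) (j # v)) = (\<lambda>v. \<zero>)" by (auto simp: monomial_def)
      then show ?thesis using False Cons.prems by (simp add: T_mult_scalar_left)
    qed
    finally show ?thesis using Cons.prems
      by (auto simp: \<open>w = j # v\<close> twist_twist add.commute)
  qed
qed

lemma monomial_mult_monomial:
  assumes "a \<in> carrier A"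
  shows "monomial a u \<star> monomial \<one> v = monomial a (u @ v)"
proof
  fix w
  have "take (length u) w = u \<and> drop (length u) w = v \<longleftrightarrow> w = u @ v"
    by (metis append_eq_conv_conj append_take_drop_id)
  then show "(monomial a u \<star> monomial \<one> v) w = monomial a (u @ v) w"
    using assms by (subst monomial_mult) (auto simp: monomial_def)
qed

end

section \<open>Coordinates on the exterior algebra\<close>

context super_tensors
begin

text \<open>The functional dual to the sorted form of \<open>b\<close>, defined on tensors before
  any reference to the ideal. It depends on \<open>b\<close> only through its multiset, so words
  such as \<open>a[i := j]\<close> can be used without sorting them.\<close>

definition coord :: "nat list \<Rightarrow> (nat list \<Rightarrow> 'u) \<Rightarrow> 'u" where
  "coord b t = (\<Oplus>z\<in>{z. mset z = mset b}. [(sorting_sign n z)] \<cdot> t z)"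

lemma finite_same_mset: "finite {z. mset z = mset (b :: nat list)}"
proof (rule finite_subset)
  show "{z. mset z = mset b} \<subseteq> {z. set z \<subseteq> set b \<and> length z = length b}"
    by (auto dest: mset_eq_setD mset_eq_length)
qed (simp add: finite_lists_length_eq)

lemma vectorsD:
  assumes "v \<in> vectors n m A p"
  shows "v \<in> carrier T" "\<And>w. length w \<noteq> 1 \<Longrightarrow> v w = \<zero>" "\<And>w. v w \<in> part A (p + word_parity n w)"
  using assms by (auto simp: vectors_def homogeneous_tensors_def)

lemma vector_mult:
  assumes v: "v \<in> vectors n m A p" and w: "w \<in> vectors n m A q"
  shows "(v \<star> w) [a, b] = v [a] \<otimes> twist A (word_parity n [a]) (w [b])"
    "length z \<noteq> 2 \<Longrightarrow> (v \<star> w) z = \<zero>"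
proof -
  note c = vectorsD(1)[OF v] vectorsD(1)[OF w]
  have v0: "v [] = \<zero>" using vectorsD(2)[OF v] by simp
  have s: "\<And>u a. u \<noteq> [] \<Longrightarrow> v (a # u) = \<zero>" using vectorsD(2)[OF v] by simp
  have cons: "(v \<star> w) (a # u) = v [a] \<otimes> twist A (word_parity n [a]) (w u)" for a u
  proof -
    have "(v \<star> w) (a # u) = v [] \<otimes> w (a # u) \<oplus>
        ((\<lambda>u. v (a # u)) \<star> (\<lambda>u. twist A (word_parity n [a]) (w u))) u"
      using c by (intro T_mult_Cons) auto
    also have "((\<lambda>u. v (a # u)) \<star> (\<lambda>u. twist A (word_parity n [a]) (w u))) u
        = v [a] \<otimes> twist A (word_parity n [a]) (w u)"
      using c s by (subst T_mult_scalar_left) auto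
    finally show ?thesis using v0 c by (simp del: word_parity_simps)
  qed
  show "(v \<star> w) [a, b] = v [a] \<otimes> twist A (word_parity n [a]) (w [b])" by (rule cons)
  show "(v \<star> w) z = \<zero>" if "length z \<noteq> 2"
  proof (cases z)
    case Nil
    then show ?thesis using c v0 by (simp add: T_mult_Nil)
  next
    case (Cons a u)
    then have "w u = \<zero>" using that vectorsD(2)[OF w] by simp
    then show ?thesis using Cons cons c by simp
  qed
qed

lemma ext_relations_subset: "ext_relations n m A \<subseteq> carrier T"
proof
  fix R assume "R \<in> ext_relations n m A"
  then obtain p q v w where R: "R = (v \<star> w) \<oplus>\<^bsub>T\<^esub> signed T (p * q) (w \<star> v)"
    and v: "v \<in> carrier T" and w: "w \<in> carrier T"
    unfolding ext_relations_def Let_def using vectorsD(1) by blast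
  show "R \<in> carrier T"
    unfolding R signed_def using v w by (auto simp del: T_simps)
qed

lemma ext_relation_length:
  assumes "R \<in> ext_relations n m A" "length z \<noteq> 2"
  shows "R z = \<zero>"
proof -
  obtain p q v w where R: "R = (v \<star> w) \<oplus>\<^bsub>T\<^esub> signed T (p * q) (w \<star> v)"
    and v: "v \<in> vectors n m A p" and w: "w \<in> vectors n m A q"
    using assms(1) unfolding ext_relations_def Let_def by blast
  show ?thesis using vector_mult(2)[OF v w assms(2)] vector_mult(2)[OF w v assms(2)]
      vectorsD(1)[OF v] vectorsD(1)[OF w]
    by (simp add: R T_signed)
qed

text \<open>The symmetry of the coefficients of a relation is opposite to that of
  \<open>sorting_sign\<close>, so the product of the two is antisymmetric under the exchange of
  \<open>a\<close> and \<open>b\<close>.\<close>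

lemma ext_relation_swap:
  assumes "R \<in> ext_relations n m A"
  shows "R [b, a] = [(- exchange_sign n a b)] \<cdot> R [a, b]"
proof -
  obtain p q v w where R: "R = (v \<star> w) \<oplus>\<^bsub>T\<^esub> signed T (p * q) (w \<star> v)"
    and v: "v \<in> vectors n m A p" and w: "w \<in> vectors n m A q"
    using assms(1) unfolding ext_relations_def Let_def by blast
  define i where "i = word_parity n [a]"
  define j where "j = word_parity n [b]"
  have va: "v [a] \<in> part A (p + i)" and vb: "v [b] \<in> part A (p + j)"
    and wa: "w [a] \<in> part A (q + i)" and wb: "w [b] \<in> part A (q + j)"
    using vectorsD(3)[OF v] vectorsD(3)[OF w]
      by (auto simp: i_def j_def simp del: word_parity_simps)
  note c = va[THEN part_carrier] vb[THEN part_carrier] wa[THEN part_carrier] wb[THEN part_carrier]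
  have 1: "R [x, y] = v [x] \<otimes> twist A (word_parity n [x]) (w [y])
      \<oplus> [((- 1) ^ (p * q) :: int)] \<cdot> (w [x] \<otimes> twist A (word_parity n [x]) (v [y]))" for x y
    using vector_mult(1)[OF v w, of x y] vector_mult(1)[OF w v, of x y] vectorsD(1)[OF v]
      vectorsD(1)[OF w]
    by (simp add: R T_signed del: word_parity_simps)
  have ab: "R [a, b] = [((- 1) ^ (i * (q + j)) :: int)] \<cdot> (v [a] \<otimes> w [b])
      \<oplus> [((- 1) ^ (p * q + i * (p + j)) :: int)] \<cdot> (w [a] \<otimes> v [b])"
    unfolding 1 using c twist_part[OF wb, of i] twist_part[OF vb, of i]
    by (simp add: i_def[symmetric] add_pow_rdistr_int int_smult_simps power_add del:
      word_parity_simps)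
  have ba: "R [b, a] = [((- 1) ^ (j * (q + i)) :: int)] \<cdot> (v [b] \<otimes> w [a])
      \<oplus> [((- 1) ^ (p * q + j * (p + i)) :: int)] \<cdot> (w [b] \<otimes> v [a])"
    unfolding 1 using c twist_part[OF wa, of j] twist_part[OF va, of j]
    by (simp add: j_def[symmetric] add_pow_rdistr_int int_smult_simps power_add del:
      word_parity_simps)
  \<comment> \<open>Supercommutation turns each product in \<open>R [b, a]\<close> into the other
    product in \<open>R [a, b]\<close>; what is left is a comparison of exponents modulo 2.\<close>
  have vw: "v [b] \<otimes> w [a] = [((- 1) ^ ((p + j) * (q + i)) :: int)] \<cdot> (w [a] \<otimes> v [b])"
    and wv: "w [b] \<otimes> v [a] = [((- 1) ^ ((q + j) * (p + i)) :: int)] \<cdot> (v [a] \<otimes> w [b])"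
    using part_commute[OF vb wa] part_commute[OF wb va] c by (simp_all add: signed_int)
  have sg: "(- 1 :: int) ^ x = (- 1) ^ y" if "even x = even y" for x y
    using that by (cases "even x") auto
  have e: "- exchange_sign n a b = (- 1) ^ (i * j)" by (simp add: exchange_sign_parity i_def j_def)
  have "R [b, a] = [((- 1) ^ (j * (q + i) + (p + j) * (q + i)) :: int)] \<cdot> (w [a] \<otimes> v [b])
      \<oplus> [((- 1) ^ (p * q + j * (p + i) + (q + j) * (p + i)) :: int)] \<cdot> (v [a] \<otimes> w [b])"
    using c by (simp add: ba vw wv int_smult_simps power_add)
  also have "(- 1 :: int) ^ (j * (q + i) + (p + j) * (q + i))
    = (- 1) ^ (i * j + (p * q + i * (p + j)))"
    by (rule sg) auto
  also have "(- 1 :: int) ^ (p * q + j * (p + i) + (q + j) * (p + i))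
    = (- 1) ^ (i * j + i * (q + j))"
    by (rule sg) auto
  finally show ?thesis
    unfolding e ab using c by (simp add: int_smult_distrib int_smult_simps power_add a_comm)
qed

lemma coordinate_relation:
  assumes R: "R \<in> ext_relations n m A" and x: "x \<in> carrier T" and y: "y \<in> carrier T"
  shows "coord b (x \<star> (R \<star> y)) = \<zero>"
proof -
  have Rc: "R \<in> carrier T" using R ext_relations_subset by blast
  note c = T_coeff[OF x] T_coeff[OF y] T_coeff[OF Rc]
  let ?P = "{z. mset z = mset b}"
  \<comment> \<open>A relation is supported on words of length two, so a product with it on the left
    reads its coefficient at the first two letters and \<open>y\<close> at the rest; shorter words
    get 0.\<close>
  let ?Y = "\<lambda>q. case q of i # j # q' \<Rightarrow> R [i, j] \<otimes> twist A (word_parity n [i, j]) (y q') | _ \<Rightarrow> \<zero>"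
  have Ry: "(R \<star> y) q = ?Y q" for q
  proof -
    have z: "R [] = \<zero>" "\<And>i. R [i] = \<zero>" "\<And>i j u. u \<noteq> [] \<Longrightarrow> R (i # j # u) = \<zero>"
      using ext_relation_length[OF R] by auto
    have 1: "(R \<star> y) (i # q) = ((\<lambda>u. R (i # u)) \<star> (\<lambda>u. twist A (word_parity n [i]) (y u))) q" for
      i q
      using c z by (subst T_mult_Cons) (auto simp: T_mult_coeff simp del: word_parity_simps)
    have 2: "((\<lambda>u. R (i # u)) \<star> (\<lambda>u. twist A (word_parity n [i]) (y u))) [] = \<zero>" for i
      using c z by (subst T_mult_Nil) auto
    have 3: "((\<lambda>u. R (i # u)) \<star> (\<lambda>u. twist A (word_parity n [i]) (y u))) (j # q')
        = ((\<lambda>u. R (i # j # u)) \<star> (\<lambda>u. twist A (word_parity n [i, j]) (y u))) q'" for i j q'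
      using c z by (subst T_mult_Cons) (auto simp: T_mult_coeff twist_twist add.commute)
    have 4: "((\<lambda>u. R (i # j # u)) \<star> (\<lambda>u. twist A (word_parity n [i, j]) (y u))) q'
        = R [i, j] \<otimes> twist A (word_parity n [i, j]) (y q')" for i j q'
      using c z by (subst T_mult_scalar_left) auto
    show ?thesis using c z
      by (auto simp: 1 2 3 4 T_mult_Nil simp del: word_parity_simps split: list.split)
  qed
  \<comment> \<open>The contribution to the coordinate of the word \<open>z\<close> cut after
    \<open>k\<close> letters, where \<open>x\<close> ends. The map \<open>sw k\<close> exchanges the
    two letters that belong to \<open>R\<close>; it leaves words alone that are too short, and there
    the contribution is 0.\<close>
  define f where "f k z = [(sorting_sign n z)] \<cdot> (x (take k z) \<otimes> twist A (word_parity n (take k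
    z)) (?Y (drop k z)))" for k z
  have Yc: "?Y q \<in> carrier A" for q using c by (auto split: list.split)
  have fc: "f k z \<in> carrier A" for k z using c Yc by (simp add: f_def int_smult_simps)
  define sw where "sw k z = (case drop k z of i # j # q \<Rightarrow> take k z @ j # i # q | _ \<Rightarrow> z)" for k
    and z :: "nat list"
  have sw_mset: "mset (sw k z) = mset z" for k z
  proof -
    have "mset (take k z @ j # i # q) = mset z" if "drop k z = i # j # q" for i j q
    proof -
      have "mset (take k z @ j # i # q) = mset (take k z @ drop k z)" unfolding that by simp
      then show ?thesis by simp
    qed
    then show ?thesis by (simp add: sw_def split: list.split)
  qed
  have fsw: "sw k (sw k z) = z \<and> f k (sw k z) = \<ominus> f k z" for k z
  proof (cases "\<exists>i j q. drop k z = i # j # q")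
    case False
    then have "sw k z = z" "?Y (drop k z) = \<zero>" by (auto simp: sw_def split: list.split)
    then show ?thesis using c by (simp add: f_def int_smult_simps)
  next
    case True
    then obtain i j q where d: "drop k z = i # j # q" by blast
    define u where "u = take k z"
    have z: "z = u @ i # j # q" using d append_take_drop_id[of k z] by (simp add: u_def)
    have "k < length z" using d by (metis drop_eq_Nil leI list.distinct(1))
    then have l: "length u = k" by (simp add: u_def)
    have s: "sw k z = u @ j # i # q" using d by (simp add: sw_def u_def)
    have p: "word_parity n [j, i] = word_parity n [i, j]" by simp
    have "?Y (j # i # q) = [(- exchange_sign n i j)] \<cdot> ?Y (i # j # q)"
      using c ext_relation_swap[OF R, of j i]
      by (simp add: p add_pow_ldistr_int del: word_parity_simps)
    moreover have "?Y (i # j # q) \<in> carrier A" by (rule Yc)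
    ultimately have "f k (u @ j # i # q) = [(sorting_sign n (u @ j # i # q) * - exchange_sign n i
      j)] \<cdot>
        (x u \<otimes> twist A (word_parity n u) (?Y (i # j # q)))"
      using c l by (simp add: f_def add_pow_rdistr_int twist_int int_smult_simps del:
        word_parity_simps list.case)
    also have "sorting_sign n (u @ j # i # q) * - exchange_sign n i j = (- 1) * sorting_sign n z"
      unfolding z sorting_sign_swap[of n u i j q] by simp
    also have "[(- 1 * sorting_sign n z)] \<cdot> (x u \<otimes> twist A (word_parity n u) (?Y (i # j # q)))
      = [(- 1 :: int)] \<cdot> f k z"
      using c l Yc by (subst int_smult_simps(5)[symmetric]) (auto simp: f_def z simp del:
        word_parity_simps)
    also have "\<dots> = \<ominus> f k z" using fc by (rule int_smult_simps)
    finally have "f k (sw k z) = \<ominus> f k z" using s by simp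
    moreover have "sw k (sw k z) = z" unfolding s using l by (simp add: sw_def z)
    ultimately show ?thesis by blast
  qed
  \<comment> \<open>Reindexing along the involution \<open>sw k\<close> shows that the sum equals
    its own negative. Words fixed by the exchange need no separate treatment, because 2 is
    invertible.\<close>
  have sum0: "(\<Oplus>z\<in>?P. f k z) = \<zero>" for k
  proof -
    have inj: "inj_on (sw k) ?P" using fsw by (metis inj_onI)
    have im: "sw k ` ?P = ?P"
    proof
      show "sw k ` ?P \<subseteq> ?P" using sw_mset by auto
      show "?P \<subseteq> sw k ` ?P" using sw_mset fsw
        by (metis (mono_tags, lifting) image_eqI mem_Collect_eq subsetI)
    qed
    have "(\<Oplus>z\<in>?P. f k z) = (\<Oplus>z\<in>?P. f k (sw k z))"
      using finsum_reindex[of "f k" "sw k" ?P] inj im fc by auto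
    also have "\<dots> = (\<Oplus>z\<in>?P. [(- 1 :: int)] \<cdot> f k z)"
      using fsw fc by (intro finsum_cong') (auto simp: int_smult_simps)
    also have "\<dots> = \<ominus> (\<Oplus>z\<in>?P. f k z)"
      using fc by (subst int_smult_finsum[symmetric]) (auto simp: int_smult_simps)
    finally show ?thesis using fc by (intro double_eq_zero) auto
  qed
  have "(\<Oplus>z\<in>?P. \<Oplus>k\<in>N. f k z) = \<zero>" if "finite N" for N
    using that
  proof (induction N)
    case (insert k N)
    have "(\<Oplus>z\<in>?P. \<Oplus>k\<in>insert k N. f k z) = (\<Oplus>z\<in>?P. f k z \<oplus> (\<Oplus>k\<in>N. f k z))"
      using insert fc by (intro finsum_cong') (auto intro!: finsum_insert)
    also have "\<dots> = (\<Oplus>z\<in>?P. f k z) \<oplus> (\<Oplus>z\<in>?P. \<Oplus>k\<in>N. f k z)"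
      using fc by (intro finsum_addf) auto
    finally show ?case using insert sum0 by simp
  qed simp
  from this[of "{..length b}"] have "(\<Oplus>z\<in>?P. \<Oplus>k\<in>{..length b}. f k z) = \<zero>" by simp
  moreover have "coord b (x \<star> (R \<star> y)) = (\<Oplus>z\<in>?P. \<Oplus>k\<in>{..length b}. f k z)"
    unfolding coord_def
  proof (rule finsum_cong')
    fix z assume "z \<in> ?P"
    then have l: "length z = length b" by (auto dest: mset_eq_length)
    show "[(sorting_sign n z)] \<cdot> (x \<star> (R \<star> y)) z = (\<Oplus>k\<in>{..length b}. f k z)"
      unfolding T_mult[of x] Ry f_def l using c Yc by (intro int_smult_finsum) auto
  qed (use fc in auto)
  ultimately show ?thesis by simp
qed

lemma coordinate_closed: "(\<And>w. t w \<in> carrier A) \<Longrightarrow> coord b t \<in> carrier A"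
  unfolding coord_def by (rule finsum_closed) (auto simp: int_smult_simps)

lemma coordinate_add:
  "(\<And>w. s w \<in> carrier A) \<Longrightarrow> (\<And>w. t w \<in> carrier A) \<Longrightarrow>
    coord b (\<lambda>w. s w \<oplus> t w) = coord b s \<oplus> coord b t"
  unfolding coord_def
  by (subst finsum_addf[symmetric]) (auto intro!: finsum_cong' simp: int_smult_simps
    int_smult_distrib)

lemma coordinate_scale:
  "a \<in> carrier A \<Longrightarrow> (\<And>w. t w \<in> carrier A) \<Longrightarrow> coord b (\<lambda>w. a \<otimes> t w) = a \<otimes> coord b t"
  unfolding coord_def
  by (subst finsum_rdistr) (auto intro!: finsum_cong' simp: int_smult_simps add_pow_rdistr_int
    finite_same_mset)

lemma coordinate_part:
  "(\<And>w. t w \<in> part A (word_parity n w)) \<Longrightarrow> coord b t \<in> part A (word_parity n b)"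
  unfolding coord_def
proof (rule part_finsum)
  fix z assume "z \<in> {z. mset z = mset b}" and t: "\<And>w. t w \<in> part A (word_parity n w)"
  then have "word_parity n z = word_parity n b" by (auto intro: word_parity_mset)
  then show "[(sorting_sign n z)] \<cdot> t z \<in> part A (word_parity n b)" using t[of z] part_int by simp
qed

lemma coordinate_zero: "coord b (\<lambda>w. \<zero>) = \<zero>"
  by (simp add: coord_def)

section \<open>The exterior algebra as a quotient, and coordinates on it\<close>

abbreviation E where "E \<equiv> ext_alg n m A"
abbreviation ext_mult (infixl "\<bullet>" 70) where "x \<bullet> y \<equiv> x \<otimes>\<^bsub>E\<^esub> y"
abbreviation cls where "cls \<equiv> ext_class n m A"

lemma ext_ideal: "ideal (ext_ideal n m A) T"
  unfolding ext_ideal_def by (rule T.genideal_ideal[OF ext_relations_subset])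

lemma ext_ring: "ring E"
  unfolding ext_alg_def by (rule ideal.quotient_is_ring[OF ext_ideal])

end

sublocale super_tensors \<subseteq> E: ring E
  by (rule ext_ring)

context super_tensors
begin

lemma cls_hom: "ring_hom_ring T E cls"
  unfolding ext_alg_def ext_class_def[abs_def] by (rule ideal.rcos_ring_hom_ring[OF ext_ideal])

lemma cls_closed [simp, intro]: "t \<in> carrier T \<Longrightarrow> cls t \<in> carrier E"
  by (rule ring_hom_closed[OF ring_hom_ring.homh[OF cls_hom]])

lemma cls_mult: "s \<in> carrier T \<Longrightarrow> t \<in> carrier T \<Longrightarrow> cls (s \<star> t) = cls s \<bullet> cls t"
  by (rule ring_hom_mult[OF ring_hom_ring.homh[OF cls_hom]])

lemma cls_add: "s \<in> carrier T \<Longrightarrow> t \<in> carrier T \<Longrightarrow> cls (s \<oplus>\<^bsub>T\<^esub> t) = cls s \<oplus>\<^bsub>E\<^esub> cls t"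
  by (rule ring_hom_add[OF ring_hom_ring.homh[OF cls_hom]])

lemma cls_one: "cls \<one>\<^bsub>T\<^esub> = \<one>\<^bsub>E\<^esub>"
  by (rule ring_hom_one[OF ring_hom_ring.homh[OF cls_hom]])

lemma cls_zero: "cls \<zero>\<^bsub>T\<^esub> = \<zero>\<^bsub>E\<^esub>"
  by (rule ring_hom_zero[OF ring_hom_ring.homh[OF cls_hom] T_ring ext_ring])

lemma cls_uminus: "t \<in> carrier T \<Longrightarrow> cls (\<ominus>\<^bsub>T\<^esub> t) = \<ominus>\<^bsub>E\<^esub> cls t"
  by (metis E.minus_equality T.a_inv_closed T.l_neg cls_add cls_closed cls_zero)

lemma cls_surj: "\<omega> \<in> carrier E \<Longrightarrow> \<exists>t\<in>carrier T. \<omega> = cls t"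
  unfolding ext_alg_def ext_class_def FactRing_def A_RCOSETS_def' by auto

lemma cls_eq_iff: "s \<in> carrier T \<Longrightarrow> t \<in> carrier T \<Longrightarrow> cls s = cls t \<longleftrightarrow> s \<ominus>\<^bsub>T\<^esub> t \<in> ext_ideal n m A"
  unfolding ext_class_def using T.quotient_eq_iff_same_a_r_cos[OF ext_ideal] by auto

lemma cls_self:
  assumes "t \<in> carrier T"
  shows "t \<in> cls t"
proof -
  have "\<zero>\<^bsub>T\<^esub> \<in> ext_ideal n m A"
    by (rule additive_subgroup.zero_closed[OF ideal.axioms(1)[OF ext_ideal]])
  moreover have "t = \<zero>\<^bsub>T\<^esub> \<oplus>\<^bsub>T\<^esub> t" using assms by (simp del: T_simps)
  ultimately show ?thesis unfolding ext_class_def a_r_coset_def' by blast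
qed

lemma cls_memD:
  assumes t: "t \<in> carrier T" and s: "s \<in> cls t"
  shows "s \<in> carrier T" "cls s = cls t"
proof -
  obtain h where h: "h \<in> ext_ideal n m A" "s = h \<oplus>\<^bsub>T\<^esub> t"
    using s unfolding ext_class_def a_r_coset_def' by blast
  have hc: "h \<in> carrier T" by (rule ideal.Icarr[OF ext_ideal h(1)])
  then show sc: "s \<in> carrier T" using h t by (simp del: T_simps)
  have "s \<ominus>\<^bsub>T\<^esub> t = h" using hc t h(2) by (simp add: T.minus_eq T.a_assoc T.r_neg del: T_simps)
  then show "cls s = cls t" using cls_eq_iff[OF sc t] h(1) by simp
qed

text \<open>A coordinate is not multiplicative, so its kernel is not obviously an ideal. The tensors
  all of whose two-sided multiples have coordinate 0 do form an ideal, and it contains the relations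
  by \<open>coordinate_relation\<close>.\<close>

lemma coordinate_ext_ideal:
  assumes "t \<in> ext_ideal n m A"
  shows "coord b t = \<zero>"
proof -
  let ?J = "{t \<in> carrier T. \<forall>x\<in>carrier T. \<forall>y\<in>carrier T. coord b (x \<star> (t \<star> y)) = \<zero>}"
  have add: "coord b (s \<oplus>\<^bsub>T\<^esub> t) = coord b s \<oplus> coord b t"
    if "s \<in> carrier T" "t \<in> carrier T" for s t
    unfolding T_simps using that by (intro coordinate_add) auto
  have zero: "coord b \<zero>\<^bsub>T\<^esub> = \<zero>" by (simp add: coordinate_zero)
  have "ideal ?J T"
  proof (rule idealI[OF T_ring])
    show "subgroup ?J (add_monoid T)"
    proof (rule group.subgroupI)
      show "group (add_monoid T)" by (rule T.a_group)
      show "?J \<subseteq> carrier (add_monoid T)" by auto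
      have "\<zero>\<^bsub>T\<^esub> \<in> ?J" using zero by (simp del: T_simps)
      then show "?J \<noteq> {}" by blast
      fix s t assume s: "s \<in> ?J" and t: "t \<in> ?J"
      then show "s \<otimes>\<^bsub>add_monoid T\<^esub> t \<in> ?J"
        by (simp add: T.l_distr T.r_distr add del: T_simps)
      have "coord b (x \<star> (\<ominus>\<^bsub>T\<^esub> s \<star> y)) = \<zero>"
        if "x \<in> carrier T" "y \<in> carrier T" for x y
      proof -
        have sc: "s \<in> carrier T" using s by simp
        have "coord b (\<ominus>\<^bsub>T\<^esub> (x \<star> (s \<star> y))) \<oplus> coord b (x \<star> (s \<star> y)) = \<zero>"
          using that sc zero by (simp add: add[symmetric] T.l_neg del: T_simps)
        moreover have "coord b (x \<star> (s \<star> y)) = \<zero>" using s that by simp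
        moreover have "coord b (\<ominus>\<^bsub>T\<^esub> (x \<star> (s \<star> y))) \<in> carrier A"
          using that sc by (intro coordinate_closed T_coeff) (simp del: T_simps)
        ultimately show ?thesis using that sc by (simp add: T.l_minus T.r_minus del: T_simps)
      qed
      then have "\<ominus>\<^bsub>T\<^esub> s \<in> ?J" using s by (simp del: T_simps)
      then show "inv\<^bsub>add_monoid T\<^esub> s \<in> ?J" unfolding a_inv_def .
    qed
    fix t x assume t: "t \<in> ?J" and x: "x \<in> carrier T"
    have tc: "t \<in> carrier T" using t by simp
    have "coord b (u \<star> ((x \<star> t) \<star> y)) = coord b ((u \<star> x) \<star> (t \<star> y))"
      if "u \<in> carrier T" "y \<in> carrier T" for u y
      using that x tc by (simp add: T.m_assoc del: T_simps)
    then show "x \<star> t \<in> ?J" using t x by (simp del: T_simps)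
    have "coord b (u \<star> ((t \<star> x) \<star> y)) = coord b (u \<star> (t \<star> (x \<star> y)))"
      if "u \<in> carrier T" "y \<in> carrier T" for u y
      using that x tc by (simp add: T.m_assoc del: T_simps)
    then show "t \<star> x \<in> ?J" using t x by (simp del: T_simps)
  qed
  moreover have "ext_relations n m A \<subseteq> ?J"
    using coordinate_relation ext_relations_subset by blast
  ultimately have "ext_ideal n m A \<subseteq> ?J"
    unfolding ext_ideal_def by (rule T.genideal_minimal)
  then have t: "t \<in> ?J" using assms by blast
  then have "coord b (\<one>\<^bsub>T\<^esub> \<star> (t \<star> \<one>\<^bsub>T\<^esub>)) = \<zero>" using T.one_closed by blast
  then show ?thesis using t by (simp del: T_simps)
qed

lemma coordinate_cls:
  assumes "s \<in> carrier T" "t \<in> carrier T" "cls s = cls t"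
  shows "coord b s = coord b t"
proof -
  have "s \<ominus>\<^bsub>T\<^esub> t \<in> ext_ideal n m A" using assms cls_eq_iff by blast
  then have 0: "coord b (s \<ominus>\<^bsub>T\<^esub> t) = \<zero>" by (rule coordinate_ext_ideal)
  have d: "s \<ominus>\<^bsub>T\<^esub> t \<in> carrier T" using assms by (simp del: T_simps)
  have "s = (s \<ominus>\<^bsub>T\<^esub> t) \<oplus>\<^bsub>T\<^esub> t" using assms by (simp add: T.minus_eq T.a_assoc T.l_neg del: T_simps)
  then have "coord b s = coord b (\<lambda>w. (s \<ominus>\<^bsub>T\<^esub> t) w \<oplus> t w)" by simp
  also have "\<dots> = coord b (s \<ominus>\<^bsub>T\<^esub> t) \<oplus> coord b t"
    by (rule coordinate_add) (use d assms in auto)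
  also have "\<dots> = coord b t" using 0 assms by (simp add: coordinate_closed)
  finally show ?thesis .
qed

lemma scalar_closed [simp]: "a \<in> carrier A \<Longrightarrow> scalar A a \<in> carrier T"
  by (simp add: scalar_monomial monomial_closed)

lemma cls_scale: "a \<in> carrier A \<Longrightarrow> t \<in> carrier T \<Longrightarrow> cls (\<lambda>w. a \<otimes> t w) = cls (scalar A a) \<bullet> cls t"
  by (simp add: cls_mult[symmetric] T_scalar_mult)

lemma cls_scalar_mult:
  "a \<in> carrier A \<Longrightarrow> b \<in> carrier A \<Longrightarrow> cls (scalar A (a \<otimes> b)) = cls (scalar A a) \<bullet> cls (scalar A b)"
proof -
  assume "a \<in> carrier A" "b \<in> carrier A"
  then have "(\<lambda>w. a \<otimes> scalar A b w) = scalar A (a \<otimes> b)" by (auto simp: scalar_def)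
  then show ?thesis using cls_scale[of a "scalar A b"] \<open>a \<in> carrier A\<close> \<open>b \<in> carrier A\<close> by simp
qed

lemma cls_scalar_one: "cls (scalar A \<one>) = \<one>\<^bsub>E\<^esub>"
  using cls_one by (simp add: scalar_def)

lemma cls_scalar_add:
  "a \<in> carrier A \<Longrightarrow> b \<in> carrier A \<Longrightarrow> cls (scalar A (a \<oplus> b)) = cls (scalar A a) \<oplus>\<^bsub>E\<^esub> cls (scalar A b)"
proof -
  assume a: "a \<in> carrier A" "b \<in> carrier A"
  have "scalar A (a \<oplus> b) = scalar A a \<oplus>\<^bsub>T\<^esub> scalar A b" using a by (auto simp: scalar_def)
  then show ?thesis using a by (simp add: cls_add[symmetric])
qed

text \<open>An even scalar is fixed by every twist and commutes with \<open>A\<close>, so left and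
  right multiplication by it agree already on tensors.\<close>

lemma even_scalar_central:
  assumes "a \<in> part A 0" "\<omega> \<in> carrier E"
  shows "cls (scalar A a) \<bullet> \<omega> = \<omega> \<bullet> cls (scalar A a)"
proof -
  obtain t where t: "t \<in> carrier T" "\<omega> = cls t" using cls_surj assms by blast
  have ac: "a \<in> carrier A" using assms part_carrier by blast
  have "(t \<star> scalar A a) w = t w \<otimes> a" for w
  proof -
    have tw: "twist A p (scalar A a v) = scalar A a v" for p v
      using twist_part[OF assms(1), of p] ac by (simp add: scalar_def int_smult_simps)
    have "(s \<star> scalar A a) w = s w \<otimes> a" if "\<And>w. s w \<in> carrier A" for s
      using that
    proof (induction w arbitrary: s)
      case Nil
      then show ?case using ac by (subst T_mult_Nil) (auto simp: scalar_def)
    next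
      case (Cons i w)
      have sc: "scalar A a v \<in> carrier A" for v using ac by (simp add: scalar_def)
      have "(s \<star> scalar A a) (i # w) = s [] \<otimes> scalar A a (i # w) \<oplus> ((\<lambda>v. s (i # v)) \<star> scalar A a) w"
        using Cons.prems sc by (simp only: T_mult_Cons tw)
      then show ?case using Cons ac by (simp add: scalar_def)
    qed
    then show ?thesis using t by simp
  qed
  then have "scalar A a \<star> t = t \<star> scalar A a"
    using t ac by (auto simp: T_scalar_mult even_commute[OF assms(1)])
  then show ?thesis using t ac by (simp add: cls_mult[symmetric])
qed

lemma E_double_eq_zero:
  assumes "\<omega> \<in> carrier E" "\<omega> = \<ominus>\<^bsub>E\<^esub> \<omega>"
  shows "\<omega> = \<zero>\<^bsub>E\<^esub>"
proof -
  obtain h where h: "h \<in> carrier A" "h \<oplus> h = \<one>" using half part_carrier by blast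
  have "\<omega> \<oplus>\<^bsub>E\<^esub> \<omega> = \<zero>\<^bsub>E\<^esub>" using assms by (metis E.r_neg)
  then have "cls (scalar A h) \<bullet> (\<omega> \<oplus>\<^bsub>E\<^esub> \<omega>) = \<zero>\<^bsub>E\<^esub>" using h by simp
  then have "cls (scalar A (h \<oplus> h)) \<bullet> \<omega> = \<zero>\<^bsub>E\<^esub>"
    using h(1) assms(1) by (simp add: cls_scalar_add E.l_distr E.r_distr)
  then show ?thesis using assms(1) by (simp add: h(2) cls_scalar_one)
qed

lemma cls_vector_swap:
  assumes v: "v \<in> vectors n m A p" and w: "w \<in> vectors n m A q"
  shows "cls v \<bullet> cls w = [(- ((- 1) ^ (p * q)) :: int)] \<cdot>\<^bsub>E\<^esub> (cls w \<bullet> cls v)"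
proof -
  let ?R = "(v \<star> w) \<oplus>\<^bsub>T\<^esub> signed T (p * q) (w \<star> v)"
  note c = vectorsD(1)[OF v] vectorsD(1)[OF w]
  have "?R \<in> ext_relations n m A" unfolding ext_relations_def Let_def using v w by blast
  then have "?R \<in> ext_ideal n m A"
    unfolding ext_ideal_def using T.genideal_self[OF ext_relations_subset] by blast
  moreover have sc: "signed T (p * q) (w \<star> v) \<in> carrier T"
    using c by (simp add: signed_def del: T_simps)
  moreover have "?R \<ominus>\<^bsub>T\<^esub> \<zero>\<^bsub>T\<^esub> = ?R" using c sc by (simp add: T.minus_eq del: T_simps)
  ultimately have "cls ?R = \<zero>\<^bsub>E\<^esub>"
    using cls_eq_iff[of ?R "\<zero>\<^bsub>T\<^esub>"] c cls_zero by (simp del: T_simps)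
  then have "cls v \<bullet> cls w \<oplus>\<^bsub>E\<^esub> cls (signed T (p * q) (w \<star> v)) = \<zero>\<^bsub>E\<^esub>"
    using c sc by (simp add: cls_add cls_mult del: T_simps)
  moreover have "cls (signed T (p * q) (w \<star> v)) = [((- 1) ^ (p * q) :: int)] \<cdot>\<^bsub>E\<^esub> (cls w \<bullet> cls v)"
    using c by (cases "even (p * q)")
      (simp_all add: signed_def cls_mult cls_uminus E.int_smult_simps del: T_simps even_mult_iff)
  ultimately have "cls v \<bullet> cls w = \<ominus>\<^bsub>E\<^esub> ([((- 1) ^ (p * q) :: int)] \<cdot>\<^bsub>E\<^esub> (cls w \<bullet> cls v))"
    using c by (intro E.minus_equality[symmetric]) (simp_all add: E.int_smult_simps)
  then show ?thesis using c by (simp add: E.int_smult_simps flip: E.add.int_pow_neg)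
qed

text \<open>The relation for two equal even vectors states only that the square is its own
  negative.\<close>

lemma cls_even_vector_square:
  assumes v: "v \<in> vectors n m A 0"
  shows "cls v \<bullet> cls v = \<zero>\<^bsub>E\<^esub>"
  using cls_vector_swap[OF v v] vectorsD(1)[OF v]
  by (intro E_double_eq_zero) (simp_all add: E.int_smult_simps)

section \<open>Basis vectors and normal forms\<close>

definition basis_vector :: "nat \<Rightarrow> (nat list \<Rightarrow> 'u) set" where
  "basis_vector i = cls (monomial \<one> [i])"

lemma monomial_vector: "i < n + m \<Longrightarrow> monomial \<one> [i] \<in> vectors n m A (word_parity n [i])"
proof -
  assume i: "i < n + m"
  have "\<one> \<in> part A (word_parity n [i] + word_parity n [i])"
    using part_one part_cong[of 0 "word_parity n [i] + word_parity n [i]"] by simp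
  then have "monomial \<one> [i] w \<in> part A (word_parity n [i] + word_parity n w)" for w
    using part_zero unfolding monomial_def by (cases "w = [i]") simp_all
  moreover have "monomial \<one> [i] \<in> homogeneous_tensors n m 1 A"
    using i monomial_closed[of \<one> "[i]"] unfolding homogeneous_tensors_def
      by (auto simp: monomial_def)
  ultimately show ?thesis unfolding vectors_def by blast
qed

lemma basis_vector_swap:
  "a < n + m \<Longrightarrow> b < n + m \<Longrightarrow>
    basis_vector a \<bullet> basis_vector b = [(exchange_sign n a b)] \<cdot>\<^bsub>E\<^esub> (basis_vector b \<bullet> basis_vector
      a)"
  unfolding basis_vector_def exchange_sign_parity by (intro cls_vector_swap monomial_vector)

lemma basis_vector_square: "a < n \<Longrightarrow> basis_vector a \<bullet> basis_vector a = \<zero>\<^bsub>E\<^esub>"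
  unfolding basis_vector_def using monomial_vector[of a] by (intro cls_even_vector_square) simp

lemma basis_vector_closed: "a < n + m \<Longrightarrow> basis_vector a \<in> carrier E"
  unfolding basis_vector_def by (intro cls_closed monomial_closed) auto

lemma cls_monomial:
  assumes "a \<in> carrier A" "set w \<subseteq> {..<n + m}"
  shows "cls (monomial a w) = cls (scalar A a) \<bullet> word_prod E basis_vector w"
proof -
  have one: "cls (monomial \<one> w) = word_prod E basis_vector w" if "set w \<subseteq> {..<n + m}" for w
    using that
  proof (induction w)
    case Nil
    then show ?case using cls_one by (simp add: monomial_def)
  next
    case (Cons i w)
    have "monomial \<one> (i # w) = monomial \<one> [i] \<star> monomial \<one> w"
      by (simp add: monomial_mult_monomial)
    then show ?case using Cons by (simp add: cls_mult monomial_closed basis_vector_def)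
  qed
  have "monomial a w = monomial a [] \<star> monomial \<one> w"
    using assms by (simp add: monomial_mult_monomial)
  then show ?thesis using assms by (simp add: cls_mult monomial_closed one scalar_monomial)
qed

text \<open>The basis vectors obey the exchange rule from which \<open>sorting_sign\<close> is
  built, so sorting a monomial in the quotient costs the same sign that \<open>coord\<close>
  attaches to its word. Words with a repeated even letter are included, with sign 0.\<close>

lemma cls_monomial_sort:
  assumes a: "a \<in> carrier A" and w: "set w \<subseteq> {..<n + m}"
  shows "cls (monomial a w) = cls (monomial ([(sorting_sign n w)] \<cdot> a) (sort w))"
proof -
  have x: "word_prod E basis_vector (sort w) \<in> carrier E"
    by (rule E.word_prod_closed) (use w basis_vector_closed in auto)
  have "word_prod E basis_vector w = [(sorting_sign n w)] \<cdot>\<^bsub>E\<^esub> word_prod E basis_vector (sort w)"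
  proof (rule E.word_prod_sort[where S = "{..<n + m}"])
    fix a b assume "a \<in> {..<n + m}"
    then show "basis_vector a \<in> carrier E" by (intro basis_vector_closed) simp
    show "a < n \<Longrightarrow> basis_vector a \<bullet> basis_vector a = \<zero>\<^bsub>E\<^esub>" by (rule basis_vector_square)
    assume "b \<in> {..<n + m}"
    with \<open>a \<in> {..<n + m}\<close>
    show "basis_vector a \<bullet> basis_vector b
      = [(exchange_sign n a b)] \<cdot>\<^bsub>E\<^esub> (basis_vector b \<bullet> basis_vector a)"
      by (intro basis_vector_swap) simp_all
  qed (rule w)
  then have "cls (monomial a w)
      = [(sorting_sign n w)] \<cdot>\<^bsub>E\<^esub> (cls (scalar A a) \<bullet> word_prod E basis_vector (sort w))"
    using a w x by (simp add: cls_monomial E.add_pow_rdistr_int)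
  also have "\<dots> = [(sorting_sign n w)] \<cdot>\<^bsub>E\<^esub> cls (monomial a (sort w))"
    using a w by (simp add: cls_monomial)
  also have "\<dots> = cls (monomial ([(sorting_sign n w)] \<cdot> a) (sort w))"
  proof -
    have c: "monomial a (sort w) \<in> carrier T" using a w by (simp add: monomial_closed)
    have "\<ominus>\<^bsub>T\<^esub> monomial a (sort w) = monomial (\<ominus> a) (sort w)"
      by (rule ext) (use c in \<open>auto simp: T_uminus monomial_def\<close>)
    moreover have "monomial \<zero> (sort w) = \<zero>\<^bsub>T\<^esub>" by (auto simp: monomial_def)
    ultimately show ?thesis using sorting_sign_cases[of n w] a c cls_zero cls_uminus[OF c]
      by (auto simp: int_smult_simps E.int_smult_simps simp del: T_simps)
  qed
  finally show ?thesis .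
qed

text \<open>The candidate for the representative of a class that is supported on basis
  words.\<close>

definition normal_form :: "nat \<Rightarrow> (nat list \<Rightarrow> 'u) \<Rightarrow> nat list \<Rightarrow> 'u" where
  "normal_form r t = (\<lambda>w. if w \<in> basis_words n m r then coord w t else \<zero>)"

lemma homogeneousD:
  assumes "t \<in> homogeneous_tensors n m r A"
  shows "t \<in> carrier T" "\<And>w. length w \<noteq> r \<Longrightarrow> t w = \<zero>"
  using assms by (auto simp: homogeneous_tensors_def)

lemma finite_basis_words: "finite (basis_words n m r)"
  by (rule finite_subset[OF _ finite_lists_length_eq[of "{..<n + m}" r]]) (auto simp:
    basis_words_def)

lemma normal_form_homogeneous:
  assumes "\<And>w. t w \<in> carrier A"
  shows "normal_form r t \<in> homogeneous_tensors n m r A"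
proof -
  have "finite {w. normal_form r t w \<noteq> \<zero>}"
    by (rule finite_subset[OF _ finite_basis_words[of r]]) (auto simp: normal_form_def)
  moreover have "normal_form r t w \<in> carrier A" for w
    using coordinate_closed[OF assms] by (simp add: normal_form_def)
  moreover have "normal_form r t w \<noteq> \<zero> \<Longrightarrow> w \<in> basis_words n m r" for w
    by (auto simp: normal_form_def split: if_splits)
  ultimately show ?thesis unfolding homogeneous_tensors_def
    by (auto simp: T_carrier basis_words_def)
qed

lemma coordinate_monomial:
  assumes "a \<in> carrier A"
  shows "coord b (monomial a w) = (if mset w = mset b then [(sorting_sign n w)] \<cdot> a else \<zero>)"
proof (cases "mset w = mset b")
  case True
  have "coord b (monomial a w) = (\<Oplus>z\<in>{z. mset z = mset b}. if w
    = z then [(sorting_sign n z)] \<cdot> a else \<zero>)"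
    unfolding coord_def using assms
    by (intro finsum_cong') (auto simp: monomial_def int_smult_simps)
  also have "\<dots> = [(sorting_sign n w)] \<cdot> a"
    by (rule finsum_singleton) (use True assms finite_same_mset in \<open>auto simp: int_smult_simps\<close>)
  finally show ?thesis using True by simp
next
  case False
  then have "monomial a w z = \<zero>" if "mset z = mset b" for z using that by (auto simp: monomial_def)
  then have "coord b (monomial a w) = \<zero>"
    unfolding coord_def by (intro add.finprod_one_eqI) auto
  then show ?thesis using False by simp
qed

text \<open>If the sign is 0, both sides vanish. Otherwise the sorted word is a basis word, and no
  other basis word has the same multiset of letters.\<close>

lemma normal_form_monomial:
  assumes "a \<in> carrier A" "set w \<subseteq> {..<n + m}" "length w = r"
  shows "normal_form r (monomial a w) = monomial ([(sorting_sign n w)] \<cdot> a) (sort w)"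
proof
  fix b
  show "normal_form r (monomial a w) b = monomial ([(sorting_sign n w)] \<cdot> a) (sort w) b"
  proof (cases "b = sort w")
    case True
    show ?thesis
    proof (cases "sorting_sign n w = 0")
      case True
      then show ?thesis using assms(1)
        by (simp add: normal_form_def coordinate_monomial int_smult_simps) (simp add: monomial_def)
    next
      case False
      then have "distinct (filter (\<lambda>i. i < n) w)" by (rule sorting_sign_nonzero_imp_distinct)
      then have "distinct (filter (\<lambda>i. i < n) (sort w))"
        by (metis distinct_sort filter_sort)
      then have "sort w \<in> basis_words n m r" using assms by (simp add: basis_words_def)
      then show ?thesis using True assms(1)
        by (simp add: normal_form_def coordinate_monomial) (simp add: monomial_def)
    qed
  next
    case False
    have "mset w \<noteq> mset b" if "b \<in> basis_words n m r"
      using that False by (metis (mono_tags, lifting) basis_words_def mem_Collect_eq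
        properties_for_sort)
    then show ?thesis using False assms(1)
      by (simp add: normal_form_def coordinate_monomial) (simp add: monomial_def)
  qed
qed

text \<open>By additivity, peeling one word at a time off the support, it is enough to treat
  monomials; there \<open>cls_monomial_sort\<close> and \<open>normal_form_monomial\<close> lead to
  the same tensor.\<close>

lemma cls_normal_form:
  assumes "t \<in> homogeneous_tensors n m r A"
  shows "cls t = cls (normal_form r t)"
proof -
  have "cls t = cls (normal_form r t)"
    if "finite W" "t \<in> homogeneous_tensors n m r A" "{w. t w \<noteq> \<zero>} \<subseteq> W" for W t
    using that
  proof (induction W arbitrary: t)
    case empty
    then have "t = \<zero>\<^bsub>T\<^esub>" by auto
    moreover have "normal_form r \<zero>\<^bsub>T\<^esub> = \<zero>\<^bsub>T\<^esub>" by (auto simp: normal_form_def coordinate_zero)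
    ultimately show ?case by simp
  next
    case (insert w W)
    note tD = homogeneousD[OF insert.prems(1)]
    show ?case
    proof (cases "t w = \<zero>")
      case True
      then show ?thesis using insert by (metis (mono_tags, lifting) insertE mem_Collect_eq
        subset_iff)
    next
      case False
      let ?t = "t(w := \<zero>)"
      have w: "set w \<subseteq> {..<n + m}" "length w = r" "t w \<in> carrier A"
        using False tD by (auto simp: T_carrier)
      have "finite {v. ?t v \<noteq> \<zero>}"
        by (rule finite_subset[of _ "{v. t v \<noteq> \<zero>}"]) (use tD(1) in \<open>auto simp: T_carrier\<close>)
      then have h: "?t \<in> homogeneous_tensors n m r A"
        using insert.prems(1) by (auto simp: homogeneous_tensors_def T_carrier)
      have sub: "{v. ?t v \<noteq> \<zero>} \<subseteq> W" using insert.prems(2) by auto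
      have IH: "cls ?t = cls (normal_form r ?t)" by (rule insert.IH[OF h sub])
      have mc: "monomial (t w) w \<in> carrier T" using w by (simp add: monomial_closed)
      have dec: "t = ?t \<oplus>\<^bsub>T\<^esub> monomial (t w) w" using tD(1) by (auto simp: monomial_def)
      have nf: "normal_form r t = normal_form r ?t \<oplus>\<^bsub>T\<^esub> normal_form r (monomial (t w) w)"
      proof
        fix b
        have "coord b t = coord b ?t \<oplus> coord b (monomial (t w) w)"
          by (subst dec, unfold T_simps, rule coordinate_add)
            (rule T_coeff[OF homogeneousD(1)[OF h]], rule T_coeff[OF mc])
        then show "normal_form r t b = (normal_form r ?t \<oplus>\<^bsub>T\<^esub> normal_form r (monomial (t w) w)) b"
          by (simp add: normal_form_def)
      qed
      have "cls t = cls ?t \<oplus>\<^bsub>E\<^esub> cls (monomial (t w) w)"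
        by (subst dec, rule cls_add) (rule homogeneousD(1)[OF h], rule mc)
      also have "\<dots> = cls (normal_form r ?t) \<oplus>\<^bsub>E\<^esub> cls (normal_form r (monomial (t w) w))"
        using w by (simp only: IH normal_form_monomial cls_monomial_sort)
      also have "\<dots> = cls (normal_form r t)"
        unfolding nf by (rule cls_add[symmetric])
          (use h mc homogeneousD(1) normal_form_homogeneous T_coeff in blast)+
      finally show ?thesis .
    qed
  qed
  moreover have "finite {w. t w \<noteq> \<zero>}" using homogeneousD(1)[OF assms] by (simp add: T_carrier)
  ultimately show ?thesis using assms by blast
qed

text \<open>The spanning half of the basis theorem; \<open>coordinate_cls\<close> is the converse,
  that the coordinates depend on the class only.\<close>

lemma cls_eq_coordinates:
  assumes "s \<in> homogeneous_tensors n m r A" "t \<in> homogeneous_tensors n m r A"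
    and "\<And>b. b \<in> basis_words n m r \<Longrightarrow> coord b s = coord b t"
  shows "cls s = cls t"
proof -
  have "normal_form r s = normal_form r t" using assms(3) by (auto simp: normal_form_def)
  then show ?thesis using cls_normal_form assms by metis
qed

text \<open>The independence half: the family \<open>c\<close> in \<open>ext_coordinates\<close> can
  be recovered from the class it represents. Only \<open>b\<close> itself contributes, with sign 1
  since it is sorted.\<close>

lemma coordinate_basis:
  assumes "\<And>w. c w \<in> carrier A" "\<And>w. w \<notin> basis_words n m r \<Longrightarrow> c w = \<zero>" "b \<in> basis_words n m r"
  shows "coord b c = c b"
proof -
  have "z = b" if "mset z = mset b" "z \<in> basis_words n m r" for z
    using that assms(3) by (metis (mono_tags, lifting) basis_words_def mem_Collect_eq
      properties_for_sort)
  moreover have "sorting_sign n b = 1"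
    using assms(3) by (intro sorting_sign_sorted) (auto simp: basis_words_def)
  ultimately have "coord b c = (\<Oplus>z\<in>{z. mset z = mset b}. if b = z then c z else \<zero>)"
    unfolding coord_def using assms
    by (intro finsum_cong') (auto simp: int_smult_simps, (metis int_smult_zero)+)
  also have "\<dots> = c b" by (rule finsum_singleton) (use assms finite_same_mset in auto)
  finally show ?thesis .
qed

end

section \<open>Matrices\<close>

lemma (in abelian_monoid) finsum_swap:
  assumes "finite I" "finite J" "\<And>i j. i \<in> I \<Longrightarrow> j \<in> J \<Longrightarrow> f i j \<in> carrier G"
  shows "(\<Oplus>i\<in>I. \<Oplus>j\<in>J. f i j) = (\<Oplus>j\<in>J. \<Oplus>i\<in>I. f i j)"
  using assms(1,3)
proof (induction I)
  case empty
  show ?case by simp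
next
  case (insert i I)
  then have f: "\<And>j. j \<in> J \<Longrightarrow> f i j \<in> carrier G" "\<And>i' j. i' \<in> I \<Longrightarrow> j \<in> J \<Longrightarrow> f i' j \<in> carrier G"
    by auto
  have "(\<Oplus>i\<in>insert i I. \<Oplus>j\<in>J. f i j) = (\<Oplus>j\<in>J. f i j) \<oplus> (\<Oplus>i\<in>I. \<Oplus>j\<in>J. f i j)"
    using insert.hyps f by (intro finsum_insert) (auto intro!: finsum_closed)
  also have "\<dots> = (\<Oplus>j\<in>J. f i j) \<oplus> (\<Oplus>j\<in>J. \<Oplus>i\<in>I. f i j)" using insert by simp
  also have "\<dots> = (\<Oplus>j\<in>J. f i j \<oplus> (\<Oplus>i\<in>I. f i j))"
    using f by (intro finsum_addf[symmetric]) (auto intro!: finsum_closed)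
  also have "\<dots> = (\<Oplus>j\<in>J. \<Oplus>i\<in>insert i I. f i j)"
    using insert.hyps f by (intro finsum_cong') (auto intro!: finsum_insert[symmetric]
      finsum_closed)
  finally show ?case .
qed

context half_superalgebra
begin

lemma supermatrixD:
  assumes "U \<in> supermatrices r n m A"
  shows "U i j \<in> part A (word_parity n [j])" "U i j \<in> carrier A" "\<not> (i < r \<and> j < n + m) \<Longrightarrow> U i j = \<zero>"
proof -
  show z: "\<not> (i < r \<and> j < n + m) \<Longrightarrow> U i j = \<zero>" using assms unfolding supermatrices_def by blast
  show p: "U i j \<in> part A (word_parity n [j])"
  proof (cases "i < r \<and> j < n + m")
    case True
    then have "U i j \<in> (if j < n then even_part A else odd_part A)"
      using assms unfolding supermatrices_def by blast
    then show ?thesis by (simp add: Defs.part_def split: if_splits)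
  next
    case False
    then show ?thesis using z part_zero by simp
  qed
  then show "U i j \<in> carrier A" by (rule part_carrier)
qed

lemma supermatrixI:
  assumes "\<And>i j. i < r \<Longrightarrow> j < n + m \<Longrightarrow> U i j \<in> part A (word_parity n [j])"
    and "\<And>i j. \<not> (i < r \<and> j < n + m) \<Longrightarrow> U i j = \<zero>"
  shows "U \<in> supermatrices r n m A"
proof -
  have "U i j \<in> (if j < n then even_part A else odd_part A)" if "i < r" "j < n + m" for i j
    using assms(1)[OF that] by (simp add: Defs.part_def split: if_splits)
  then show ?thesis using assms(2) unfolding supermatrices_def by blast
qed

lemma square_even: "g \<in> supermatrices r r 0 A \<Longrightarrow> g i k \<in> part A 0"
  using supermatrixD[of g r r 0 i k] part_zero by (cases "k < r") auto

lemma mat_mult_coeff_closed: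
  assumes "\<And>i k. g i k \<in> carrier A" "\<And>k j. U k j \<in> carrier A"
  shows "mat_mult A r g U i j \<in> carrier A"
  unfolding mat_mult_def by (rule finsum_closed) (use assms in auto)

lemma mat_mult_assoc:
  assumes g: "\<And>i k. g i k \<in> carrier A" and h: "\<And>i k. h i k \<in> carrier A"
    and U: "\<And>i k. U i k \<in> carrier A"
  shows "mat_mult A r (mat_mult A r g h) U = mat_mult A r g (mat_mult A r h U)"
proof (intro ext)
  fix i j
  have "mat_mult A r (mat_mult A r g h) U i j = (\<Oplus>k\<in>{..<r}. \<Oplus>l\<in>{..<r}. g i l \<otimes> h l k \<otimes> U k j)"
    unfolding mat_mult_def using g h U by (intro finsum_cong') (auto simp: finsum_ldistr)
  also have "\<dots> = (\<Oplus>l\<in>{..<r}. \<Oplus>k\<in>{..<r}. g i l \<otimes> h l k \<otimes> U k j)"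
    using g h U by (intro finsum_swap) auto
  also have "\<dots> = mat_mult A r g (mat_mult A r h U) i j"
    unfolding mat_mult_def using g h U
    by (intro finsum_cong') (auto simp: finsum_rdistr m_assoc)
  finally show "mat_mult A r (mat_mult A r g h) U i j = mat_mult A r g (mat_mult A r h U) i j" .
qed

lemma mat_mult_closed:
  assumes g: "g \<in> supermatrices r r 0 A" and U: "U \<in> supermatrices r n m A"
  shows "mat_mult A r g U \<in> supermatrices r n m A"
proof (rule supermatrixI)
  fix i j
  have "g i k \<otimes> U k j \<in> part A (word_parity n [j])" for k
    using part_mult[OF square_even[OF g] supermatrixD(1)[OF U], of i k k j] by simp
  then show "mat_mult A r g U i j \<in> part A (word_parity n [j])"
    unfolding mat_mult_def by (intro part_finsum)
  assume n: "\<not> (i < r \<and> j < n + m)"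
  have "g i k \<otimes> U k j = \<zero>" for k
    using n supermatrixD(2,3)[OF g] supermatrixD(2,3)[OF U] by (metis l_null r_null)
  then show "mat_mult A r g U i j = \<zero>" unfolding mat_mult_def by simp
qed

text \<open>Besides the identity matrix this covers the frame (1|0) in \<open>n|m\<close> columns,
  given by the same function; it is the test frame on which determinants are evaluated
  later.\<close>

lemma mat_one_supermatrix: "r \<le> n \<Longrightarrow> mat_one A r \<in> supermatrices r n m A"
  by (rule supermatrixI) (auto simp: mat_one_def part_zero part_one)

lemma mat_mult_one:
  assumes "\<And>i j. U i j \<in> carrier A" "\<And>i j. r \<le> i \<Longrightarrow> U i j = \<zero>"
  shows "mat_mult A r (mat_one A r) U = U"
proof (intro ext)
  fix i j
  show "mat_mult A r (mat_one A r) U i j = U i j"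
  proof (cases "i < r")
    case True
    have "mat_mult A r (mat_one A r) U i j = (\<Oplus>k\<in>{..<r}. if i = k then U k j else \<zero>)"
      unfolding mat_mult_def using True assms by (intro finsum_cong') (auto simp: mat_one_def)
    also have "\<dots> = U i j" by (rule finsum_singleton) (use True assms in auto)
    finally show ?thesis .
  next
    case False
    have "mat_one A r i k \<otimes> U k j = \<zero>" for k using False assms(1) by (simp add: mat_one_def)
    then show ?thesis using False assms(2) by (simp add: mat_mult_def)
  qed
qed

lemma mat_one_right:
  assumes g: "g \<in> supermatrices r r 0 A"
  shows "mat_mult A r g (mat_one A r) = g"
proof (intro ext)
  fix i j
  show "mat_mult A r g (mat_one A r) i j = g i j"
  proof (cases "j < r")
    case True
    have "mat_mult A r g (mat_one A r) i j = (\<Oplus>k\<in>{..<r}. if j = k then g i k else \<zero>)"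
      unfolding mat_mult_def using True supermatrixD(2)[OF g]
        by (intro finsum_cong') (auto simp: mat_one_def)
    also have "\<dots> = g i j" by (rule finsum_singleton) (use True supermatrixD(2)[OF g] in auto)
    finally show ?thesis .
  next
    case False
    have "(\<Oplus>k\<in>{..<r}. g i k \<otimes> mat_one A r k j) = \<zero>"
      by (rule add.finprod_one_eqI) (use False supermatrixD(2)[OF g] in \<open>auto simp: mat_one_def\<close>)
    then show ?thesis using False supermatrixD(3)[OF g] by (simp add: mat_mult_def)
  qed
qed

lemma GL_D:
  assumes "g \<in> GL r A"
  obtains h where "h \<in> GL r A" "mat_mult A r g h = mat_one A r" "mat_mult A r h g = mat_one A r"
  using assms unfolding GL_def by blast

lemma GL_supermatrix: "g \<in> GL r A \<Longrightarrow> g \<in> supermatrices r r 0 A"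
  unfolding GL_def by blast

lemma GL_one: "mat_one A r \<in> GL r A"
  using mat_one_supermatrix[of r r 0] mat_one_right[OF mat_one_supermatrix[of r r 0]]
  unfolding GL_def by blast

lemma GL_mult:
  assumes g: "g \<in> GL r A" and h: "h \<in> GL r A"
  shows "mat_mult A r g h \<in> GL r A"
proof -
  obtain g' where g': "g' \<in> GL r A" "mat_mult A r g g' = mat_one A r" "mat_mult A r g' g
    = mat_one A r"
    by (rule GL_D[OF g])
  obtain h' where h': "h' \<in> GL r A" "mat_mult A r h h' = mat_one A r" "mat_mult A r h' h
    = mat_one A r"
    by (rule GL_D[OF h])
  have sm: "k \<in> GL r A \<Longrightarrow> k \<in> supermatrices r r 0 A" for k by (rule GL_supermatrix)
  have inv: "mat_mult A r (mat_mult A r x y) (mat_mult A r y' x') = mat_one A r"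
    if c: "x \<in> GL r A" "y \<in> GL r A" "x' \<in> GL r A" "y' \<in> GL r A"
      and "mat_mult A r x x' = mat_one A r" "mat_mult A r y y' = mat_one A r" for x y x' y'
  proof -
    note e = supermatrixD(2)[OF sm[OF c(1)]] supermatrixD(2)[OF sm[OF c(2)]]
      supermatrixD(2)[OF sm[OF c(3)]] supermatrixD(2)[OF sm[OF c(4)]]
    have "mat_mult A r (mat_mult A r x y) (mat_mult A r y' x')
        = mat_mult A r x (mat_mult A r (mat_mult A r y y') x')"
      using e by (simp add: mat_mult_assoc mat_mult_coeff_closed)
    also have "mat_mult A r (mat_mult A r y y') x' = x'"
      unfolding that(6) by (rule mat_mult_one) (use e supermatrixD(3)[OF sm[OF c(3)]] in auto)
    finally show ?thesis using that by simp
  qed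
  have "mat_mult A r g h \<in> supermatrices r r 0 A" "mat_mult A r h' g' \<in> supermatrices r r 0 A"
    using g h g' h' sm mat_mult_closed by blast+
  moreover have "mat_mult A r (mat_mult A r g h) (mat_mult A r h' g') = mat_one A r"
    "mat_mult A r (mat_mult A r h' g') (mat_mult A r g h) = mat_one A r"
    using inv g h g' h' by blast+
  ultimately show ?thesis unfolding GL_def by blast
qed

lemma GL_act_assoc:
  assumes "g \<in> GL r A" "h \<in> GL r A" "U \<in> supermatrices r n m A"
  shows "mat_mult A r g (mat_mult A r h U) = mat_mult A r (mat_mult A r g h) U"
  by (rule mat_mult_assoc[symmetric])
    (use assms GL_supermatrix supermatrixD(2) in blast)+

lemma mat_one_act: "U \<in> supermatrices r n m A \<Longrightarrow> mat_mult A r (mat_one A r) U = U"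
  by (rule mat_mult_one) (simp_all add: supermatrixD)

lemma plane_self: "U \<in> supermatrices r n m A \<Longrightarrow> U \<in> plane A r U"
  unfolding plane_def by (rule image_eqI[OF _ GL_one]) (simp add: mat_one_act)

lemma plane_act:
  assumes g: "g \<in> GL r A" and U: "U \<in> supermatrices r n m A"
  shows "plane A r (mat_mult A r g U) = plane A r U"
proof
  show "plane A r (mat_mult A r g U) \<subseteq> plane A r U"
    unfolding plane_def using GL_act_assoc[OF _ g U] GL_mult[OF _ g] by auto
  obtain h where h: "h \<in> GL r A" "mat_mult A r h g = mat_one A r" using GL_D[OF g] by metis
  show "plane A r U \<subseteq> plane A r (mat_mult A r g U)"
  proof
    fix V assume "V \<in> plane A r U"
    then obtain k where k: "k \<in> GL r A" "V = mat_mult A r k U" unfolding plane_def by blast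
    have gU: "mat_mult A r g U \<in> supermatrices r n m A"
      by (rule mat_mult_closed[OF GL_supermatrix[OF g] U])
    have "mat_mult A r (mat_mult A r k h) (mat_mult A r g U)
      = mat_mult A r k (mat_mult A r h (mat_mult A r g U))"
      by (rule GL_act_assoc[OF k(1) h(1) gU, symmetric])
    also have "mat_mult A r h (mat_mult A r g U) = U"
      using GL_act_assoc[OF h(1) g U] h(2) mat_one_act[OF U] by simp
    finally show "V \<in> plane A r (mat_mult A r g U)"
      unfolding plane_def using k GL_mult[OF k(1) h(1)]
      by (intro image_eqI[where x = "mat_mult A r k h"]) simp_all
  qed
qed

lemma columns_mult:
  assumes g: "g \<in> supermatrices r r 0 A" and U: "\<And>i j. U i j \<in> carrier A"
  shows "columns A r (mat_mult A r g U) a = mat_mult A r g (columns A r U a)"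
proof (intro ext)
  fix i j
  show "columns A r (mat_mult A r g U) a i j = mat_mult A r g (columns A r U a) i j"
  proof (cases "i < r \<and> j < r")
    case True
    then show ?thesis unfolding columns_def mat_mult_def using supermatrixD(2)[OF g] U
      by (simp, intro finsum_cong') auto
  next
    case False
    have "g i k \<otimes> columns A r U a k j = \<zero>" for k
      using False supermatrixD(2,3)[OF g] U by (cases "i < r") (auto simp: columns_def)
    then show ?thesis using False by (auto simp: columns_def mat_mult_def)
  qed
qed

lemma columns_supermatrix:
  assumes U: "U \<in> supermatrices r n m A" and a: "length a = r" "set a \<subseteq> {..<n}"
  shows "columns A r U a \<in> supermatrices r r 0 A"
proof (rule supermatrixI)
  fix i j assume "i < r" "j < r + 0"
  then have "a ! j \<in> set a" using a by (intro nth_mem) simp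
  then have "a ! j < n" using a by auto
  then show "columns A r U a i j \<in> part A (word_parity r [j])"
    using supermatrixD(1)[OF U, of i "a ! j"] \<open>j < r + 0\<close> \<open>i < r\<close> by (simp add: columns_def)
qed (auto simp: columns_def)

end

context super_tensors
begin

section \<open>Coefficients of a product of rows\<close>

text \<open>This is \<open>T_mult_Cons\<close> for a left factor of degree one: the column chosen in
  the first row twists the coefficient of all remaining rows, and the nested twists amount to the
  Koszul signs. Words of the wrong length fall under the last equation.\<close>

fun row_coeff :: "(nat \<Rightarrow> nat \<Rightarrow> 'u) \<Rightarrow> nat list \<Rightarrow> nat list \<Rightarrow> 'u" where
  "row_coeff U [] [] = \<one>"
| "row_coeff U (i # is) (j # w) = U i j \<otimes> twist A (word_parity n [j]) (row_coeff U is w)"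
| "row_coeff U _ _ = \<zero>"

lemma row_coeff_closed:
  assumes "\<And>i j. U i j \<in> carrier A"
  shows "row_coeff U is w \<in> carrier A"
  using assms by (induction U "is" w rule: row_coeff.induct) auto

lemma row_coeff_length: "length w \<noteq> length is \<Longrightarrow> (\<And>i j. U i j \<in> carrier A) \<Longrightarrow> row_coeff U is w = \<zero>"
  by (induction U "is" w rule: row_coeff.induct) auto

lemma word_prod_rows:
  assumes U: "\<And>i j. U i j \<in> carrier A"
  shows "word_prod T (row_vector A U) is = row_coeff U is"
proof (induction "is")
  case Nil
  show ?case
  proof
    fix w show "word_prod T (row_vector A U) [] w = row_coeff U [] w" by (cases w) auto
  qed
next
  case (Cons i "is")
  have rc: "row_vector A U i w \<in> carrier A" for w using U
    by (simp add: row_vector_def split: list.split)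
  have rv: "row_vector A U i [] = \<zero>" "row_vector A U i [j] = U i j" for j
    by (simp_all add: row_vector_def)
  note c = row_coeff_closed[of U, OF U]
  show ?case
  proof
    fix w
    show "word_prod T (row_vector A U) (i # is) w = row_coeff U (i # is) w"
    proof (cases w)
      case Nil
      then show ?thesis using c rc by (simp add: Cons T_mult_Nil rv)
    next
      case (Cons j v)
      have "(row_vector A U i \<star> row_coeff U is) (j # v)
        = row_vector A U i [] \<otimes> row_coeff U is (j # v)
          \<oplus> ((\<lambda>v. row_vector A U i (j # v)) \<star> (\<lambda>v. twist A (word_parity n [j]) (row_coeff U is
            v))) v"
        by (rule T_mult_Cons) (use c rc in auto)
      also have "((\<lambda>v. row_vector A U i (j # v)) \<star> (\<lambda>v. twist A (word_parity n [j]) (row_coeff U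
        is v))) v
          = row_vector A U i [j] \<otimes> twist A (word_parity n [j]) (row_coeff U is v)"
        by (rule T_mult_scalar_left) (use c rc U in \<open>auto simp: row_vector_def split: list.split\<close>)
      finally show ?thesis using c U \<open>word_prod T (row_vector A U) is = row_coeff U is\<close>
        by (simp add: Cons rv del: word_parity_simps)
    qed
  qed
qed

lemma row_coeff_part:
  assumes "\<And>i j. U i j \<in> part A (word_parity n [j])"
  shows "row_coeff U is w \<in> part A (word_parity n w)"
  using assms
proof (induction U "is" w rule: row_coeff.induct)
  case (2 U i "is" j w)
  then show ?case using twist_part[of "row_coeff U is w" "word_parity n w" "word_parity n [j]"]
      part_mult[of "U i j" "word_parity n [j]" "[((-1) ^ (word_parity n [j] * word_parity n w) ::
        int)] \<cdot> row_coeff U is w" "word_parity n w"]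
      part_int by (simp only: row_coeff.simps) (simp del: word_parity_simps(2) add:
        word_parity_simps(3)[of n "[j]" w, simplified append.simps])
qed (auto simp: part_one part_zero)

lemma row_coeff_cong:
  assumes "\<And>i j. i \<in> set is \<Longrightarrow> j \<in> set w \<Longrightarrow> U i j = V i j"
  shows "row_coeff U is w = row_coeff V is w"
  using assms by (induction U "is" w rule: row_coeff.induct) auto

lemma row_coeff_eq_zero:
  assumes "\<And>i j. U i j \<in> carrier A" "k < length w" "k < length is" "U (is ! k) (w ! k) = \<zero>"
  shows "row_coeff U is w = \<zero>"
  using assms
proof (induction U "is" w arbitrary: k rule: row_coeff.induct)
  case (2 U i "is" j w)
  show ?case
  proof (cases k)
    case 0
    then show ?thesis using 2 row_coeff_closed by simp
  next
    case (Suc l)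
    then have "row_coeff U is w = \<zero>" using 2(1)[of l] 2(2-) by simp
    then show ?thesis using 2 by simp
  qed
qed auto

lemma row_coeff_ones:
  assumes "length w = length is" "\<And>k. k < length is \<Longrightarrow> U (is ! k) (w ! k) = \<one>"
  shows "row_coeff U is w = \<one>"
  using assms
proof (induction U "is" w rule: row_coeff.induct)
  case (2 U i "is" j w)
  have "row_coeff U is w = \<one>" using 2(1) 2(2) 2(3)[of "Suc _"] by simp
  then show ?case using 2(3)[of 0] by simp
qed auto

text \<open>Letters below \<open>n\<close> do not twist, so leading entries \<open>\<one>\<close>
  cancel whatever the parity of the remaining coefficient.\<close>

lemma row_coeff_even_ones:
  assumes "length u = length is" "set u \<subseteq> {..<n}" "\<And>k. k < length is \<Longrightarrow> U (is ! k) (u ! k) = \<one>"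
    "\<And>i j. U i j \<in> carrier A"
  shows "row_coeff U (is @ is') (u @ v) = row_coeff U is' v"
  using assms
proof (induction U "is" u rule: row_coeff.induct)
  case (2 U i "is" j w)
  have "row_coeff U (is @ is') (w @ v) = row_coeff U is' v"
    using 2(1) 2(2,3,5) 2(4)[of "Suc _"] by simp
  then show ?case using 2(3) 2(4)[of 0] row_coeff_closed[of U, OF 2(5)] by simp
qed auto

text \<open>Distinctness of the row indices makes row \<open>l\<close> occur exactly once in each
  product, which gives linearity in that row.\<close>

lemma row_coeff_row_add:
  assumes "\<And>i j. U i j \<in> carrier A" "\<And>j. x j \<in> carrier A" "\<And>j. y j \<in> carrier A" "distinct is" "l \<in>
    set is"
  shows "row_coeff (U(l := \<lambda>j. x j \<oplus> y j)) is w
    = row_coeff (U(l := x)) is w \<oplus> row_coeff (U(l := y)) is w"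
  using assms(4,5)
proof (induction "is" arbitrary: w)
  case (Cons i "is")
  have c: "row_coeff (U(l := z)) is v \<in> carrier A" if "\<And>j. z j \<in> carrier A" for v z
    by (rule row_coeff_closed) (use assms that in auto)
  show ?case
  proof (cases w)
    case Nil
    then show ?thesis by simp
  next
    case (Cons j v)
    show ?thesis
    proof (cases "i = l")
      case True
      have "row_coeff (U(l := z)) is v = row_coeff U is v" for z
        by (rule row_coeff_cong) (use True Cons.prems in auto)
      then show ?thesis using True assms row_coeff_closed[of U, OF assms(1)]
        by (simp add: Cons l_distr fun_upd_same del: fun_upd_apply)
    next
      case False
      then show ?thesis using Cons.IH[of v] Cons.prems assms c
        by (simp add: Cons r_distr twist_add fun_upd_same fun_upd_other del: fun_upd_apply)
    qed
  qed
qed simp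

text \<open>Being even, \<open>c\<close> is fixed by the twists and moves past the entries of the
  preceding rows.\<close>

lemma row_coeff_row_scale:
  assumes "\<And>i j. U i j \<in> carrier A" "\<And>j. x j \<in> carrier A" "c \<in> part A 0" "distinct is" "l \<in> set is"
  shows "row_coeff (U(l := \<lambda>j. c \<otimes> x j)) is w = c \<otimes> row_coeff (U(l := x)) is w"
  using assms(4,5)
proof (induction "is" arbitrary: w)
  case (Cons i "is")
  note cc = part_carrier[OF assms(3)]
  have rc: "row_coeff (U(l := x)) is v \<in> carrier A" for v
    by (rule row_coeff_closed) (use assms in auto)
  show ?case
  proof (cases w)
    case Nil
    then show ?thesis using cc by simp
  next
    case (Cons j v)
    show ?thesis
    proof (cases "i = l")
      case True
      have "row_coeff (U(l := z)) is v = row_coeff U is v" for z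
        by (rule row_coeff_cong) (use True Cons.prems in auto)
      then show ?thesis using True assms row_coeff_closed[of U, OF assms(1)] cc
        by (simp add: Cons m_assoc fun_upd_same del: fun_upd_apply)
    next
      case False
      have tw: "twist A p c = c" for p using twist_part[OF assms(3), of p] cc
        by (simp add: int_smult_simps)
      have "U i j \<otimes> (c \<otimes> z) = c \<otimes> (U i j \<otimes> z)" if "z \<in> carrier A" for z
        using that assms(1) cc even_commute[OF assms(3), of "U i j"] by (simp flip: m_assoc)
      then show ?thesis using False Cons.IH[of v] Cons.prems assms rc cc
        by (simp add: Cons twist_mult tw fun_upd_same fun_upd_other del: fun_upd_apply)
    qed
  qed
qed simp

end

section \<open>Multivectors of frames\<close>

locale super_pluecker = super_tensors A n m for A :: "('k, 'u) superalgebra" (structure) and n m +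
  fixes r :: nat
  assumes r_le: "r \<le> n"
begin

abbreviation matrices where "matrices \<equiv> supermatrices r n m A"
abbreviation rows where "rows U \<equiv> row_coeff U [0..<r]"
abbreviation emb where "emb a \<equiv> cls (scalar A a)"
abbreviation row_class where "row_class U i \<equiv> cls (row_vector A U i)"
abbreviation row_prod where "row_prod U \<equiv> word_prod E (row_class U)"
abbreviation mvec where "mvec U \<equiv> multivector n m r A U"

lemma emb_closed: "a \<in> carrier A \<Longrightarrow> emb a \<in> carrier E"
  by simp

lemma row_vector_vectors:
  assumes "U \<in> matrices"
  shows "row_vector A U i \<in> vectors n m A 0"
proof -
  let ?v = "row_vector A U i"
  have c: "?v w \<in> part A (word_parity n w)" and l: "?v w \<noteq> \<zero> \<Longrightarrow> \<exists>j<n + m. w = [j]" for w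
    using supermatrixD[OF assms, of i] part_zero
    by (auto simp: row_vector_def simp del: word_parity_simps split: list.splits)
  have "{w. ?v w \<noteq> \<zero>} \<subseteq> (\<lambda>j. [j]) ` {..<n + m}" using l by auto
  then have "finite {w. ?v w \<noteq> \<zero>}" by (rule finite_subset) simp
  then show ?thesis unfolding vectors_def homogeneous_tensors_def
    using c l part_carrier by (auto simp: T_carrier) fastforce+
qed

lemma row_class_closed: "U \<in> matrices \<Longrightarrow> row_class U i \<in> carrier E"
  using row_vector_vectors vectorsD(1) by blast

lemma cls_word_prod:
  assumes "\<And>i. x i \<in> carrier T"
  shows "cls (word_prod T x w) = word_prod E (\<lambda>i. cls (x i)) w"
proof (induction w)
  case Nil
  show ?case using cls_one by (simp del: T_simps)
next
  case (Cons i w)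
  have "word_prod T x w \<in> carrier T" using assms by (intro T.word_prod_closed)
  then show ?case using Cons assms by (simp add: cls_mult)
qed

lemma multivector_word_prod: "mvec U = row_prod U [0..<r]"
  by (simp add: multivector_def word_prod_def)

lemma multivector_cls:
  assumes "U \<in> matrices"
  shows "mvec U = cls (rows U)"
  using word_prod_rows[of U "[0..<r]", OF supermatrixD(2)[OF assms]]
    cls_word_prod[of "row_vector A U" "[0..<r]", OF vectorsD(1)[OF row_vector_vectors[OF assms]]]
  by (simp add: multivector_word_prod)

lemma row_tensor_homogeneous:
  assumes U: "U \<in> matrices"
  shows "rows U \<in> homogeneous_tensors n m r A" "rows U w \<in> part A (word_parity n w)"
proof -
  have "rows U \<in> carrier T"
    unfolding word_prod_rows[of U "[0..<r]", OF supermatrixD(2)[OF U], symmetric]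
    by (rule T.word_prod_closed) (rule vectorsD(1)[OF row_vector_vectors[OF U]])
  moreover have "rows U w = \<zero>" if "length w \<noteq> r" for w
    using that supermatrixD(2)[OF U] by (intro row_coeff_length) simp_all
  ultimately show "rows U \<in> homogeneous_tensors n m r A"
    unfolding homogeneous_tensors_def by blast
  show "rows U w \<in> part A (word_parity n w)"
    by (rule row_coeff_part) (rule supermatrixD(1)[OF U])
qed

lemma cls_scalar_finsum:
  assumes "\<And>i. i \<in> I \<Longrightarrow> f i \<in> carrier A"
  shows "emb (\<Oplus>i\<in>I. f i) = (\<Oplus>\<^bsub>E\<^esub>i\<in>I. emb (f i))"
proof -
  have z: "emb \<zero> = \<zero>\<^bsub>E\<^esub>" using cls_zero by (simp add: scalar_def)
  show ?thesis using assms
  proof (induction I rule: infinite_finite_induct)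
    case (insert i I)
    then have f: "f i \<in> carrier A" "\<And>j. j \<in> I \<Longrightarrow> f j \<in> carrier A" by auto
    then have "(\<Oplus>i\<in>insert i I. f i) = f i \<oplus> (\<Oplus>i\<in>I. f i)"
      using insert by (intro finsum_insert) auto
    moreover have "(\<Oplus>i\<in>I. f i) \<in> carrier A" using f by (intro finsum_closed) auto
    moreover have "(\<Oplus>\<^bsub>E\<^esub>i\<in>insert i I. emb (f i)) = emb (f i) \<oplus>\<^bsub>E\<^esub> (\<Oplus>\<^bsub>E\<^esub>i\<in>I. emb (f i))"
      using insert f by (intro E.finsum_insert) auto
    ultimately show ?case using insert f by (simp add: cls_scalar_add)
  qed (simp_all add: z)
qed

lemma emb_sorting_sign:
  assumes "a \<in> carrier A"
  shows "emb ([(sorting_sign N w)] \<cdot> a) = [(sorting_sign N w)] \<cdot>\<^bsub>E\<^esub> emb a"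
proof -
  have z: "emb \<zero> = \<zero>\<^bsub>E\<^esub>" using cls_zero by (simp add: scalar_def)
  have "emb (\<ominus> a) \<oplus>\<^bsub>E\<^esub> emb a = \<zero>\<^bsub>E\<^esub>"
    using assms by (simp add: cls_scalar_add[symmetric] l_neg z)
  then have "emb (\<ominus> a) = \<ominus>\<^bsub>E\<^esub> emb a" using assms by (intro E.minus_equality[symmetric]) auto
  then show ?thesis using sorting_sign_cases[of N w] assms z
    by (auto simp: int_smult_simps E.int_smult_simps)
qed

lemma row_class_mat_mult:
  assumes g: "g \<in> supermatrices r r 0 A" and U: "U \<in> matrices"
  shows "row_class (mat_mult A r g U) i = (\<Oplus>\<^bsub>E\<^esub>k\<in>{..<r}. emb (g i k) \<bullet> row_class U k)"
proof -
  note gc = supermatrixD(2)[OF g]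
  note v = vectorsD(1)[OF row_vector_vectors[OF U]]
  have main: "(\<lambda>w. \<Oplus>k\<in>N. g i k \<otimes> row_vector A U k w) \<in> carrier T \<and>
    cls (\<lambda>w. \<Oplus>k\<in>N. g i k \<otimes> row_vector A U k w) = (\<Oplus>\<^bsub>E\<^esub>k\<in>N. emb (g i k) \<bullet> row_class U k)"
    if "finite N" for N
    using that
  proof (induction N)
    case empty
    show ?case using cls_zero T.zero_closed by simp
  next
    case (insert k N)
    let ?s = "\<lambda>w. g i k \<otimes> row_vector A U k w" and ?t = "\<lambda>w. \<Oplus>k\<in>N. g i k \<otimes> row_vector A U k w"
    have s: "?s = scalar A (g i k) \<star> row_vector A U k" by (rule T_scalar_mult[OF gc v, symmetric])
    have sc: "?s \<in> carrier T" unfolding s using gc v by (intro T.m_closed) auto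
    have e: "(\<lambda>w. \<Oplus>k\<in>insert k N. g i k \<otimes> row_vector A U k w) = ?s \<oplus>\<^bsub>T\<^esub> ?t"
      using insert gc T_coeff[OF v] by (auto intro!: ext finsum_insert)
    have "(\<Oplus>\<^bsub>E\<^esub>k\<in>insert k N. emb (g i k) \<bullet> row_class U k)
        = emb (g i k) \<bullet> row_class U k \<oplus>\<^bsub>E\<^esub> (\<Oplus>\<^bsub>E\<^esub>k\<in>N. emb (g i k) \<bullet> row_class U k)"
      using insert gc v by (intro E.finsum_insert) auto
    also have "\<dots> = cls ?s \<oplus>\<^bsub>E\<^esub> cls ?t" using insert gc v by (simp add: cls_scale)
    also have "\<dots> = cls (?s \<oplus>\<^bsub>T\<^esub> ?t)" using insert sc by (intro cls_add[symmetric]) auto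
    finally show ?case unfolding e using T.a_closed[OF sc] insert by simp
  qed
  have "row_vector A (mat_mult A r g U) i w = (\<Oplus>k\<in>{..<r}. g i k \<otimes> row_vector A U k w)" for w
  proof -
    have "(\<Oplus>k\<in>{..<r}. g i k \<otimes> \<zero>) = \<zero>" using gc by simp
    then show ?thesis by (auto simp: row_vector_def mat_mult_def split: list.split)
  qed
  then have "row_vector A (mat_mult A r g U) i = (\<lambda>w. \<Oplus>k\<in>{..<r}. g i k \<otimes> row_vector A U k w)"
    by auto
  then show ?thesis using main[of "{..<r}"] by simp
qed

section \<open>The action of square matrices on multivectors\<close>

definition index_words :: "nat \<Rightarrow> nat list set" where
  "index_words l = {w. set w \<subseteq> {..<r} \<and> length w = l}"

lemma finite_index_words: "finite (index_words l)"
  unfolding index_words_def by (rule finite_lists_length_eq) simp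

lemma square_row_coeff:
  assumes g: "g \<in> supermatrices r r 0 A" and w: "w \<in> index_words l"
  shows "row_coeff g is w \<in> part A 0"
proof -
  have "row_coeff g is w \<in> part A (word_parity n w)"
  proof (rule row_coeff_part)
    fix i j show "g i j \<in> part A (word_parity n [j])"
      using square_even[OF g, of i j] supermatrixD(3)[OF g, of i j] part_zero r_le
      by (cases "j < r") auto
  qed
  moreover have "word_parity n w = 0"
    using w r_le by (fastforce simp: index_words_def word_parity_def filter_empty_conv)
  ultimately show ?thesis by simp
qed

text \<open>When the product of the rows is expanded, scalars built from \<open>g\<close> have to be
  moved past rows of \<open>U\<close>. Entries and row coefficients of a square matrix are even,
  hence central.\<close>

lemma row_product_expansion:
  assumes g: "g \<in> supermatrices r r 0 A" and U: "U \<in> matrices"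
  shows "row_prod (mat_mult A r g U) is
    = (\<Oplus>\<^bsub>E\<^esub>w\<in>index_words (length is). emb (row_coeff g is w) \<bullet> row_prod U w)"
proof (induction "is")
  case Nil
  have "index_words (length []) = {[]}" by (auto simp: index_words_def)
  moreover have "(\<Oplus>\<^bsub>E\<^esub>w\<in>{[]}. emb (row_coeff g [] w) \<bullet> row_prod U w) = \<one>\<^bsub>E\<^esub>"
    by (subst E.finsum_insert) (auto simp: cls_scalar_one)
  ultimately show ?case by simp
next
  case (Cons i "is")
  note gc = supermatrixD(2)[OF g]
  note x = row_class_closed[OF U]
  have wc: "row_prod U w \<in> carrier E" for w by (rule E.word_prod_closed) (rule x)
  have rc: "row_coeff g is w \<in> carrier A" for "is" w by (rule row_coeff_closed) (rule gc)
  let ?W = "index_words (length is)"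
  let ?f = "\<lambda>w. emb (row_coeff g (i # is) w) \<bullet> row_prod U w"
  have f: "?f w \<in> carrier E" for w using rc wc by (intro E.m_closed emb_closed)
  have gc0: "g i k \<in> part A 0" for i k by (rule square_even[OF g])
  have step: "(emb (g i k) \<bullet> row_class U k) \<bullet> (emb (row_coeff g is w) \<bullet> row_prod U w)
     = ?f (k # w)" if "k < r" "w \<in> ?W" for k w
  proof -
    have ev: "row_coeff g is w \<in> part A 0" using g that(2) by (rule square_row_coeff)
    have "(emb (g i k) \<bullet> row_class U k) \<bullet> (emb (row_coeff g is w) \<bullet> row_prod U w)
      = emb (g i k) \<bullet> (row_class U k \<bullet> emb (row_coeff g is w)) \<bullet> row_prod U w"
      using gc rc x wc by (simp add: E.m_assoc)
    also have "row_class U k \<bullet> emb (row_coeff g is w) = emb (row_coeff g is w) \<bullet> row_class U k"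
      by (rule even_scalar_central[OF ev x, symmetric])
    also have "emb (g i k) \<bullet> (emb (row_coeff g is w) \<bullet> row_class U k) \<bullet> row_prod U w
      = emb (g i k \<otimes> row_coeff g is w) \<bullet> row_prod U (k # w)"
      using gc rc x wc by (simp add: E.m_assoc cls_scalar_mult)
    also have "g i k \<otimes> row_coeff g is w = row_coeff g (i # is) (k # w)"
      using that r_le by simp
    finally show ?thesis .
  qed
  have "row_prod (mat_mult A r g U) (i # is)
      = (\<Oplus>\<^bsub>E\<^esub>k\<in>{..<r}. emb (g i k) \<bullet> row_class U k) \<bullet>
        (\<Oplus>\<^bsub>E\<^esub>w\<in>?W. emb (row_coeff g is w) \<bullet> row_prod U w)"
    using Cons by (simp add: row_class_mat_mult[OF g U])
  also have "\<dots> = (\<Oplus>\<^bsub>E\<^esub>k\<in>{..<r}. \<Oplus>\<^bsub>E\<^esub>w\<in>?W. ?f (k # w))"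
  proof -
    let ?S = "\<Oplus>\<^bsub>E\<^esub>w\<in>?W. emb (row_coeff g is w) \<bullet> row_prod U w"
    have Sc: "?S \<in> carrier E" using rc wc by (intro E.finsum_closed) auto
    have "(\<Oplus>\<^bsub>E\<^esub>k\<in>{..<r}. emb (g i k) \<bullet> row_class U k) \<bullet> ?S
      = (\<Oplus>\<^bsub>E\<^esub>k\<in>{..<r}. (emb (g i k) \<bullet> row_class U k) \<bullet> ?S)"
      using gc x Sc by (intro E.finsum_ldistr) auto
    also have "\<dots> = (\<Oplus>\<^bsub>E\<^esub>k\<in>{..<r}. \<Oplus>\<^bsub>E\<^esub>w\<in>?W. ?f (k # w))"
    proof (rule E.finsum_cong')
      fix k assume k: "k \<in> {..<r}"
      have "(emb (g i k) \<bullet> row_class U k) \<bullet> ?S = (\<Oplus>\<^bsub>E\<^esub>w\<in>?W. (emb (g i k) \<bullet> row_class U k) \<bullet>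
          (emb (row_coeff g is w) \<bullet> row_prod U w))"
        using gc x rc wc by (intro E.finsum_rdistr finite_index_words) auto
      also have "\<dots> = (\<Oplus>\<^bsub>E\<^esub>w\<in>?W. ?f (k # w))"
        by (rule E.finsum_cong') (use k f step in \<open>auto simp del: row_coeff.simps word_prod_simps\<close>)
      finally show "(emb (g i k) \<bullet> row_class U k) \<bullet> ?S = (\<Oplus>\<^bsub>E\<^esub>w\<in>?W. ?f (k # w))" .
    qed (use f in \<open>auto intro!: E.finsum_closed simp del: row_coeff.simps word_prod_simps\<close>)
    finally show ?thesis .
  qed
  also have "\<dots> = (\<Oplus>\<^bsub>E\<^esub>k\<in>{..<r}. \<Oplus>\<^bsub>E\<^esub>w\<in>Cons k ` ?W. ?f w)"
  proof (rule E.finsum_cong')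
    fix k
    show "(\<Oplus>\<^bsub>E\<^esub>w\<in>?W. ?f (k # w)) = (\<Oplus>\<^bsub>E\<^esub>w\<in>Cons k ` ?W. ?f w)"
      by (rule E.finsum_reindex[symmetric]) (use f in \<open>auto simp del: row_coeff.simps
        word_prod_simps\<close>)
  qed (use f in \<open>auto intro!: E.finsum_closed simp del: row_coeff.simps word_prod_simps\<close>)
  also have "\<dots> = (\<Oplus>\<^bsub>E\<^esub>w\<in>(\<Union>k\<in>{..<r}. Cons k ` ?W). ?f w)"
    by (rule E.add.finprod_UN_disjoint[symmetric]) (use f finite_index_words in \<open>auto simp:
      disjnt_def pairwise_def simp del: row_coeff.simps word_prod_simps\<close>)
  also have "(\<Union>k\<in>{..<r}. Cons k ` ?W) = index_words (length (i # is))"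
  proof
    show "index_words (length (i # is)) \<subseteq> (\<Union>k\<in>{..<r}. Cons k ` ?W)"
    proof
      fix w assume w: "w \<in> index_words (length (i # is))"
      then obtain k v where "w = k # v" by (cases w) (auto simp: index_words_def)
      with w show "w \<in> (\<Union>k\<in>{..<r}. Cons k ` ?W)" by (auto simp: index_words_def)
    qed
  qed (auto simp: index_words_def)
  finally show ?case .
qed

lemma sort_index_word:
  assumes "w \<in> index_words r" "distinct w"
  shows "sort w = [0..<r]"
proof -
  have "set w = {..<r}"
    using assms by (intro card_subset_eq) (auto simp: index_words_def distinct_card)
  then show ?thesis using assms(2) sorted_distinct_set_unique[of "sort w" "[0..<r]"]
    by (simp add: atLeast0LessThan)
qed

lemma row_class_swap:
  assumes "U \<in> matrices"
  shows "row_class U i \<bullet> row_class U j = \<ominus>\<^bsub>E\<^esub> (row_class U j \<bullet> row_class U i)"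
  using cls_vector_swap[OF row_vector_vectors[OF assms] row_vector_vectors[OF assms], of i j]
    row_class_closed[OF assms]
  by (simp add: E.int_smult_simps)

lemma row_product_sort:
  assumes U: "U \<in> matrices" and w: "set w \<subseteq> {..<r}"
  shows "row_prod U w = [(sorting_sign r w)] \<cdot>\<^bsub>E\<^esub> row_prod U (sort w)"
proof (rule E.word_prod_sort[where S = "{..<r}"])
  fix a b assume a: "a \<in> {..<r}"
  show "row_class U a \<in> carrier E" by (rule row_class_closed[OF U])
  show "row_class U a \<bullet> row_class U a = \<zero>\<^bsub>E\<^esub>"
    by (rule cls_even_vector_square[OF row_vector_vectors[OF U]])
  assume b: "b \<in> {..<r}"
  show "row_class U a \<bullet> row_class U b = [(exchange_sign r a b)] \<cdot>\<^bsub>E\<^esub> (row_class U b \<bullet> row_class U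
    a)"
    using a b row_class_swap[OF U, of a b] row_class_closed[OF U]
    by (simp add: exchange_sign_def E.int_smult_simps)
qed (rule w)

text \<open>The witness is the Leibniz formula for the determinant, summed over all words of row
  indices: words with a repetition have sign 0, and every other word sorts to
  \<open>[0..<r]\<close>. It is chosen before \<open>U\<close>, so one scalar serves all
  matrices.\<close>

lemma multivector_mat_mult:
  assumes g: "g \<in> supermatrices r r 0 A"
  obtains d where "d \<in> part A 0" "\<And>U. U \<in> matrices \<Longrightarrow>
    mvec (mat_mult A r g U) = emb d \<bullet> mvec U"
proof
  let ?c = "\<lambda>w. [(sorting_sign r w)] \<cdot> row_coeff g [0..<r] w"
  let ?d = "\<Oplus>w\<in>index_words r. ?c w"
  note gc = supermatrixD(2)[OF g]
  have rc: "row_coeff g [0..<r] w \<in> carrier A" for w by (rule row_coeff_closed) (rule gc)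
  have "row_coeff g [0..<r] w \<in> part A 0" if "w \<in> index_words r" for w
    using g that by (rule square_row_coeff)
  then show "?d \<in> part A 0" by (intro part_finsum part_int)
  fix U assume U: "U \<in> matrices"
  note x = row_class_closed[OF U]
  have wc: "row_prod U w \<in> carrier E" for w by (rule E.word_prod_closed) (rule x)
  have "mvec (mat_mult A r g U)
      = (\<Oplus>\<^bsub>E\<^esub>w\<in>index_words r. emb (row_coeff g [0..<r] w) \<bullet> row_prod U w)"
    using row_product_expansion[OF g U, of "[0..<r]"] by (simp add: multivector_word_prod)
  also have "\<dots> = (\<Oplus>\<^bsub>E\<^esub>w\<in>index_words r. emb (?c w) \<bullet> row_prod U [0..<r])"
  proof (rule E.finsum_cong')
    fix w assume w: "w \<in> index_words r"
    have e: "row_prod U w = [(sorting_sign r w)] \<cdot>\<^bsub>E\<^esub> row_prod U (sort w)"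
      using w by (intro row_product_sort[OF U]) (auto simp: index_words_def)
    have s: "sorting_sign r w = 0 \<or> sort w = [0..<r]"
    proof -
      have "filter (\<lambda>i. i < r) w = w" using w by (auto simp: index_words_def filter_id_conv)
      then show ?thesis using sorting_sign_nonzero_imp_distinct[of r w] sort_index_word[OF w]
        by auto
    qed
    have "emb (row_coeff g [0..<r] w) \<bullet> row_prod U w
        = [(sorting_sign r w)] \<cdot>\<^bsub>E\<^esub> (emb (row_coeff g [0..<r] w) \<bullet> row_prod U (sort w))"
      unfolding e using rc wc by (simp add: E.add_pow_rdistr_int)
    also have "\<dots> = [(sorting_sign r w)] \<cdot>\<^bsub>E\<^esub> (emb (row_coeff g [0..<r] w) \<bullet> row_prod U [0..<r])"
      using s rc wc by (auto simp: E.int_smult_simps)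
    also have "\<dots> = emb (?c w) \<bullet> row_prod U [0..<r]"
      using rc wc by (simp add: emb_sorting_sign E.add_pow_ldistr_int)
    finally show "emb (row_coeff g [0..<r] w) \<bullet> row_prod U w
        = emb (?c w) \<bullet> row_prod U [0..<r]" .
  qed (use rc wc in \<open>auto simp: int_smult_simps\<close>)
  also have "\<dots> = (\<Oplus>\<^bsub>E\<^esub>w\<in>index_words r. emb (?c w)) \<bullet> row_prod U [0..<r]"
    using rc wc by (intro E.finsum_ldistr[symmetric] finite_index_words) (auto simp:
      int_smult_simps)
  also have "(\<Oplus>\<^bsub>E\<^esub>w\<in>index_words r. emb (?c w)) = emb ?d"
    using rc by (intro cls_scalar_finsum[symmetric]) (simp add: int_smult_simps)
  finally show "mvec (mat_mult A r g U) = emb ?d \<bullet> mvec U"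
    by (simp add: multivector_word_prod)
qed

end

context super_pluecker
begin

lemma even_units_iff: "a \<in> even_units A \<longleftrightarrow> a \<in> part A 0 \<and> a \<in> Units A"
  by (simp add: even_units_def Defs.part_def)

lemma emb_mult_cls: "a \<in> carrier A \<Longrightarrow> t \<in> carrier T \<Longrightarrow> emb a \<bullet> cls t = cls (\<lambda>w. a \<otimes> t w)"
  by (rule cls_scale[symmetric])

section \<open>Minors of normalized frames, determinants and Cramer's rule\<close>

lemma coordinate_unique_word:
  assumes "mset w = mset b" "t w \<in> carrier A" "\<And>v. mset v = mset b \<Longrightarrow> v \<noteq> w \<Longrightarrow> t v = \<zero>"
  shows "coord b t = [(sorting_sign n w)] \<cdot> t w"
proof -
  have tc: "t z \<in> carrier A" if "mset z = mset b" for z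
    using assms(2) assms(3)[OF that] by (cases "z = w") auto
  have "coord b t = (\<Oplus>z\<in>{z. mset z = mset b}. if w = z then [(sorting_sign n z)] \<cdot> t z else \<zero>)"
    unfolding coord_def using assms(3) tc
    by (intro finsum_cong') (auto simp: int_smult_simps)
  also have "\<dots> = [(sorting_sign n w)] \<cdot> t w"
    by (rule finsum_singleton) (use assms tc finite_same_mset in \<open>auto simp: int_smult_simps\<close>)
  finally show ?thesis .
qed

lemma normalized_column:
  assumes "columns A r U a = mat_one A r" "k < r" "l < r"
  shows "U k (a ! l) = (if k = l then \<one> else \<zero>)"
  using fun_cong[OF fun_cong[OF assms(1), of k], of l] assms(2,3)
    by (simp add: columns_def mat_one_def)

text \<open>Any other permutation of \<open>a\<close> assigns to some row \<open>k\<close> a column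
  \<open>a ! l'\<close> with \<open>l'\<close> different from \<open>k\<close>, where the normalized
  entry is 0. Only \<open>a\<close> itself contributes, with a product of ones.\<close>

lemma coordinate_normalized:
  assumes U: "U \<in> matrices" and a: "length a = r" "distinct a" "set a \<subseteq> {..<n}"
    and one: "columns A r U a = mat_one A r"
  shows "coord a (rows U) = [(sorting_sign n a)] \<cdot> \<one>"
proof -
  note c = supermatrixD(2)[OF U]
  have "rows U a = \<one>"
    by (rule row_coeff_ones) (use a normalized_column[OF one] in auto)
  moreover have "rows U v = \<zero>" if v: "mset v = mset a" "v \<noteq> a" for v
  proof -
    have l: "length v = r" "set v = set a" using v(1) a mset_eq_length mset_eq_setD by metis+
    then obtain k where k: "k < r" "v ! k \<noteq> a ! k" using v(2) a by (metis nth_equalityI)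
    then obtain l' where "l' < r" "v ! k = a ! l'" using l a by (metis in_set_conv_nth)
    then show ?thesis using k l normalized_column[OF one k(1)]
      by (intro row_coeff_eq_zero[of U k]) (auto simp: c)
  qed
  ultimately show ?thesis using coordinate_unique_word[of a a "rows U"] by simp
qed

text \<open>The only nonzero product reads column \<open>j\<close> in row \<open>i\<close> and the
  ones elsewhere. The column \<open>j\<close> may be even or odd, and this is how the odd entries of
  a frame become visible in the multivector.\<close>

lemma coordinate_normalized_replace:
  assumes U: "U \<in> matrices" and a: "length a = r" "distinct a" "set a \<subseteq> {..<n}"
    and one: "columns A r U a = mat_one A r" and i: "i < r" and j: "j \<notin> set a"
  shows "coord (a[i := j]) (rows U) = [(sorting_sign n (a[i := j]))] \<cdot> U i j"
proof -
  note c = supermatrixD(2)[OF U]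
  have u: "a[i := j] = take i a @ j # drop (Suc i) a" using i a
    by (simp add: upd_conv_take_nth_drop)
  have split: "[0..<r] = [0..<i] @ i # [Suc i..<r]"
    using i upt_add_eq_append[of 0 i "r - i"] upt_conv_Cons[of i r] by simp
  have "rows U (a[i := j]) = row_coeff U (i # [Suc i..<r]) (j # drop (Suc i) a)"
    unfolding u split
  proof (rule row_coeff_even_ones)
    show "set (take i a) \<subseteq> {..<n}" by (rule order_trans[OF set_take_subset a(3)])
    show "U ([0..<i] ! k) (take i a ! k) = \<one>" if "k < length [0..<i]" for k
      using that i a normalized_column[OF one, of k k] by simp
  qed (use c i a in auto)
  also have "\<dots> = U i j"
  proof -
    \<comment> \<open>Only ones follow row \<open>i\<close>, and the twist caused by an odd
      \<open>j\<close> fixes \<open>\<one>\<close>.\<close>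
    have "row_coeff U [Suc i..<r] (drop (Suc i) a) = \<one>"
    proof (rule row_coeff_ones)
      show "U ([Suc i..<r] ! k) (drop (Suc i) a ! k) = \<one>" if "k < length [Suc i..<r]" for k
        using that i a normalized_column[OF one, of "Suc i + k" "Suc i + k"] by simp
    qed (use a in simp)
    then show ?thesis using c by simp
  qed
  finally have "rows U (a[i := j]) = U i j" .
  moreover have "rows U v = \<zero>" if "mset v = mset (a[i := j])" "v \<noteq> a[i := j]" for v
  proof -
    have l: "length v = r" using that(1) a mset_eq_length by (metis length_list_update)
    have dj: "distinct (a[i := j])" using a j by (simp add: distinct_list_update)
    then have dv: "distinct v" using that(1) by (metis mset_eq_imp_distinct_iff)
    have sv: "set v = set (a[i := j])" using that(1) by (rule mset_eq_setD)
    have ai: "a ! i \<notin> set v"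
    proof
      assume "a ! i \<in> set v"
      then have "a ! i \<in> set (a[i := j])" using sv by simp
      then obtain k where "k < r" "a[i := j] ! k = a ! i" using a
        by (metis in_set_conv_nth length_list_update)
      then show False using a i j by (cases "k = i") (auto simp: nth_eq_iff_index_eq)
    qed
    \<comment> \<open>If no row received the column belonging to another row, each row
      \<open>k\<close> would hold \<open>a ! k\<close> or \<open>j\<close>. As \<open>a ! i\<close>
      does not occur in \<open>v\<close>, row \<open>i\<close> would hold \<open>j\<close>, and by
      distinctness the other rows their own columns, so \<open>v\<close> would be
      \<open>a[i := j]\<close>.\<close>
    have "\<exists>k<r. \<exists>l'<r. v ! k = a ! l' \<and> k \<noteq> l'"
    proof (rule ccontr)
      assume no: "\<not> ?thesis"
      have mem: "v ! k = a ! k \<or> v ! k = j" if "k < r" for k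
      proof -
        have "v ! k \<in> set (a[i := j])" using that l sv by (metis nth_mem)
        then have "v ! k = j \<or> v ! k \<in> set a" using set_update_subset_insert by fastforce
        then show ?thesis using no that a by (metis in_set_conv_nth)
      qed
      have vi: "v ! i = j" using mem[OF i] ai l i by (metis nth_mem)
      have "v = a[i := j]"
      proof (rule nth_equalityI)
        fix k assume "k < length v"
        then have k: "k < r" using l by simp
        show "v ! k = a[i := j] ! k"
        proof (cases "k = i")
          case False
          then have "v ! k \<noteq> j" using vi dv k i l by (metis nth_eq_iff_index_eq)
          then show ?thesis using mem[OF k] False by simp
        qed (use vi i a in simp)
      qed (use l a in simp)
      with that(2) show False by simp
    qed
    then obtain k l' where "k < r" "l' < r" "v ! k = a ! l'" "k \<noteq> l'" by blast
    then show ?thesis using l normalized_column[OF one]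
      by (intro row_coeff_eq_zero[of U k]) (auto simp: c)
  qed
  ultimately show ?thesis using coordinate_unique_word[of "a[i := j]" "a[i := j]" "rows U"] c
    by simp
qed

lemma coordinate_emb:
  assumes "a \<in> carrier A" "s \<in> carrier T" "t \<in> carrier T" "cls s = emb a \<bullet> cls t"
  shows "coord b s = a \<otimes> coord b t"
proof -
  have "scalar A a \<star> t \<in> carrier T" using assms by (intro T.m_closed) auto
  then have "(\<lambda>w. a \<otimes> t w) \<in> carrier T" using assms by (simp add: T_scalar_mult)
  then have "coord b s = coord b (\<lambda>w. a \<otimes> t w)"
    using assms by (intro coordinate_cls) (simp_all add: emb_mult_cls)
  then show ?thesis using assms by (simp add: coordinate_scale)
qed

lemma row_tensor_carrier: "U \<in> matrices \<Longrightarrow> rows U \<in> carrier T"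
  using row_tensor_homogeneous(1) homogeneousD(1) by blast

lemma columns_upt: "g \<in> supermatrices r r 0 A \<Longrightarrow> columns A r g [0..<r] = g"
  by (intro ext) (auto simp: columns_def supermatrixD(3))

lemma square_matrices: "g \<in> supermatrices r r 0 A \<Longrightarrow> g \<in> matrices"
proof (rule supermatrixI)
  fix i j assume g: "g \<in> supermatrices r r 0 A"
  show "g i j \<in> part A (word_parity n [j])"
    using square_even[OF g, of i j] supermatrixD(3)[OF g, of i j] part_zero r_le
    by (cases "j < r") auto
  show "g i j = \<zero>" if "\<not> (i < r \<and> j < n + m)"
    by (rule supermatrixD(3)[OF g]) (use that r_le in auto)
qed

lemma upt_chart: "length [0..<r] = r" "distinct [0..<r]" "set [0..<r] \<subseteq> {..<n}" "sorted [0..<r]"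
  using r_le by auto

lemma coordinate_mat_one: "coord [0..<r] (rows (mat_one A r)) = \<one>"
proof -
  have "columns A r (mat_one A r) [0..<r] = mat_one A r"
    by (rule columns_upt[OF mat_one_supermatrix]) simp
  then have "coord [0..<r] (rows (mat_one A r)) = [(sorting_sign n [0..<r])] \<cdot> \<one>"
    by (intro coordinate_normalized mat_one_supermatrix r_le upt_chart)
  also have "sorting_sign n [0..<r] = 1" by (rule sorting_sign_sorted) (use upt_chart in auto)
  finally show ?thesis by (simp add: int_smult_simps)
qed

text \<open>Both matrices are applied in turn to the frame (1|0). The result is that frame again,
  and comparing the coordinates at \<open>[0..<r]\<close>, which are 1, leaves
  \<open>d \<otimes> d' = \<one>\<close>.\<close>

lemma right_inverse_det:
  assumes g: "g \<in> supermatrices r r 0 A" and h: "h \<in> supermatrices r r 0 A"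
    and gh: "mat_mult A r g h = mat_one A r"
  obtains d d' where "d \<in> part A 0" "d' \<in> part A 0" "d \<otimes> d' = \<one>"
    "\<And>U. U \<in> matrices \<Longrightarrow> mvec (mat_mult A r g U) = emb d \<bullet> mvec U"
    "\<And>U. U \<in> matrices \<Longrightarrow> mvec (mat_mult A r h U) = emb d' \<bullet> mvec U"
proof -
  obtain d where d: "d \<in> part A 0" "\<And>U. U \<in> matrices \<Longrightarrow>
      mvec (mat_mult A r g U) = emb d \<bullet> mvec U"
    by (rule multivector_mat_mult[OF g]) blast
  obtain d' where d': "d' \<in> part A 0" "\<And>U. U \<in> matrices \<Longrightarrow>
      mvec (mat_mult A r h U) = emb d' \<bullet> mvec U"
    by (rule multivector_mat_mult[OF h]) blast
  let ?P = "mat_one A r"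
  have P: "?P \<in> matrices" by (rule mat_one_supermatrix[OF r_le])
  have hP: "mat_mult A r h ?P \<in> matrices" by (rule mat_mult_closed[OF h P])
  note dc = part_carrier[OF d(1)] part_carrier[OF d'(1)]
  have "?P = mat_mult A r g (mat_mult A r h ?P)"
    using mat_mult_assoc[of g h ?P r] supermatrixD(2)[OF g] supermatrixD(2)[OF h]
      supermatrixD(2)[OF P]
      gh mat_one_act[OF P] by simp
  then have "mvec ?P = emb d \<bullet> (emb d' \<bullet> mvec ?P)"
    using d(2)[OF hP] d'(2)[OF P] by simp
  then have "cls (rows ?P) = emb (d \<otimes> d') \<bullet> cls (rows ?P)"
    using dc row_tensor_carrier[OF P] by (simp add: multivector_cls[OF P] cls_scalar_mult E.m_assoc)
  then have "coord [0..<r] (rows ?P) = (d \<otimes> d') \<otimes> coord [0..<r] (rows ?P)"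
    using dc row_tensor_carrier[OF P] by (intro coordinate_emb) auto
  then have "d \<otimes> d' = \<one>" using dc by (simp add: coordinate_mat_one)
  with d d' show thesis using that by blast
qed

lemma GL_det:
  assumes "g \<in> GL r A"
  obtains d where "d \<in> even_units A"
    "\<And>U. U \<in> matrices \<Longrightarrow> mvec (mat_mult A r g U) = emb d \<bullet> mvec U"
proof -
  obtain h where h: "h \<in> GL r A" "mat_mult A r g h = mat_one A r" using GL_D[OF assms] by metis
  obtain d d' where d: "d \<in> part A 0" "d' \<in> part A 0" "d \<otimes> d' = \<one>"
    "\<And>U. U \<in> matrices \<Longrightarrow> mvec (mat_mult A r g U) = emb d \<bullet> mvec U"
    by (rule right_inverse_det[OF GL_supermatrix[OF assms] GL_supermatrix[OF h(1)] h(2)]) blast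
  then have "d \<in> even_units A"
    using even_unitI[OF d(1) part_carrier[OF d(2)] d(3)] by (simp add: even_units_iff)
  then show thesis using that d(4) by blast
qed

text \<open>Replacing row \<open>l\<close> of \<open>U\<close> by row \<open>i\<close> repeats a factor of the product of the rows.\<close>

lemma coordinate_repeated_row:
  assumes U: "U \<in> matrices" and "i < r" "l < r" "i \<noteq> l"
  shows "coord b (rows (U(l := U i))) = \<zero>"
proof -
  let ?V = "U(l := U i)"
  let ?f = "\<lambda>k. if k = l then i else k"
  have V: "?V \<in> matrices"
    using assms(2,3) supermatrixD(1,3)[OF U] by (intro supermatrixI) (auto split: if_splits)
  have "row_class ?V k = row_class U (?f k)" for k
  proof -
    have "row_vector A ?V k w = row_vector A U (?f k) w" for w
      by (auto simp: row_vector_def split: list.split)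
    then show ?thesis by presburger
  qed
  then have "mvec ?V = row_prod U (map ?f [0..<r])"
    by (simp only: multivector_word_prod word_prod_map)
  also have "\<dots> = [(sorting_sign r (map ?f [0..<r]))] \<cdot>\<^bsub>E\<^esub> row_prod U (sort (map ?f [0..<r]))"
    by (rule row_product_sort[OF U]) (use assms(2) in auto)
  also have "sorting_sign r (map ?f [0..<r]) = 0"
  proof (rule ccontr)
    assume "sorting_sign r (map ?f [0..<r]) \<noteq> 0"
    then have "distinct (filter (\<lambda>i. i < r) (map ?f [0..<r]))"
      by (rule sorting_sign_nonzero_imp_distinct)
    moreover have "filter (\<lambda>i. i < r) (map ?f [0..<r]) = map ?f [0..<r]"
      by (rule filter_True) (use assms(2) in auto)
    ultimately have "inj_on ?f {..<r}" by (simp add: distinct_map atLeast0LessThan)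
    then show False using inj_onD[of ?f "{..<r}" i l] assms by auto
  qed
  also have "[(0::int)] \<cdot>\<^bsub>E\<^esub> row_prod U (sort (map ?f [0..<r])) = \<zero>\<^bsub>E\<^esub>"
    by (intro E.int_smult_simps E.word_prod_closed row_class_closed[OF U])
  finally have "cls (rows ?V) = cls \<zero>\<^bsub>T\<^esub>"
    using cls_zero by (simp only: multivector_cls[OF V])
  then have "coord b (rows ?V) = coord b \<zero>\<^bsub>T\<^esub>"
    by (intro coordinate_cls row_tensor_carrier[OF V] T.zero_closed)
  then show ?thesis by (simp add: coordinate_zero)
qed

text \<open>All permutations of \<open>b\<close> use the letters of \<open>b\<close> only. In
  Cramer's rule this permits a row to be altered outside the columns of the minor.\<close>

lemma coordinate_row_cong:
  assumes "\<And>i j. j \<in> set b \<Longrightarrow> U i j = V i j" "\<And>i j. U i j \<in> carrier A" "\<And>i j. V i j \<in> carrier A"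
  shows "coord b (rows U) = coord b (rows V)"
  unfolding coord_def
proof (rule finsum_cong')
  fix z assume "z \<in> {z. mset z = mset b}"
  then have "set z = set b" by (auto dest: mset_eq_setD)
  then have "rows U z = rows V z" using assms(1) by (intro row_coeff_cong) auto
  then show "[(sorting_sign n z)] \<cdot> rows U z = [(sorting_sign n z)] \<cdot> rows V z" by simp
qed (use row_coeff_closed[of V, OF assms(3)] in \<open>auto simp: int_smult_simps\<close>)

lemma coordinate_row_sum:
  assumes U: "\<And>i j. U i j \<in> carrier A" and x: "\<And>k j. x k j \<in> carrier A" and c: "\<And>k. c k \<in> part A 0"
    and l: "l < r" and N: "finite N"
  shows "coord b (rows (U(l := \<lambda>j. \<Oplus>k\<in>N. c k \<otimes> x k j)))
    = (\<Oplus>k\<in>N. c k \<otimes> coord b (rows (U(l := x k))))"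
proof -
  note cc = part_carrier[OF c]
  have rc: "rows (U(l := y)) w \<in> carrier A" if "\<And>j. y j \<in> carrier A" for y w
    by (rule row_coeff_closed) (use U that in auto)
  have scale: "coord b (rows (U(l := \<lambda>j. a \<otimes> y j))) = a \<otimes> coord b (rows (U(l := y)))"
    if "a \<in> part A 0" "\<And>j. y j \<in> carrier A" for a y
  proof -
    have "rows (U(l := \<lambda>j. a \<otimes> y j)) = (\<lambda>w. a \<otimes> rows (U(l := y)) w)"
      using U that l by (intro ext row_coeff_row_scale) auto
    then show ?thesis using that part_carrier rc by (simp only: coordinate_scale)
  qed
  show ?thesis using N
  proof (induction N)
    case empty
    have "rows (U(l := \<lambda>j. \<zero> \<otimes> \<zero>)) = (\<lambda>w. \<zero> \<otimes> rows (U(l := \<lambda>j. \<zero>)) w)"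
      using U part_zero l by (intro ext row_coeff_row_scale) auto
    also have "\<dots> = (\<lambda>w. \<zero>)" using rc[of "\<lambda>j. \<zero>"] by simp
    finally show ?case by (simp add: coordinate_zero del: fun_upd_apply)
  next
    case (insert k N)
    let ?s = "\<lambda>j. \<Oplus>k\<in>N. c k \<otimes> x k j"
    have sc: "?s j \<in> carrier A" for j using x cc by (intro finsum_closed) auto
    have "(\<lambda>j. \<Oplus>k\<in>insert k N. c k \<otimes> x k j) = (\<lambda>j. c k \<otimes> x k j \<oplus> ?s j)"
      using insert x cc by (intro ext finsum_insert) auto
    moreover have "rows (U(l := \<lambda>j. c k \<otimes> x k j \<oplus> ?s j))
        = (\<lambda>w. rows (U(l := \<lambda>j. c k \<otimes> x k j)) w \<oplus> rows (U(l := ?s)) w)"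
      using U x cc sc l by (intro ext row_coeff_row_add) auto
    moreover have "coord b (\<lambda>w. rows (U(l := \<lambda>j. c k \<otimes> x k j)) w \<oplus> rows (U(l := ?s)) w)
        = coord b (rows (U(l := \<lambda>j. c k \<otimes> x k j))) \<oplus> coord b (rows (U(l := ?s)))"
      using x cc sc by (intro coordinate_add rc) auto
    moreover have "(\<Oplus>k\<in>insert k N. c k \<otimes> coord b (rows (U(l := x k))))
       = c k \<otimes> coord b (rows (U(l := x k))) \<oplus> (\<Oplus>k\<in>N. c k \<otimes> coord b (rows (U(l := x k))))"
      using insert x cc by (intro finsum_insert) (auto intro!: coordinate_closed rc)
    ultimately show ?case using insert x c by (simp add: scale del: fun_upd_apply)
  qed
qed

text \<open>The right inverse comes from Cramer's rule.\<close>

lemma columns_right_inverse: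
  assumes U: "U \<in> matrices" and a: "length a = r" "distinct a" "set a \<subseteq> {..<n}"
    and unit: "coord a (rows U) \<in> Units A"
  obtains h where "h \<in> supermatrices r r 0 A" "mat_mult A r (columns A r U a) h = mat_one A r"
proof -
  note Uc = supermatrixD(2)[OF U]
  let ?D = "coord a (rows U)"
  \<comment> \<open>\<open>?e k\<close> is the unit row at column \<open>a ! k\<close>, and
    \<open>?F l y\<close> is the minor with row \<open>l\<close> replaced by \<open>y\<close>. Thus
    \<open>?F l (?e k)\<close> is a cofactor, and the matrix \<open>h\<close> below is the adjugate
    divided by the minor \<open>?D\<close>.\<close>
  let ?e = "\<lambda>k j. if j = a ! k then \<one> else \<zero>"
  let ?F = "\<lambda>l y. coord a (rows (U(l := y)))"
  have par: "word_parity n a = 0" using a(3) by (auto simp: word_parity_def filter_empty_conv)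
  have DP: "?D \<in> part A 0"
    using coordinate_part[of "rows U" a] row_tensor_homogeneous(2)[OF U] par by simp
  have iD: "inv ?D \<in> part A 0" by (rule even_unit_inverse[OF DP unit])
  have FP: "?F l (?e k) \<in> part A 0" if "k < r" for l k
  proof -
    have "a ! k \<in> set a" using that a by (intro nth_mem) simp
    then have "a ! k < n" using a by auto
    then have "(U(l := ?e k)) i j \<in> part A (word_parity n [j])" for i j
      using supermatrixD(1)[OF U, of i j] part_one part_zero by auto
    then have "rows (U(l := ?e k)) w \<in> part A (word_parity n w)" for w by (intro row_coeff_part)
    then show ?thesis using coordinate_part[of "rows (U(l := ?e k))" a] par by simp
  qed
  define h where "h k l = (if k < r \<and> l < r then ?F l (?e k) \<otimes> inv ?D else \<zero>)" for k l
  have hs: "h \<in> supermatrices r r 0 A"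
  proof (rule supermatrixI)
    fix i j assume "i < r" "j < r + 0"
    then show "h i j \<in> part A (word_parity r [j])" using part_mult[OF FP iD, of i j]
      by (simp add: h_def)
  qed (auto simp: h_def)
  have "mat_mult A r (columns A r U a) h i l = mat_one A r i l" for i l
  proof (cases "i < r \<and> l < r")
    case False
    have "columns A r U a i k \<otimes> h k l = \<zero>" if "k < r" for k
      using False Uc part_carrier[OF FP[OF that]] part_carrier[OF iD]
      by (cases "i < r") (auto simp: columns_def h_def)
    then have "mat_mult A r (columns A r U a) h i l = \<zero>"
      unfolding mat_mult_def by (intro add.finprod_one_eqI) auto
    then show ?thesis using False by (auto simp: mat_one_def)
  next
    case True
    then have i: "i < r" and l: "l < r" by auto
    have ev: "U i (a ! k) \<in> part A 0" if "k < r" for k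
    proof -
      have "a ! k \<in> set a" using that a by (intro nth_mem) simp
      then have "a ! k < n" using a by auto
      then show ?thesis using supermatrixD(1)[OF U, of i "a ! k"] by simp
    qed
    \<comment> \<open>The cutoff at \<open>r\<close> makes every \<open>c k\<close> even, as
      \<open>coordinate_row_sum\<close> requires.\<close>
    define c where "c k = (if k < r then U i (a ! k) else \<zero>)" for k
    have cp: "c k \<in> part A 0" for k using ev part_zero by (simp add: c_def)
    have Fc: "?F l (?e k) \<in> carrier A" if "k < r" for k by (rule part_carrier[OF FP[OF that]])
    have "mat_mult A r (columns A r U a) h i l = (\<Oplus>k\<in>{..<r}. c k \<otimes> ?F l (?e k) \<otimes> inv ?D)"
      unfolding mat_mult_def using i l Fc part_carrier[OF iD] part_carrier[OF cp]
      by (intro finsum_cong') (auto simp: columns_def h_def c_def[symmetric] m_assoc Uc simp del: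
        fun_upd_apply)
    also have "\<dots> = (\<Oplus>k\<in>{..<r}. c k \<otimes> ?F l (?e k)) \<otimes> inv ?D"
      using Fc part_carrier[OF iD] part_carrier[OF cp]
      by (intro finsum_ldistr[symmetric]) (auto simp del: fun_upd_apply)
    also have "(\<Oplus>k\<in>{..<r}. c k \<otimes> ?F l (?e k)) = ?F l (\<lambda>j. \<Oplus>k\<in>{..<r}. c k \<otimes> ?e k j)"
      by (rule coordinate_row_sum[symmetric]) (use Uc cp l in auto)
    \<comment> \<open>On the columns in \<open>a\<close> the combination of unit rows is row
      \<open>i\<close> of \<open>U\<close>; other columns do not affect this minor.\<close>
    also have "\<dots> = ?F l (U i)"
    proof (rule coordinate_row_cong)
      fix p j assume "j \<in> set a"
      then obtain k where k: "k < r" "j = a ! k" using a by (metis in_set_conv_nth)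
      have "(\<Oplus>k\<in>{..<r}. c k \<otimes> ?e k j) = (\<Oplus>k'\<in>{..<r}. if k = k' then c k' else \<zero>)"
        using part_carrier[OF cp] k a by (intro finsum_cong') (auto simp: nth_eq_iff_index_eq)
      also have "\<dots> = c k" by (rule finsum_singleton) (use k part_carrier[OF cp] in auto)
      finally show "(U(l := \<lambda>j. \<Oplus>k\<in>{..<r}. c k \<otimes> ?e k j)) p j = (U(l := U i)) p j"
        using k by (simp add: c_def)
    qed (use Uc part_carrier[OF cp] in \<open>auto intro!: finsum_closed\<close>)
    \<comment> \<open>For \<open>i = l\<close> the minor is \<open>?D\<close> itself, otherwise it
      has a repeated row.\<close>
    also have "?F l (U i) \<otimes> inv ?D = mat_one A r i l"
      using True unit coordinate_repeated_row[OF U i l] part_carrier[OF iD] by (cases "i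
        = l") (auto simp: mat_one_def)
    finally show ?thesis .
  qed
  then have "mat_mult A r (columns A r U a) h = mat_one A r" by auto
  with hs show thesis using that by blast
qed

text \<open>Cramer's rule, argued with rows, gives a right inverse \<open>h\<close> of the matrix
  \<open>?g\<close>. The determinant of \<open>h\<close> is then a unit, so the rule applies to
  \<open>h\<close> as well and gives \<open>k\<close> with \<open>h k = 1\<close>; associativity
  forces \<open>k = ?g\<close>, and \<open>h\<close> is a two-sided inverse.\<close>

lemma columns_GL:
  assumes U: "U \<in> matrices" and a: "length a = r" "distinct a" "set a \<subseteq> {..<n}"
    and unit: "coord a (rows U) \<in> Units A"
  shows "columns A r U a \<in> GL r A"
proof -
  let ?g = "columns A r U a"
  have g: "?g \<in> supermatrices r r 0 A" by (rule columns_supermatrix[OF U a(1,3)])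
  obtain h where h: "h \<in> supermatrices r r 0 A" and gh: "mat_mult A r ?g h = mat_one A r"
    by (rule columns_right_inverse[OF U a unit])
  obtain d d' where d: "d \<in> part A 0" "d' \<in> part A 0" "d \<otimes> d' = \<one>"
    "\<And>U. U \<in> matrices \<Longrightarrow> mvec (mat_mult A r h U) = emb d' \<bullet> mvec U"
    by (rule right_inverse_det[OF g h gh]) blast
  note dc = part_carrier[OF d(1)] part_carrier[OF d(2)]
  have P: "mat_one A r \<in> matrices" by (rule mat_one_supermatrix[OF r_le])
  have hm: "h \<in> matrices" by (rule square_matrices[OF h])
  \<comment> \<open>As \<open>h\<close> times the test frame is \<open>h\<close>, the scalar
    \<open>d'\<close> is the coordinate of \<open>h\<close> at \<open>[0..<r]\<close>, which is the
    form in which Cramer's rule needs it.\<close>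
  have "cls (rows h) = emb d' \<bullet> cls (rows (mat_one A r))"
    using d(4)[OF P] mat_one_right[OF h] by (simp add: multivector_cls hm P)
  then have "coord [0..<r] (rows h) = d'"
    using coordinate_emb[of d' "rows h" "rows (mat_one A r)" "[0..<r]"] dc
      row_tensor_carrier[OF hm] row_tensor_carrier[OF P] by (simp add: coordinate_mat_one)
  moreover have "d' \<in> Units A"
    using even_unitI[OF d(2) dc(1)] even_commute[OF d(2) dc(1)] d(3) by simp
  ultimately obtain k where k: "k \<in> supermatrices r r 0 A" "mat_mult A r h k = mat_one A r"
    using columns_right_inverse[OF hm upt_chart(1,2,3)] columns_upt[OF h] by metis
  have "?g = mat_mult A r ?g (mat_mult A r h k)" unfolding k(2)
    by (rule mat_one_right[OF g, symmetric])
  also have "\<dots> = mat_mult A r (mat_mult A r ?g h) k"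
    by (rule mat_mult_assoc[symmetric]) (use supermatrixD(2) g h k in blast)+
  also have "\<dots> = k" unfolding gh by (rule mat_one_act[OF k(1)])
  finally have "mat_mult A r h ?g = mat_one A r" using k(2) by simp
  then show ?thesis unfolding GL_def using g h gh by blast
qed

end

section \<open>Charts given by increasing lists of even columns\<close>

definition is_chart :: "nat \<Rightarrow> nat \<Rightarrow> nat list \<Rightarrow> bool" where
  "is_chart n r a \<longleftrightarrow> length a = r \<and> sorted_wrt (<) a \<and> set a \<subseteq> {..<n}"

lemma is_chartD:
  assumes "is_chart n r a"
  shows "length a = r" "distinct a" "set a \<subseteq> {..<n}" "sorted a"
  using assms by (simp_all add: is_chart_def strict_sorted_iff)

lemma is_chart_parity: "is_chart n r a \<Longrightarrow> word_parity n a = 0"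
  by (auto simp: is_chart_def word_parity_def filter_empty_conv)

lemma is_chart_basis: "is_chart n r a \<Longrightarrow> a \<in> basis_words n m r"
  using is_chartD[of n r a] by (auto simp: basis_words_def)

lemma is_chart_sign: "is_chart n r a \<Longrightarrow> sorting_sign n a = 1"
  using is_chartD[of n r a] by (intro sorting_sign_sorted) auto

context super_pluecker
begin

section \<open>Points of the Grassmannian and of the projective superspace\<close>

text \<open>\<open>V\<close> is the inverse of the chosen submatrix times \<open>U\<close>; its
  entries are the local coordinates of the plane in the chart \<open>a\<close>.\<close>

lemma normalize:
  assumes U: "U \<in> matrices" and a: "is_chart n r a" and G: "columns A r U a \<in> GL r A"
  obtains V where "V \<in> matrices" "columns A r V a = mat_one A r"
    "U = mat_mult A r (columns A r U a) V" "V \<in> frames n m r A" "plane A r U = plane A r V"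
proof -
  let ?g = "columns A r U a"
  obtain h where h: "h \<in> GL r A" "mat_mult A r ?g h = mat_one A r" "mat_mult A r h ?g = mat_one A r"
    by (rule GL_D[OF G])
  let ?V = "mat_mult A r h U"
  have V: "?V \<in> matrices" by (rule mat_mult_closed[OF GL_supermatrix[OF h(1)] U])
  have one: "columns A r ?V a = mat_one A r"
    using columns_mult[OF GL_supermatrix[OF h(1)] supermatrixD(2)[OF U]] h(3) by simp
  have e: "U = mat_mult A r ?g ?V"
    using GL_act_assoc[OF G h(1) U] h(2) mat_one_act[OF U] by simp
  have "?V \<in> frames n m r A"
    unfolding frames_def using V one GL_one a by (auto simp: is_chart_def)
  moreover have "plane A r U = plane A r ?V" using plane_act[OF h(1) U] by simp
  ultimately show thesis using that V one e by blast
qed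

lemma coordinate_chart_normalized:
  assumes "V \<in> matrices" "is_chart n r a" "columns A r V a = mat_one A r"
  shows "coord a (rows V) = \<one>"
  using coordinate_normalized[OF assms(1) is_chartD(1-3)[OF assms(2)] assms(3)] is_chart_sign[OF
    assms(2)]
  by (simp add: int_smult_simps)

lemma multivector_GL_coordinate:
  assumes g: "g \<in> GL r A" and U: "U \<in> matrices"
  obtains d where "d \<in> even_units A"
    "cls (rows (mat_mult A r g U)) = emb d \<bullet> cls (rows U)"
    "\<And>b. coord b (rows (mat_mult A r g U)) = d \<otimes> coord b (rows U)"
proof -
  obtain d where d: "d \<in> even_units A"
    "\<And>U. U \<in> matrices \<Longrightarrow> mvec (mat_mult A r g U) = emb d \<bullet> mvec U"
    by (rule GL_det[OF g]) blast
  have gU: "mat_mult A r g U \<in> matrices" by (rule mat_mult_closed[OF GL_supermatrix[OF g] U])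
  have e: "cls (rows (mat_mult A r g U)) = emb d \<bullet> cls (rows U)"
    using d(2)[OF U] by (simp add: multivector_cls U gU)
  moreover have "coord b (rows (mat_mult A r g U)) = d \<otimes> coord b (rows U)" for b
    using d(1) e row_tensor_carrier[OF U] row_tensor_carrier[OF gU]
    by (intro coordinate_emb) (auto simp: even_units_iff part_carrier)
  ultimately show thesis using that d(1) by blast
qed

text \<open>Membership in a chart, defined by an invertible matrix, becomes invertibility of one
  coordinate, a condition that also makes sense for points of the projective superspace and is
  easily transported along morphisms.\<close>

lemma chart_unit_iff:
  assumes U: "U \<in> matrices" and a: "is_chart n r a"
  shows "columns A r U a \<in> GL r A \<longleftrightarrow> coord a (rows U) \<in> Units A"
proof
  assume G: "columns A r U a \<in> GL r A"
  obtain V where V: "V \<in> matrices" "columns A r V a = mat_one A r" "U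
    = mat_mult A r (columns A r U a) V"
    by (rule normalize[OF U a G])
  obtain d where d: "d \<in> even_units A"
    "\<And>b. coord b (rows (mat_mult A r (columns A r U a) V)) = d \<otimes> coord b (rows V)"
    by (rule multivector_GL_coordinate[OF G V(1)]) blast
  have "coord a (rows U) = d"
    using d(2)[of a] V(3) coordinate_chart_normalized[OF V(1) a V(2)] Units_closed[of d] d(1)
    by (simp add: even_units_iff)
  then show "coord a (rows U) \<in> Units A" using d(1) by (simp add: even_units_iff)
qed (rule columns_GL[OF U is_chartD(1-3)[OF a]])

lemma frames_iff:
  "U \<in> frames n m r A \<longleftrightarrow> U \<in> matrices \<and> (\<exists>a. is_chart n r a \<and> coord a (rows U) \<in> Units A)"
  unfolding frames_def using chart_unit_iff[of U] by (auto simp: is_chart_def)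

section \<open>Projective points and the tensors representing them\<close>

text \<open>Points are represented by even tensors of degree \<open>r\<close> instead of coordinate
  families on basis words, since \<open>rows U\<close> is such a tensor without any reduction to
  normal form.\<close>

definition nondegenerate :: "(nat list \<Rightarrow> 'u) set" where
  "nondegenerate = {t \<in> homogeneous_tensors n m r A. (\<forall>w. t w \<in> part A (word_parity n w)) \<and>
     (\<exists>w\<in>basis_words n m r. even (word_parity n w) \<and> coord w t \<in> Units A)}"

definition point :: "(nat list \<Rightarrow> 'u) \<Rightarrow> (nat list \<Rightarrow> 'u) set set" where
  "point t = proj_class n m A (cls t)"

lemma nondegenerateD:
  assumes "t \<in> nondegenerate"
  shows "t \<in> homogeneous_tensors n m r A" "t \<in> carrier T" "t w \<in> part A (word_parity n w)"
  using assms homogeneousD(1) by (auto simp: nondegenerate_def)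

text \<open>A coordinate family is itself such a tensor, with coordinates equal to its coefficients;
  conversely the normal form of a tensor is a coordinate family of its class.\<close>

lemma proj_vectors_eq: "proj_vectors n m r A = cls ` nondegenerate"
proof
  show "proj_vectors n m r A \<subseteq> cls ` nondegenerate"
  proof
    fix \<omega> assume "\<omega> \<in> proj_vectors n m r A"
    then obtain c w where c: "\<omega> = cls c" "\<And>v. c v \<in> carrier A" "\<And>v. v \<notin> basis_words n m r \<Longrightarrow> c v = \<zero>"
      "\<And>v. c v \<in> part A (word_parity n v)"
      and w: "w \<in> basis_words n m r" "even (word_parity n w)" "c w \<in> Units A"
      unfolding proj_vectors_def ext_coordinates_def by blast
    have cb: "coord b c = c b" if "b \<in> basis_words n m r" for b
      using c(2,3) that by (rule coordinate_basis)
    then have "normal_form r c = c" using c(3) by (auto simp: normal_form_def)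
    then have "c \<in> homogeneous_tensors n m r A" using normal_form_homogeneous[of c r, OF c(2)]
      by simp
    then have "c \<in> nondegenerate" unfolding nondegenerate_def using c(4) w cb by auto
    then show "\<omega> \<in> cls ` nondegenerate" using c(1) by blast
  qed
  show "cls ` nondegenerate \<subseteq> proj_vectors n m r A"
  proof
    fix \<omega> assume "\<omega> \<in> cls ` nondegenerate"
    then obtain t w where t: "t \<in> nondegenerate" "\<omega> = cls t" and w: "w \<in> basis_words n m r"
      "even (word_parity n w)" "coord w t \<in> Units A"
      unfolding nondegenerate_def by blast
    let ?c = "normal_form r t"
    note tD = nondegenerateD[OF t(1)]
    have "ext_coordinates n m r A \<omega> ?c"
      unfolding ext_coordinates_def t(2) using cls_normal_form[OF tD(1)] coordinate_closed[of t]
        tD(2)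
      by (auto simp: normal_form_def)
    moreover have "?c v \<in> part A (word_parity n v)" for v
      using coordinate_part[of t v, OF tD(3)] part_zero by (simp add: normal_form_def)
    moreover have "?c w \<in> Units A" using w by (simp add: normal_form_def)
    ultimately show "\<omega> \<in> proj_vectors n m r A"
      unfolding proj_vectors_def ext_power_def using w t(2) tD(1) by blast
  qed
qed

lemma even_units_mult: "a \<in> even_units A \<Longrightarrow> b \<in> even_units A \<Longrightarrow> a \<otimes> b \<in> even_units A"
  using part_mult[of a 0 b 0] by (simp add: even_units_iff)

lemma even_units_inv: "a \<in> even_units A \<Longrightarrow> inv a \<in> even_units A"
  using even_unit_inverse by (simp add: even_units_iff)

lemma even_units_one: "\<one> \<in> even_units A"
  by (simp add: even_units_iff part_one)

lemma even_units_carrier: "a \<in> even_units A \<Longrightarrow> a \<in> carrier A"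
  using Units_closed by (simp add: even_units_iff)

lemma proj_class_scale:
  assumes a: "a \<in> even_units A" and w: "\<omega> \<in> carrier E"
  shows "proj_class n m A (emb a \<bullet> \<omega>) = proj_class n m A \<omega>"
proof -
  have sub: "proj_class n m A (emb a \<bullet> \<omega>) \<subseteq> proj_class n m A \<omega>"
    if a: "a \<in> even_units A" and w: "\<omega> \<in> carrier E" for a \<omega>
  proof
    fix \<eta> assume "\<eta> \<in> proj_class n m A (emb a \<bullet> \<omega>)"
    then obtain b where b: "b \<in> even_units A" "\<eta> = emb b \<bullet> (emb a \<bullet> \<omega>)"
      unfolding proj_class_def by blast
    then have "\<eta> = emb (b \<otimes> a) \<bullet> \<omega>"
      using a w by (simp add: cls_scalar_mult even_units_carrier E.m_assoc)
    then show "\<eta> \<in> proj_class n m A \<omega>"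
      unfolding proj_class_def using even_units_mult[OF b(1) a] by blast
  qed
  have "\<omega> = emb (inv a) \<bullet> (emb a \<bullet> \<omega>)"
  proof -
    have "emb (inv a) \<bullet> (emb a \<bullet> \<omega>) = emb (inv a \<otimes> a) \<bullet> \<omega>"
      using a w even_units_inv[OF a] by (simp add: cls_scalar_mult even_units_carrier E.m_assoc)
    also have "inv a \<otimes> a = \<one>" using a by (simp add: even_units_iff)
    finally show ?thesis using w by (simp add: cls_scalar_one)
  qed
  then have "proj_class n m A \<omega> \<subseteq> proj_class n m A (emb a \<bullet> \<omega>)"
    using sub[OF even_units_inv[OF a], of "emb a \<bullet> \<omega>"] a w by (simp add: even_units_carrier)
  then show ?thesis using sub[OF a w] by blast
qed

lemma proj_class_self: "\<omega> \<in> carrier E \<Longrightarrow> \<omega> \<in> proj_class n m A \<omega>"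
  unfolding proj_class_def using even_units_one cls_scalar_one E.l_one[of \<omega>]
    by (metis (mono_tags, lifting) mem_Collect_eq)

lemma point_eqI:
  assumes "a \<in> even_units A" "t \<in> carrier T" "cls s = emb a \<bullet> cls t"
  shows "point s = point t"
  unfolding point_def assms(3) using assms by (intro proj_class_scale) auto

lemma point_eqD:
  assumes "s \<in> carrier T" "point s = point t"
  obtains a where "a \<in> even_units A" "cls s = emb a \<bullet> cls t"
proof -
  have "cls s \<in> point t" using assms proj_class_self[of "cls s"] by (auto simp: point_def)
  then show thesis using that unfolding point_def proj_class_def by blast
qed

text \<open>A point is a set of cosets, and each coset is a set of tensors. The action of a morphism
  ranges over all tensors two levels down, and these agree up to an even unit in the exterior
  algebra.\<close>

lemma point_mem:
  assumes t: "t \<in> carrier T" and w: "\<omega> \<in> point t" and s: "s \<in> \<omega>"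
  obtains a where "a \<in> even_units A" "s \<in> carrier T" "cls s = emb a \<bullet> cls t"
proof -
  obtain a where a: "a \<in> even_units A" "\<omega> = emb a \<bullet> cls t"
    using w unfolding point_def proj_class_def by blast
  have "(\<lambda>w. a \<otimes> t w) = scalar A a \<star> t" by (rule T_scalar_mult[OF even_units_carrier[OF a(1)] t,
    symmetric])
  then have c: "(\<lambda>w. a \<otimes> t w) \<in> carrier T"
    using T.m_closed[OF scalar_closed[OF even_units_carrier[OF a(1)]] t] by simp
  have "\<omega> = cls (\<lambda>w. a \<otimes> t w)" using a t by (simp add: emb_mult_cls even_units_carrier)
  then show thesis using cls_memD[OF c, of s] s a that by simp
qed

text \<open>Representatives differ by an even unit, so invertibility of a coordinate is a property
  of the point.\<close>

lemma coordinate_point: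
  assumes "s \<in> carrier T" "t \<in> carrier T" "point s = point t"
  shows "coord b s \<in> Units A \<longleftrightarrow> coord b t \<in> Units A"
proof -
  have "coord b s \<in> Units A" if h: "coord b t \<in> Units A" "s \<in> carrier T" "t \<in> carrier T" "point s
    = point t" for s t
  proof -
    obtain a where a: "a \<in> even_units A" "cls s = emb a \<bullet> cls t" by (rule point_eqD[OF h(2,4)])
    then have "coord b s = a \<otimes> coord b t"
      using h by (intro coordinate_emb) (auto simp: even_units_carrier)
    then show ?thesis using a h by (simp add: even_units_iff)
  qed
  then show ?thesis using assms by metis
qed

lemma pts_proj: "pts (proj_ext_power n m r) A = point ` nondegenerate"
  by (auto simp: proj_ext_power_def proj_vectors_eq point_def)

lemma row_tensor_nondegenerate:
  assumes "U \<in> frames n m r A"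
  shows "rows U \<in> nondegenerate"
proof -
  obtain a where a: "U \<in> matrices" "is_chart n r a" "coord a (rows U) \<in> Units A"
    using assms unfolding frames_iff by blast
  then show ?thesis unfolding nondegenerate_def
    using row_tensor_homogeneous is_chart_basis[OF a(2), of m] is_chart_parity[OF a(2)]
    by (auto intro!: bexI[of _ a])
qed

lemma frames_matrices: "U \<in> frames n m r A \<Longrightarrow> U \<in> matrices"
  unfolding frames_def by blast

text \<open>A change of frame multiplies the multivector by an even unit, so the union in
  \<open>plucker\<close> collapses to one class.\<close>

lemma plucker_plane:
  assumes U: "U \<in> frames n m r A"
  shows "plucker n m r A (plane A r U) = point (rows U)"
proof -
  note UM = frames_matrices[OF U]
  have "proj_class n m A (mvec V) = point (rows U)" if V: "V \<in> plane A r U" for V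
  proof -
    obtain g where g: "g \<in> GL r A" "V = mat_mult A r g U" using V unfolding plane_def by blast
    obtain d where "d \<in> even_units A" "cls (rows V) = emb d \<bullet> cls (rows U)"
      unfolding g(2) by (rule multivector_GL_coordinate[OF g(1) UM]) blast
    then have "point (rows V) = point (rows U)"
      by (rule point_eqI[OF _ row_tensor_carrier[OF UM]])
    then show ?thesis
      using mat_mult_closed[OF GL_supermatrix[OF g(1)] UM]
        by (simp add: g(2) multivector_cls point_def)
  qed
  moreover have "U \<in> plane A r U" by (rule plane_self[OF UM])
  ultimately show ?thesis unfolding plucker_def by blast
qed

section \<open>Reading a frame off a multivector\<close>

text \<open>Solves \<open>coordinate_normalized_replace\<close> for the entry: the sign is its own
  inverse, and division by the coordinate at \<open>a\<close> removes the common factor. The formula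
  makes sense whenever that coordinate is invertible, also for points outside the image.\<close>

definition chart_matrix :: "nat list \<Rightarrow> (nat list \<Rightarrow> 'u) \<Rightarrow> nat \<Rightarrow> nat \<Rightarrow> 'u" where
  "chart_matrix a t = (\<lambda>i j. if i < r \<and> j < n + m then
     (if j \<in> set a then (if a ! i = j then \<one> else \<zero>)
      else ([(sorting_sign n (a[i := j]))] \<cdot> coord (a[i := j]) t) \<otimes> inv coord a t)
     else \<zero>)"

lemma chart_matrix_closed:
  assumes a: "is_chart n r a" and t: "\<And>w. t w \<in> part A (word_parity n w)"
    and unit: "coord a t \<in> Units A"
  shows "chart_matrix a t \<in> matrices"
proof (rule supermatrixI)
  fix i j assume i: "i < r" and "j < n + m"
  have D: "inv coord a t \<in> part A 0"
    using even_unit_inverse[OF _ unit] coordinate_part[of t a, OF t] is_chart_parity[OF a] by simp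
  \<comment> \<open>All letters of \<open>a\<close> are even, so after the replacement
    \<open>j\<close> is the only letter that may be odd; this gives the entry the parity of its
    column.\<close>
  have "word_parity n (a[i := j]) = word_parity n [j]"
  proof -
    have "set (take i a) \<subseteq> {..<n}" "set (drop (Suc i) a) \<subseteq> {..<n}"
      using is_chartD(3)[OF a] set_take_subset set_drop_subset by (metis order_trans)+
    then have "word_parity n (take i a) = 0" "word_parity n (drop (Suc i) a) = 0"
      by (auto simp: word_parity_def filter_empty_conv)
    then show ?thesis using i is_chartD(1)[OF a] by (simp add: upd_conv_take_nth_drop)
  qed
  then have "([(sorting_sign n (a[i := j]))] \<cdot> coord (a[i := j]) t) \<otimes> inv coord a t \<in> part A
    (word_parity n [j])"
    using part_mult[OF part_int[OF coordinate_part[of t "a[i := j]", OF t]] D] by simp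
  moreover have "\<one> \<in> part A (word_parity n [j])" if "j \<in> set a"
    using that is_chartD(3)[OF a] part_one by auto
  ultimately show "chart_matrix a t i j \<in> part A (word_parity n [j])"
    using part_zero by (simp add: chart_matrix_def)
qed (auto simp: chart_matrix_def)

lemma chart_matrix_normalized:
  assumes a: "is_chart n r a"
  shows "columns A r (chart_matrix a t) a = mat_one A r"
proof (intro ext)
  fix i j
  show "columns A r (chart_matrix a t) a i j = mat_one A r i j"
  proof (cases "i < r \<and> j < r")
    case True
    then have "a ! j \<in> set a" using is_chartD(1)[OF a] by (intro nth_mem) simp
    moreover then have "a ! j < n + m" using is_chartD(3)[OF a] by auto
    ultimately show ?thesis using True is_chartD(1,2)[OF a]
      by (auto simp: columns_def mat_one_def chart_matrix_def nth_eq_iff_index_eq)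
  qed (auto simp: columns_def mat_one_def)
qed

text \<open>A normalized frame \<open>W\<close> has coordinate 1 at \<open>a\<close>, so the
  coordinate of \<open>t\<close> there is the factor \<open>l\<close>, and dividing the other
  coordinates by it leaves the entries of \<open>W\<close> up to the sign already accounted
  for.\<close>

lemma chart_matrix_eq:
  assumes W: "W \<in> matrices" and a: "is_chart n r a" and one: "columns A r W a = mat_one A r"
    and l: "l \<in> even_units A" and t: "t \<in> carrier T" "cls t = emb l \<bullet> cls (rows W)"
  shows "coord a t = l" "chart_matrix a t = W"
proof -
  note aD = is_chartD[OF a]
  have lc: "l \<in> carrier A" "l \<in> Units A" using l even_units_carrier by (auto simp: even_units_iff)
  have c: "coord b t = l \<otimes> coord b (rows W)" for b
    using lc(1) t(1) row_tensor_carrier[OF W] t(2) by (rule coordinate_emb)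
  show D: "coord a t = l"
    using c[of a] coordinate_chart_normalized[OF W a one] lc by simp
  show "chart_matrix a t = W"
  proof (intro ext)
    fix i j
    note Wc = supermatrixD(2)[OF W, of i j]
    show "chart_matrix a t i j = W i j"
    proof (cases "i < r \<and> j < n + m")
      case False
      then show ?thesis using supermatrixD(3)[OF W] by (auto simp: chart_matrix_def)
    next
      case True
      show ?thesis
      proof (cases "j \<in> set a")
        case True
        then obtain k where "k < r" "j = a ! k" using aD(1) by (metis in_set_conv_nth)
        then show ?thesis using normalized_column[OF one, of i k] True \<open>i < r \<and> j < n + m\<close> aD(1,2)
          by (auto simp: chart_matrix_def nth_eq_iff_index_eq)
      next
        case False
        have dist: "distinct (a[i := j])" using aD(2) False by (simp add: distinct_list_update)
        have "coord (a[i := j]) t = l \<otimes> [(sorting_sign n (a[i := j]))] \<cdot> W i j"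
          using c[of "a[i := j]"] coordinate_normalized_replace[OF W aD(1-3) one _ False, of i]
            True by simp
        then have "[(sorting_sign n (a[i := j]))] \<cdot> coord (a[i := j]) t = l \<otimes> W i j"
          using Wc lc sorting_sign_distinct[OF dist, of n]
          by (simp add: add_pow_rdistr_int int_smult_simps)
        \<comment> \<open>The factor \<open>l\<close> is even and can be moved past a possibly odd
          entry.\<close>
        moreover have "l \<otimes> W i j \<otimes> inv l = W i j"
          using lc Wc even_commute[of l "W i j"] l by (simp add: even_units_iff m_assoc)
        ultimately show ?thesis using True False by (simp add: chart_matrix_def D)
      qed
    qed
  qed
qed

text \<open>The normalized frame of the plane is the chart matrix of \<open>t\<close>, hence
  determined by the point alone; the factor relating \<open>t\<close> to it is the coordinate of
  \<open>t\<close> at \<open>a\<close>.\<close>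

lemma point_frame_chart:
  assumes U: "U \<in> frames n m r A" and a: "is_chart n r a" and unit: "coord a (rows U) \<in> Units A"
    and t: "t \<in> carrier T" "point t = point (rows U)"
  shows "plane A r U = plane A r (chart_matrix a t)" "cls t
    = emb (coord a t) \<bullet> cls (rows (chart_matrix a t))"
proof -
  note UM = frames_matrices[OF U]
  have G: "columns A r U a \<in> GL r A" using chart_unit_iff[OF UM a] unit by simp
  obtain W where W: "W \<in> matrices" "columns A r W a
    = mat_one A r" "W \<in> frames n m r A" "plane A r U = plane A r W"
    by (rule normalize[OF UM a G]) blast
  have "point t = point (rows W)"
    using t(2) plucker_plane[OF U] plucker_plane[OF W(3)] W(4) by simp
  then obtain l where l: "l \<in> even_units A" "cls t = emb l \<bullet> cls (rows W)"
    by (rule point_eqD[OF t(1)])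
  note e = chart_matrix_eq[OF W(1) a W(2) l(1) t(1) l(2)]
  show "plane A r U = plane A r (chart_matrix a t)" using W(4) e by simp
  show "cls t = emb (coord a t) \<bullet> cls (rows (chart_matrix a t))" using l(2) e by simp
qed

text \<open>Both planes are spanned by the chart matrix of the same tensor
  \<open>rows U\<close>.\<close>

lemma plucker_injective:
  assumes U: "U \<in> frames n m r A" and V: "V \<in> frames n m r A" and e: "point (rows U)
    = point (rows V)"
  shows "plane A r U = plane A r V"
proof -
  obtain a where a: "is_chart n r a" "coord a (rows U) \<in> Units A" using U unfolding frames_iff
    by blast
  note c = row_tensor_carrier[OF frames_matrices[OF U]] row_tensor_carrier[OF frames_matrices[OF V]]
  have "coord a (rows V) \<in> Units A" using coordinate_point[OF c e] a(2) by simp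
  then show ?thesis
    using point_frame_chart(1)[OF U a c(1)] point_frame_chart(1)[OF V a(1) _ c(1) e] by simp
qed

lemma pts_grassmannian: "pts (super_grassmannian n m r) A = plane A r ` frames n m r A"
  by (simp add: super_grassmannian_def)

lemma image_pts_plucker:
  "image_pts (super_grassmannian n m r) (plucker n m r) A = (\<lambda>U. point (rows U)) ` frames n m r A"
  unfolding image_pts_def pts_grassmannian image_image using plucker_plane
    by (intro image_cong) auto

section \<open>The image inside a chart\<close>

definition chart_points :: "nat list \<Rightarrow> (nat list \<Rightarrow> 'u) set set set" where
  "chart_points a = point ` {t \<in> nondegenerate. coord a t \<in> Units A}"

lemma point_in_chart:
  assumes "t \<in> nondegenerate"
  shows "point t \<in> chart_points a \<longleftrightarrow> coord a t \<in> Units A"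
  unfolding chart_points_def using assms nondegenerateD(2) coordinate_point[of t _ a] by auto

text \<open>A point of the chart lies in the image exactly when it is the point of its own chart
  matrix. That matrix has coordinate 1 at \<open>a\<close>, which explains the factor
  \<open>coord a t\<close>; comparison at the basis words suffices by
  \<open>cls_eq_coordinates\<close>.\<close>

lemma point_in_image_iff:
  assumes t: "t \<in> nondegenerate" and a: "is_chart n r a" and unit: "coord a t \<in> Units A"
  shows "point t \<in> image_pts (super_grassmannian n m r) (plucker n m r) A \<longleftrightarrow>
    (\<forall>b\<in>basis_words n m r. coord b t \<ominus> coord a t \<otimes> coord b (rows (chart_matrix a t)) = \<zero>)"
proof -
  let ?W = "chart_matrix a t" and ?D = "coord a t"
  note tD = nondegenerateD[OF t]
  have W: "?W \<in> matrices" by (rule chart_matrix_closed[OF a tD(3) unit])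
  have Dc: "?D \<in> carrier A" using unit by blast
  have Du: "?D \<in> even_units A"
    using coordinate_part[of t a, OF tD(3)] is_chart_parity[OF a] unit by (simp add: even_units_iff)
  have cc: "coord b t \<in> carrier A" "coord b (rows ?W) \<in> carrier A" for b
    using tD(2) row_tensor_carrier[OF W] by (auto intro!: coordinate_closed)
  have eq: "coord b t \<ominus> ?D \<otimes> coord b (rows ?W) = \<zero> \<longleftrightarrow> coord b t = ?D \<otimes> coord b (rows ?W)" for b
    using cc Dc diff_zero_imp_eq[of "coord b t" "?D \<otimes> coord b (rows ?W)"]
      by (auto simp: minus_eq r_neg)
  show ?thesis unfolding eq
  proof
    assume "point t \<in> image_pts (super_grassmannian n m r) (plucker n m r) A"
    then obtain U where U: "U \<in> frames n m r A" "point t = point (rows U)"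
      unfolding image_pts_plucker by blast
    have "coord a (rows U) \<in> Units A"
      using coordinate_point[OF tD(2) row_tensor_carrier[OF frames_matrices[OF U(1)]] U(2)] unit
        by simp
    then have "cls t = emb ?D \<bullet> cls (rows ?W)"
      by (rule point_frame_chart(2)[OF U(1) a _ tD(2) U(2)])
    then show "\<forall>b\<in>basis_words n m r. coord b t = ?D \<otimes> coord b (rows ?W)"
      using coordinate_emb[OF Dc tD(2) row_tensor_carrier[OF W]] by blast
  next
    assume h: "\<forall>b\<in>basis_words n m r. coord b t = ?D \<otimes> coord b (rows ?W)"
    let ?s = "\<lambda>w. ?D \<otimes> rows ?W w"
    have s: "?s = scalar A ?D \<star> rows ?W" by (rule T_scalar_mult[OF Dc row_tensor_carrier[OF W],
      symmetric])
    have "?s \<in> carrier T" unfolding s using Dc row_tensor_carrier[OF W] by (intro T.m_closed) auto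
    moreover have "?s w = \<zero>" if "length w \<noteq> r" for w
      using homogeneousD(2)[OF row_tensor_homogeneous(1)[OF W] that] Dc by simp
    ultimately have sh: "?s \<in> homogeneous_tensors n m r A" unfolding homogeneous_tensors_def
      by blast
    have "cls t = cls ?s"
      by (rule cls_eq_coordinates[OF tD(1) sh])
        (use h coordinate_scale[OF Dc T_coeff[OF row_tensor_carrier[OF W]]] in simp)
    then have "cls t = emb ?D \<bullet> cls (rows ?W)"
      using emb_mult_cls[OF Dc row_tensor_carrier[OF W]] by simp
    then have "point t = point (rows ?W)" by (rule point_eqI[OF Du row_tensor_carrier[OF W]])
    moreover have "?W \<in> frames n m r A"
      unfolding frames_iff using W a coordinate_chart_normalized[OF W a chart_matrix_normalized[OF
        a]] by auto
    ultimately show "point t \<in> image_pts (super_grassmannian n m r) (plucker n m r) A"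
      unfolding image_pts_plucker by blast
  qed
qed

text \<open>An even element is central, so its multiples already form a two-sided ideal. This
  translates an invertible coordinate into the unit ideal condition by which open subfunctors are
  defined.\<close>

lemma ideal_generated_by_even:
  assumes "x \<in> part A 0"
  shows "Idl {x} = carrier A \<longleftrightarrow> x \<in> Units A"
proof
  assume "x \<in> Units A"
  then obtain y where y: "y \<in> carrier A" "x \<otimes> y = \<one>" unfolding Units_def by blast
  have i: "ideal (Idl {x}) A" using assms part_carrier by (intro genideal_ideal) auto
  have "x \<in> Idl {x}" using assms part_carrier by (intro genideal_self') auto
  then have "\<one> \<in> Idl {x}" using ideal.I_r_closed[OF i _ y(1)] y(2) by metis
  then show "Idl {x} = carrier A" by (rule ideal.one_imp_carrier[OF i])
next
  assume I: "Idl {x} = carrier A"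
  have xc: "x \<in> carrier A" using assms part_carrier by blast
  let ?J = "{x \<otimes> y |y. y \<in> carrier A}"
  have comm: "x \<otimes> y = y \<otimes> x" if "y \<in> carrier A" for y using assms that by (rule even_commute)
  have "ideal ?J A"
  proof (rule idealI[OF ring_axioms])
    show "subgroup ?J (add_monoid A)"
    proof (rule group.subgroupI[OF a_group])
      show "?J \<noteq> {}" using one_closed by blast
      fix u v assume "u \<in> ?J" "v \<in> ?J"
      then obtain y z where y: "u = x \<otimes> y" "y \<in> carrier A" and z: "v = x \<otimes> z" "z \<in> carrier A"
        by blast
      have "u \<oplus> v = x \<otimes> (y \<oplus> z)" using y z xc by (simp add: r_distr)
      then show "u \<otimes>\<^bsub>add_monoid A\<^esub> v \<in> ?J" using y z by auto
      have "\<ominus> u = x \<otimes> \<ominus> y" using y xc by (simp add: r_minus)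
      then have "\<ominus> u \<in> ?J" using y by blast
      then show "inv\<^bsub>add_monoid A\<^esub> u \<in> ?J" unfolding a_inv_def .
    qed (use xc in auto)
    fix u z assume "u \<in> ?J" and z: "z \<in> carrier A"
    then obtain y where y: "u = x \<otimes> y" "y \<in> carrier A" by blast
    have "z \<otimes> u = x \<otimes> (z \<otimes> y)" using y z xc comm[OF z] by (simp flip: m_assoc)
    then show "z \<otimes> u \<in> ?J" using y z by blast
    have "u \<otimes> z = x \<otimes> (y \<otimes> z)" using y z xc by (simp add: m_assoc)
    then show "u \<otimes> z \<in> ?J" using y z by blast
  qed
  moreover have "x \<in> ?J"
  proof -
    have "x = x \<otimes> \<one>" using xc by simp
    then show ?thesis using one_closed by blast
  qed
  ultimately have "Idl {x} \<subseteq> ?J" by (intro genideal_minimal) auto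
  then have "\<one> \<in> ?J" unfolding I using one_closed by (rule subsetD)
  then obtain y where "\<one> = x \<otimes> y" "y \<in> carrier A" by blast
  then have "y \<in> carrier A" "x \<otimes> y = \<one>" by simp_all
  then show "x \<in> Units A" by (intro even_unitI[OF assms])
qed

end

section \<open>Change of the coefficient superalgebra\<close>

locale superalgebra_morphism =
  dom: super_pluecker A n m r + cod: super_pluecker B n m r
  for A B :: "('k, 'u) superalgebra" and n m r +
  fixes f :: "'u \<Rightarrow> 'u"
  assumes hom: "f \<in> ring_hom A B"
    and parity: "x \<in> part A p \<Longrightarrow> f x \<in> part B p"
begin

abbreviation (input) push where "push t \<equiv> (\<lambda>w. f (t w))"
abbreviation (input) push_matrix where "push_matrix U \<equiv> (\<lambda>i j. f (U i j))"

lemma f_closed [simp]: "x \<in> carrier A \<Longrightarrow> f x \<in> carrier B"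
  by (rule ring_hom_closed[OF hom])

lemma f_mult: "x \<in> carrier A \<Longrightarrow> y \<in> carrier A \<Longrightarrow> f (x \<otimes>\<^bsub>A\<^esub> y) = f x \<otimes>\<^bsub>B\<^esub> f y"
  by (rule ring_hom_mult[OF hom])

lemma f_add: "x \<in> carrier A \<Longrightarrow> y \<in> carrier A \<Longrightarrow> f (x \<oplus>\<^bsub>A\<^esub> y) = f x \<oplus>\<^bsub>B\<^esub> f y"
  by (rule ring_hom_add[OF hom])

lemma f_one: "f \<one>\<^bsub>A\<^esub> = \<one>\<^bsub>B\<^esub>"
  by (rule ring_hom_one[OF hom])

lemma f_zero: "f \<zero>\<^bsub>A\<^esub> = \<zero>\<^bsub>B\<^esub>"
  by (rule ring_hom_zero[OF hom dom.ring_axioms cod.ring_axioms])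

lemma f_uminus: "x \<in> carrier A \<Longrightarrow> f (\<ominus>\<^bsub>A\<^esub> x) = \<ominus>\<^bsub>B\<^esub> f x"
proof -
  assume x: "x \<in> carrier A"
  have "f (\<ominus>\<^bsub>A\<^esub> x) \<oplus>\<^bsub>B\<^esub> f x = \<zero>\<^bsub>B\<^esub>"
    using x by (simp add: f_add[symmetric] dom.l_neg f_zero)
  then show ?thesis using x by (intro cod.minus_equality[symmetric]) auto
qed

lemma f_minus: "x \<in> carrier A \<Longrightarrow> y \<in> carrier A \<Longrightarrow> f (x \<ominus>\<^bsub>A\<^esub> y) = f x \<ominus>\<^bsub>B\<^esub> f y"
  by (simp add: dom.minus_eq cod.minus_eq f_add f_uminus)

lemma f_finsum: "(\<And>i. i \<in> I \<Longrightarrow> g i \<in> carrier A) \<Longrightarrow> f (\<Oplus>\<^bsub>A\<^esub>i\<in>I. g i) = (\<Oplus>\<^bsub>B\<^esub>i\<in>I. f (g i))"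
proof (induction I rule: infinite_finite_induct)
  case (insert i I)
  then have g: "g i \<in> carrier A" "\<And>j. j \<in> I \<Longrightarrow> g j \<in> carrier A" by auto
  have "(\<Oplus>\<^bsub>A\<^esub>i\<in>insert i I. g i) = g i \<oplus>\<^bsub>A\<^esub> (\<Oplus>\<^bsub>A\<^esub>i\<in>I. g i)"
    using insert.hyps g by (intro dom.finsum_insert) auto
  moreover have "(\<Oplus>\<^bsub>B\<^esub>i\<in>insert i I. f (g i)) = f (g i) \<oplus>\<^bsub>B\<^esub> (\<Oplus>\<^bsub>B\<^esub>i\<in>I. f (g i))"
    using insert.hyps g by (intro cod.finsum_insert) auto
  moreover have "(\<Oplus>\<^bsub>A\<^esub>i\<in>I. g i) \<in> carrier A" using g by (intro dom.finsum_closed) auto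
  ultimately show ?case using insert g by (simp add: f_add)
qed (simp_all add: f_zero)

lemma f_sign: "x \<in> carrier A \<Longrightarrow> f ([((- 1) ^ p :: int)] \<cdot>\<^bsub>A\<^esub> x) = [((- 1) ^ p :: int)] \<cdot>\<^bsub>B\<^esub> f x"
  by (cases "even p") (simp_all add: dom.int_smult_simps cod.int_smult_simps f_uminus)

lemma f_sorting_sign: "x \<in> carrier A \<Longrightarrow> f ([(sorting_sign N w)] \<cdot>\<^bsub>A\<^esub> x)
  = [(sorting_sign N w)] \<cdot>\<^bsub>B\<^esub> f x"
  using sorting_sign_cases[of N w]
  by (auto simp: dom.int_smult_simps cod.int_smult_simps f_uminus f_zero)

lemma f_Units:
  assumes "x \<in> Units A"
  shows "f x \<in> Units B" "f (inv\<^bsub>A\<^esub> x) = inv\<^bsub>B\<^esub> f x"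
proof -
  have e: "f x \<otimes>\<^bsub>B\<^esub> f (inv\<^bsub>A\<^esub> x) = \<one>\<^bsub>B\<^esub>" "f (inv\<^bsub>A\<^esub> x) \<otimes>\<^bsub>B\<^esub> f x = \<one>\<^bsub>B\<^esub>"
    using f_mult[of x "inv\<^bsub>A\<^esub> x"] f_mult[of "inv\<^bsub>A\<^esub> x" x] assms dom.Units_closed[OF assms]
      dom.Units_inv_closed[OF assms]
    by (simp_all add: f_one)
  then show "f x \<in> Units B"
    using dom.Units_closed[OF assms] dom.Units_inv_closed[OF assms] f_closed unfolding Units_def
      by blast
  show "f (inv\<^bsub>A\<^esub> x) = inv\<^bsub>B\<^esub> f x"
    using e assms by (intro cod.inv_char[symmetric]) auto
qed

lemma f_even_units: "x \<in> even_units A \<Longrightarrow> f x \<in> even_units B"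
  using f_Units(1) parity by (simp add: dom.even_units_iff cod.even_units_iff)

lemma f_twist: "x \<in> carrier A \<Longrightarrow> f (twist A p x) = twist B p (f x)"
proof -
  assume "x \<in> carrier A"
  then obtain y z where d: "y \<in> part A 0" "z \<in> part A 1" "x = y \<oplus>\<^bsub>A\<^esub> z"
    using dom.part_cases by blast
  then show ?thesis
    using dom.twist_decomp[OF d(1,2), of p] cod.twist_decomp[OF parity[OF d(1)] parity[OF d(2)],
      of p]
    by (simp add: f_add f_sign dom.part_carrier dom.int_smult_simps)
qed

section \<open>Base change of tensors and projective points\<close>

lemma push_carrier:
  assumes t: "t \<in> carrier dom.T"
  shows "push t \<in> carrier cod.T"
proof -
  have n: "f (t w) \<noteq> \<zero>\<^bsub>B\<^esub> \<Longrightarrow> t w \<noteq> \<zero>\<^bsub>A\<^esub>" for w using f_zero by auto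
  have "finite {w. f (t w) \<noteq> \<zero>\<^bsub>B\<^esub>}"
    by (rule finite_subset[of _ "{w. t w \<noteq> \<zero>\<^bsub>A\<^esub>}", rotated])
      (use t in \<open>simp add: dom.T_carrier\<close>, use n in blast)
  moreover have "set w \<subseteq> {..<n + m}" if "f (t w) \<noteq> \<zero>\<^bsub>B\<^esub>" for w
    using t n[OF that] unfolding dom.T_carrier by blast
  moreover have "f (t w) \<in> carrier B" for w using dom.T_coeff[OF t] by simp
  ultimately show ?thesis unfolding cod.T_carrier by blast
qed

lemma push_mult:
  assumes "s \<in> carrier dom.T" "t \<in> carrier dom.T"
  shows "push (s \<otimes>\<^bsub>dom.T\<^esub> t) = push s \<otimes>\<^bsub>cod.T\<^esub> push t"
proof
  fix w
  note c = dom.T_coeff[OF assms(1)] dom.T_coeff[OF assms(2)]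
  have "f (\<Oplus>\<^bsub>A\<^esub>k\<in>{..length w}. s (take k w) \<otimes>\<^bsub>A\<^esub> twist A (word_parity n (take k w)) (t (drop k w)))
      = (\<Oplus>\<^bsub>B\<^esub>k\<in>{..length w}. f (s (take k w) \<otimes>\<^bsub>A\<^esub> twist A (word_parity n (take k w)) (t (drop k
        w))))"
    using c by (intro f_finsum) auto
  also have "\<dots> = (\<Oplus>\<^bsub>B\<^esub>k\<in>{..length w}. f (s (take k w)) \<otimes>\<^bsub>B\<^esub> twist B (word_parity n (take k w)) (f
    (t (drop k w))))"
    using c by (intro cod.finsum_cong') (auto simp: f_mult f_twist)
  finally show "f ((s \<otimes>\<^bsub>dom.T\<^esub> t) w) = (push s \<otimes>\<^bsub>cod.T\<^esub> push t) w"
    unfolding dom.T_mult cod.T_mult .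
qed

lemma push_add: "s \<in> carrier dom.T \<Longrightarrow> t \<in> carrier dom.T \<Longrightarrow> push (s \<oplus>\<^bsub>dom.T\<^esub> t)
  = push s \<oplus>\<^bsub>cod.T\<^esub> push t"
  by (auto simp: f_add)

lemma push_hom: "push \<in> ring_hom dom.T cod.T"
proof (rule ring_hom_memI)
  show "push \<one>\<^bsub>dom.T\<^esub> = \<one>\<^bsub>cod.T\<^esub>" by (auto simp: f_one f_zero)
qed (use push_carrier push_mult push_add in blast)+

lemma push_uminus: "t \<in> carrier dom.T \<Longrightarrow> push (\<ominus>\<^bsub>dom.T\<^esub> t) = \<ominus>\<^bsub>cod.T\<^esub> push t"
  using push_carrier by (auto simp: dom.T_uminus cod.T_uminus f_uminus)

lemma push_homogeneous:
  "t \<in> homogeneous_tensors n m l A \<Longrightarrow> push t \<in> homogeneous_tensors n m l B"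
proof -
  assume t: "t \<in> homogeneous_tensors n m l A"
  have "length w = l" if "f (t w) \<noteq> \<zero>\<^bsub>B\<^esub>" for w
  proof -
    have "t w \<noteq> \<zero>\<^bsub>A\<^esub>" using that f_zero by auto
    then show ?thesis using t unfolding homogeneous_tensors_def by blast
  qed
  then show ?thesis using t push_carrier unfolding homogeneous_tensors_def by blast
qed

lemma push_vectors: "v \<in> vectors n m A p \<Longrightarrow> push v \<in> vectors n m B p"
  using push_homogeneous parity unfolding vectors_def by auto

lemma push_relation:
  assumes "R \<in> ext_relations n m A"
  shows "push R \<in> ext_relations n m B"
proof -
  obtain p q v w where R: "R = (v \<otimes>\<^bsub>dom.T\<^esub> w) \<oplus>\<^bsub>dom.T\<^esub> signed dom.T (p * q) (w \<otimes>\<^bsub>dom.T\<^esub> v)"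
    and v: "v \<in> vectors n m A p" and w: "w \<in> vectors n m A q"
    using assms unfolding ext_relations_def Let_def by blast
  note c = dom.vectorsD(1)[OF v] dom.vectorsD(1)[OF w]
  have wv: "w \<otimes>\<^bsub>dom.T\<^esub> v \<in> carrier dom.T" and vw: "v \<otimes>\<^bsub>dom.T\<^esub> w \<in> carrier dom.T"
    using c by (auto intro: dom.T.m_closed)
  have s: "push (signed dom.T l u) = signed cod.T l (push u)" "signed dom.T l u \<in> carrier dom.T"
    if "u \<in> carrier dom.T" for l u
    using that push_uminus dom.T.a_inv_closed by (auto simp: signed_def)
  have "push R = (push v \<otimes>\<^bsub>cod.T\<^esub> push w) \<oplus>\<^bsub>cod.T\<^esub> signed cod.T (p * q) (push w \<otimes>\<^bsub>cod.T\<^esub> push v)"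
    unfolding R push_add[OF vw s(2)[OF wv]] s(1)[OF wv] push_mult[OF c] push_mult[OF c(2,1)] ..
  then show ?thesis
    unfolding ext_relations_def Let_def using push_vectors[OF v] push_vectors[OF w] by blast
qed

text \<open>The preimage of the ideal over \<open>B\<close> is an ideal over \<open>A\<close> that
  contains the relations over \<open>A\<close>.\<close>

lemma push_ext_ideal:
  assumes "t \<in> ext_ideal n m A"
  shows "push t \<in> ext_ideal n m B"
proof -
  interpret h: ring_hom_ring dom.T cod.T push
    by (rule ring_hom_ringI2[OF dom.T_ring cod.T_ring push_hom])
  let ?J = "{t \<in> carrier dom.T. push t \<in> ext_ideal n m B}"
  have "ideal ?J dom.T" by (rule h.ideal_vimage[OF cod.ext_ideal])
  moreover have "ext_relations n m A \<subseteq> ?J"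
    using dom.ext_relations_subset push_relation cod.T.genideal_self[OF cod.ext_relations_subset]
    unfolding ext_ideal_def by blast
  ultimately have "ext_ideal n m A \<subseteq> ?J" unfolding ext_ideal_def by (rule dom.T.genideal_minimal)
  then show ?thesis using assms by blast
qed

lemma push_cls:
  assumes "s \<in> carrier dom.T" "t \<in> carrier dom.T" "dom.cls s = dom.cls t"
  shows "cod.cls (push s) = cod.cls (push t)"
proof -
  have "s \<ominus>\<^bsub>dom.T\<^esub> t \<in> ext_ideal n m A" using assms dom.cls_eq_iff by blast
  then have "push (s \<ominus>\<^bsub>dom.T\<^esub> t) \<in> ext_ideal n m B" by (rule push_ext_ideal)
  moreover have "push (s \<ominus>\<^bsub>dom.T\<^esub> t) = push s \<ominus>\<^bsub>cod.T\<^esub> push t"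
    using assms push_carrier by (auto simp: dom.T_minus cod.T_minus f_minus)
  ultimately show ?thesis using cod.cls_eq_iff push_carrier assms by simp
qed

lemma push_cls_scale:
  assumes "a \<in> carrier A" "s \<in> carrier dom.T" "t \<in> carrier dom.T"
    "dom.cls s = dom.emb a \<otimes>\<^bsub>dom.E\<^esub> dom.cls t"
  shows "cod.cls (push s) = cod.emb (f a) \<otimes>\<^bsub>cod.E\<^esub> cod.cls (push t)"
proof -
  have e: "scalar A a \<otimes>\<^bsub>dom.T\<^esub> t = (\<lambda>w. a \<otimes>\<^bsub>A\<^esub> t w)" by (rule dom.T_scalar_mult[OF assms(1,3)])
  have "scalar A a \<otimes>\<^bsub>dom.T\<^esub> t \<in> carrier dom.T" using assms by (intro dom.T.m_closed) auto
  then have c: "(\<lambda>w. a \<otimes>\<^bsub>A\<^esub> t w) \<in> carrier dom.T" using e by simp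
  have "cod.cls (push s) = cod.cls (push (\<lambda>w. a \<otimes>\<^bsub>A\<^esub> t w))"
    using assms c by (intro push_cls) (simp_all add: dom.emb_mult_cls)
  also have "push (\<lambda>w. a \<otimes>\<^bsub>A\<^esub> t w) = (\<lambda>w. f a \<otimes>\<^bsub>B\<^esub> push t w)" using assms by (auto simp: f_mult)
  finally show ?thesis using assms push_carrier by (simp add: cod.emb_mult_cls)
qed

lemma push_point:
  assumes "s \<in> carrier dom.T" "t \<in> carrier dom.T" "dom.point s = dom.point t"
  shows "cod.point (push s) = cod.point (push t)"
proof -
  obtain a where a: "a \<in> even_units A" "dom.cls s = dom.emb a \<otimes>\<^bsub>dom.E\<^esub> dom.cls t"
    by (rule dom.point_eqD[OF assms(1,3)])
  show ?thesis
    by (rule cod.point_eqI[OF f_even_units[OF a(1)] push_carrier[OF assms(2)]])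
      (rule push_cls_scale[OF dom.even_units_carrier[OF a(1)] assms(1,2) a(2)])
qed

lemma f_coordinate:
  "(\<And>w. t w \<in> carrier A) \<Longrightarrow> f (dom.coord b t) = cod.coord b (push t)"
  unfolding dom.coord_def cod.coord_def
  by (subst f_finsum) (auto intro!: cod.finsum_cong' simp: f_sorting_sign dom.int_smult_simps
    cod.int_smult_simps)

lemma push_nondegenerate:
  assumes "t \<in> dom.nondegenerate"
  shows "push t \<in> cod.nondegenerate"
proof -
  note tD = dom.nondegenerateD[OF assms]
  obtain w where w: "w \<in> basis_words n m r" "even (word_parity n w)" "dom.coord w t \<in> Units A"
    using assms unfolding dom.nondegenerate_def by blast
  have "cod.coord w (push t) \<in> Units B"
    using f_Units(1)[OF w(3)] f_coordinate[of t w] tD(2) by simp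
  then show ?thesis
    unfolding cod.nondegenerate_def using w push_homogeneous[OF tD(1)] parity[OF tD(3)] by blast
qed

text \<open>All tensors in all cosets of the point are sent to the same class over \<open>B\<close>,
  so the double union in \<open>pmap\<close> is that class; it is not empty, because
  \<open>t\<close> is among the tensors.\<close>

lemma pmap_point:
  assumes t: "t \<in> carrier dom.T"
  shows "pmap (proj_ext_power n m r) A B f (dom.point t) = cod.point (push t)"
proof -
  have "proj_class n m B (ext_class n m B (push s)) = cod.point (push t)"
    if h: "\<omega> \<in> dom.point t" "s \<in> \<omega>" for \<omega> s
  proof -
    obtain a where a: "a \<in> even_units A" "s \<in> carrier dom.T" "dom.cls s
      = dom.emb a \<otimes>\<^bsub>dom.E\<^esub> dom.cls t"
      by (rule dom.point_mem[OF t h])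
    show ?thesis using push_point[OF a(2) t dom.point_eqI[OF a(1) t a(3)]]
      by (simp add: cod.point_def)
  qed
  moreover have "dom.cls t \<in> dom.point t" "t \<in> dom.cls t"
    using dom.proj_class_self[of "dom.cls t"] dom.cls_self t by (auto simp: dom.point_def)
  ultimately show ?thesis by (simp add: proj_ext_power_def) blast
qed

section \<open>Base change of matrices, planes and charts\<close>

lemma f_row_coeff:
  assumes "\<And>i j. U i j \<in> carrier A"
  shows "f (dom.row_coeff U is w) = cod.row_coeff (push_matrix U) is w"
  using assms
proof (induction U "is" w rule: dom.row_coeff.induct)
  case (2 U i "is" j w)
  then show ?case using dom.row_coeff_closed[of U "is" w, OF 2(2)]
    by (simp add: f_mult f_twist del: word_parity_simps)
qed (simp_all add: f_one f_zero)

lemma push_matrices: "U \<in> supermatrices k n' m' A \<Longrightarrow> push_matrix U \<in> supermatrices k n' m' B"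
  by (rule cod.supermatrixI) (rule parity, erule dom.supermatrixD(1), simp add:
    dom.supermatrixD(3) f_zero)

lemma push_mat_mult:
  assumes "\<And>i k. g i k \<in> carrier A" "\<And>k j. U k j \<in> carrier A"
  shows "push_matrix (mat_mult A r g U) = mat_mult B r (push_matrix g) (push_matrix U)"
proof (intro ext)
  fix i j
  show "f (mat_mult A r g U i j) = mat_mult B r (push_matrix g) (push_matrix U) i j"
    unfolding mat_mult_def using assms
    by (subst f_finsum) (auto intro!: cod.finsum_cong' simp: f_mult)
qed

lemma push_GL:
  assumes "g \<in> GL r A"
  shows "push_matrix g \<in> GL r B"
proof -
  obtain h where h: "h \<in> GL r A" "mat_mult A r g h = mat_one A r" "mat_mult A r h g = mat_one A r"
    by (rule dom.GL_D[OF assms])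
  note c = dom.supermatrixD(2)[OF dom.GL_supermatrix[OF assms]] dom.supermatrixD(2)[OF
    dom.GL_supermatrix[OF h(1)]]
  have one: "push_matrix (mat_one A r) = mat_one B r"
    by (intro ext) (simp add: mat_one_def f_one f_zero)
  have "mat_mult B r (push_matrix g) (push_matrix h) = mat_one B r"
    "mat_mult B r (push_matrix h) (push_matrix g) = mat_one B r"
    using push_mat_mult[of g h] push_mat_mult[of h g] c h(2,3) one by simp_all
  then show ?thesis
    unfolding GL_def using push_matrices[OF dom.GL_supermatrix[OF assms]] push_matrices[OF
      dom.GL_supermatrix[OF h(1)]]
    by blast
qed

lemma f_coordinate_row:
  "U \<in> dom.matrices \<Longrightarrow> f (dom.coord b (dom.rows U)) = cod.coord b (cod.rows (push_matrix U))"
proof -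
  assume U: "U \<in> dom.matrices"
  have "f (dom.coord b (dom.rows U)) = cod.coord b (\<lambda>w. f (dom.rows U w))"
    by (rule f_coordinate) (rule dom.T_coeff[OF dom.row_tensor_carrier[OF U]])
  also have "(\<lambda>w. f (dom.rows U w)) = cod.rows (push_matrix U)"
    by (rule ext, rule f_row_coeff) (rule dom.supermatrixD(2)[OF U])
  finally show ?thesis .
qed

lemma push_frames:
  assumes "U \<in> frames n m r A"
  shows "push_matrix U \<in> frames n m r B"
proof -
  obtain a where a: "U \<in> dom.matrices" "is_chart n r a" "dom.coord a (dom.rows U) \<in> Units A"
    using assms unfolding dom.frames_iff by blast
  then show ?thesis unfolding cod.frames_iff
    using push_matrices f_Units(1)[OF a(3)] f_coordinate_row[OF a(1)] by auto
qed

lemma pmap_plane: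
  assumes U: "U \<in> frames n m r A"
  shows "pmap (super_grassmannian n m r) A B f (plane A r U) = plane B r (push_matrix U)"
proof -
  note UM = dom.frames_matrices[OF U]
  have "plane B r (push_matrix V) = plane B r (push_matrix U)" if V: "V \<in> plane A r U" for V
  proof -
    obtain g where g: "g \<in> GL r A" "V = mat_mult A r g U" using V unfolding plane_def by blast
    have "push_matrix V = mat_mult B r (push_matrix g) (push_matrix U)"
      unfolding g(2) using dom.supermatrixD(2)[OF dom.GL_supermatrix[OF g(1)]]
        dom.supermatrixD(2)[OF UM]
      by (rule push_mat_mult)
    then show ?thesis using cod.plane_act[OF push_GL[OF g(1)] push_matrices[OF UM]] by simp
  qed
  moreover have "U \<in> plane A r U" by (rule dom.plane_self[OF UM])
  ultimately show ?thesis unfolding super_grassmannian_def superspace.select_convs by blast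
qed

text \<open>The entries are built from coordinates of \<open>t\<close>, signs and one inverse of a
  unit, all of which a ring homomorphism preserves.\<close>

lemma push_chart_matrix:
  assumes t: "t \<in> dom.nondegenerate" and unit: "dom.coord a t \<in> Units A"
  shows "push_matrix (dom.chart_matrix a t) = cod.chart_matrix a (push t)"
proof (intro ext)
  fix i j
  note c = dom.coordinate_closed[of t, OF dom.T_coeff[OF dom.nondegenerateD(2)[OF t]]]
  note fc = f_coordinate[of t, OF dom.T_coeff[OF dom.nondegenerateD(2)[OF t]]]
  show "f (dom.chart_matrix a t i j) = cod.chart_matrix a (push t) i j"
    unfolding dom.chart_matrix_def cod.chart_matrix_def using c unit
    by (simp add: f_one f_zero f_mult f_sorting_sign dom.int_smult_simps f_Units(2)[OF unit] fc)
qed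

text \<open>The equations of the image over \<open>B\<close> are the images under \<open>f\<close>
  of those over \<open>A\<close>. One set of elements of \<open>A\<close> therefore serves all
  \<open>f\<close> at once, as a closed subfunctor demands.\<close>

lemma push_image_iff:
  assumes t: "t \<in> dom.nondegenerate" and a: "is_chart n r a" and unit: "dom.coord a t \<in> Units A"
  shows "cod.point (push t) \<in> image_pts (super_grassmannian n m r) (plucker n m r) B \<longleftrightarrow>
    (\<forall>b\<in>basis_words n m r. f (dom.coord b t \<ominus>\<^bsub>A\<^esub>
      dom.coord a t \<otimes>\<^bsub>A\<^esub> dom.coord b (dom.rows (dom.chart_matrix a t))) = \<zero>\<^bsub>B\<^esub>)"
proof -
  note tD = dom.nondegenerateD[OF t]
  note fc = f_coordinate[of t, OF dom.T_coeff[OF tD(2)]]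
  have W: "dom.chart_matrix a t \<in> dom.matrices" by (rule dom.chart_matrix_closed[OF a tD(3) unit])
  have unitB: "cod.coord a (push t) \<in> Units B" using f_Units(1)[OF unit] fc by simp
  have "f (dom.coord b t \<ominus>\<^bsub>A\<^esub> dom.coord a t \<otimes>\<^bsub>A\<^esub> dom.coord b (dom.rows (dom.chart_matrix a t)))
     = cod.coord b (push t) \<ominus>\<^bsub>B\<^esub> cod.coord a (push t) \<otimes>\<^bsub>B\<^esub> cod.coord b (cod.rows (cod.chart_matrix
       a (push t)))" for b
  proof -
    have c: "dom.coord b' t \<in> carrier A" "dom.coord b' (dom.rows (dom.chart_matrix a t)) \<in> carrier
      A" for b'
      using tD(2) dom.row_tensor_carrier[OF W] by (auto intro!: dom.coordinate_closed)
    then show ?thesis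
      by (simp add: f_minus f_mult fc f_coordinate_row[OF W] push_chart_matrix[OF t unit])
  qed
  then show ?thesis
    using cod.point_in_image_iff[OF push_nondegenerate[OF t] a unitB] by simp
qed

end

section \<open>The super Pluecker embedding\<close>

locale pluecker_base = field K for K :: "'k ring" and n m r :: nat +
  assumes two_nonzero: "[(2::nat)] \<cdot>\<^bsub>K\<^esub> \<one>\<^bsub>K\<^esub> \<noteq> \<zero>\<^bsub>K\<^esub>"
    and rank_le: "r \<le> n"
begin

lemma super_plueckerI: "comm_superalgebra K A \<Longrightarrow> super_pluecker A n r"
  using comm_superalgebra.half_superalgebra[OF _ field_axioms two_nonzero] rank_le
  by (auto intro!: super_pluecker.intro super_tensors.intro super_pluecker_axioms.intro)

lemma superalgebra_morphismI:
  assumes "comm_superalgebra K A" "comm_superalgebra K B" "f \<in> superalgebra_hom K A B"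
  shows "superalgebra_morphism A B n r f"
proof (intro superalgebra_morphism.intro superalgebra_morphism_axioms.intro super_plueckerI
  assms(1,2))
  show "f \<in> ring_hom A B" using assms(3) unfolding superalgebra_hom_def by blast
  show "f x \<in> part B p" if "x \<in> part A p" for x p
    using that assms(3) unfolding superalgebra_hom_def Defs.part_def by (auto split: if_splits)
qed

abbreviation (input) Gr :: "('k, 'u, (nat \<Rightarrow> nat \<Rightarrow> 'u) set) superspace" where
  "Gr \<equiv> super_grassmannian n m r"

abbreviation (input) Pr :: "('k, 'u, (nat list \<Rightarrow> 'u) set set) superspace" where
  "Pr \<equiv> proj_ext_power n m r"

lemma point_functor_grassmannian:
  "point_functor K (super_grassmannian n m r :: ('k, 'u, (nat \<Rightarrow> nat \<Rightarrow> 'u) set) superspace)"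
  unfolding point_functor_def
proof (intro conjI allI impI)
  fix A B :: "('k, 'u) superalgebra" and f x
  assume h: "comm_superalgebra K A \<and> comm_superalgebra K B \<and> f \<in> superalgebra_hom K A B \<and> x \<in> pts
    Gr A"
  interpret superalgebra_morphism A B n m r f using h superalgebra_morphismI by blast
  obtain U where U: "U \<in> frames n m r A" "x = plane A r U" using h unfolding dom.pts_grassmannian
    by blast
  show "pmap Gr A B f x \<in> pts Gr B"
    unfolding U(2) pmap_plane[OF U(1)] cod.pts_grassmannian using push_frames[OF U(1)] by blast
next
  fix A :: "('k, 'u) superalgebra" and x
  assume h: "comm_superalgebra K A \<and> x \<in> pts Gr A"
  interpret super_pluecker A n m r using h super_plueckerI by blast
  have id: "superalgebra_morphism A A n r (\<lambda>a. a)"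
    by (intro superalgebra_morphism.intro superalgebra_morphism_axioms.intro super_pluecker_axioms)
      (auto intro: ring_hom_memI)
  obtain U where U: "U \<in> frames n m r A" "x = plane A r U" using h unfolding pts_grassmannian
    by blast
  show "pmap Gr A A (\<lambda>a. a) x = x"
    unfolding U(2) superalgebra_morphism.pmap_plane[OF id U(1)] ..
next
  fix A B C :: "('k, 'u) superalgebra" and f g x
  assume h: "comm_superalgebra K A \<and> comm_superalgebra K B \<and> comm_superalgebra K C \<and>
    f \<in> superalgebra_hom K A B \<and> g \<in> superalgebra_hom K B C \<and> x \<in> pts Gr A"
  interpret f: superalgebra_morphism A B n m r f using h superalgebra_morphismI by blast
  interpret g: superalgebra_morphism B C n m r g using h superalgebra_morphismI by blast
  interpret gf: superalgebra_morphism A C n m r "\<lambda>a. g (f a)"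
    using ring_hom_trans[OF f.hom g.hom] f.parity g.parity
    by unfold_locales (auto simp: comp_def)
  obtain U where U: "U \<in> frames n m r A" "x = plane A r U" using h
    unfolding f.dom.pts_grassmannian by blast
  show "pmap Gr A C (\<lambda>a. g (f a)) x = pmap Gr B C g (pmap Gr A B f x)"
    unfolding U(2) f.pmap_plane[OF U(1)] g.pmap_plane[OF f.push_frames[OF U(1)]] gf.pmap_plane[OF
      U(1)] ..
qed

lemma point_functor_projective:
  "point_functor K (proj_ext_power n m r :: ('k, 'u, (nat list \<Rightarrow> 'u) set set) superspace)"
  unfolding point_functor_def
proof (intro conjI allI impI)
  fix A B :: "('k, 'u) superalgebra" and f x
  assume h: "comm_superalgebra K A \<and> comm_superalgebra K B \<and> f \<in> superalgebra_hom K A B \<and> x \<in> pts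
    Pr A"
  interpret superalgebra_morphism A B n m r f using h superalgebra_morphismI by blast
  obtain t where t: "t \<in> dom.nondegenerate" "x = dom.point t" using h unfolding dom.pts_proj
    by blast
  show "pmap Pr A B f x \<in> pts Pr B"
    unfolding t(2) pmap_point[OF dom.nondegenerateD(2)[OF t(1)]] cod.pts_proj
      using push_nondegenerate[OF t(1)] by blast
next
  fix A :: "('k, 'u) superalgebra" and x
  assume h: "comm_superalgebra K A \<and> x \<in> pts Pr A"
  interpret super_pluecker A n m r using h super_plueckerI by blast
  have id: "superalgebra_morphism A A n r (\<lambda>a. a)"
    by (intro superalgebra_morphism.intro superalgebra_morphism_axioms.intro super_pluecker_axioms)
      (auto intro: ring_hom_memI)
  obtain t where t: "t \<in> nondegenerate" "x = point t" using h unfolding pts_proj by blast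
  show "pmap Pr A A (\<lambda>a. a) x = x"
    unfolding t(2) superalgebra_morphism.pmap_point[OF id nondegenerateD(2)[OF t(1)]] ..
next
  fix A B C :: "('k, 'u) superalgebra" and f g x
  assume h: "comm_superalgebra K A \<and> comm_superalgebra K B \<and> comm_superalgebra K C \<and>
    f \<in> superalgebra_hom K A B \<and> g \<in> superalgebra_hom K B C \<and> x \<in> pts Pr A"
  interpret f: superalgebra_morphism A B n m r f using h superalgebra_morphismI by blast
  interpret g: superalgebra_morphism B C n m r g using h superalgebra_morphismI by blast
  interpret gf: superalgebra_morphism A C n m r "\<lambda>a. g (f a)"
    using ring_hom_trans[OF f.hom g.hom] f.parity g.parity
    by unfold_locales (auto simp: comp_def)
  obtain t where t: "t \<in> f.dom.nondegenerate" "x = f.dom.point t" using h unfolding f.dom.pts_proj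
    by blast
  note tc = f.dom.nondegenerateD(2)[OF t(1)]
  show "pmap Pr A C (\<lambda>a. g (f a)) x = pmap Pr B C g (pmap Pr A B f x)"
    unfolding t(2) f.pmap_point[OF tc] g.pmap_point[OF f.push_carrier[OF tc]] gf.pmap_point[OF tc]
      ..
qed

lemma natural_plucker:
  "natural K (super_grassmannian n m r :: ('k, 'u, (nat \<Rightarrow> nat \<Rightarrow> 'u) set) superspace)
    (proj_ext_power n m r) (plucker n m r)"
  unfolding natural_def
proof (intro conjI allI impI)
  fix A :: "('k, 'u) superalgebra" and x
  assume h: "comm_superalgebra K A \<and> x \<in> pts Gr A"
  interpret super_pluecker A n m r using h super_plueckerI by blast
  obtain U where U: "U \<in> frames n m r A" "x = plane A r U" using h unfolding pts_grassmannian
    by blast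
  show "plucker n m r A x \<in> pts Pr A"
    unfolding U(2) plucker_plane[OF U(1)] pts_proj using row_tensor_nondegenerate[OF U(1)] by blast
next
  fix A B :: "('k, 'u) superalgebra" and f x
  assume h: "comm_superalgebra K A \<and> comm_superalgebra K B \<and> f \<in> superalgebra_hom K A B \<and> x \<in> pts
    Gr A"
  interpret superalgebra_morphism A B n m r f using h superalgebra_morphismI by blast
  obtain U where U: "U \<in> frames n m r A" "x = plane A r U" using h unfolding dom.pts_grassmannian
    by blast
  note UM = dom.frames_matrices[OF U(1)]
  have "(\<lambda>w. f (dom.rows U w)) = cod.rows (\<lambda>i j. f (U i j))"
    by (rule ext, rule f_row_coeff) (rule dom.supermatrixD(2)[OF UM])
  then show "plucker n m r B (pmap Gr A B f x) = pmap Pr A B f (plucker n m r A x)"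
    unfolding U(2) pmap_plane[OF U(1)] dom.plucker_plane[OF U(1)] cod.plucker_plane[OF
      push_frames[OF U(1)]]
      pmap_point[OF dom.row_tensor_carrier[OF UM]] by simp
qed

text \<open>Once \<open>plucker\<close> is injective on points, its pointwise inverse is
  automatically natural: a morphism takes the image of \<open>x\<close> to the image of the
  transported \<open>x\<close>, and that has only one preimage. The explicit chart formulas enter
  through injectivity.\<close>

lemma plucker_inverse:
  "\<exists>G. natural K ((proj_ext_power n m r)\<lparr>pts := image_pts Gr (plucker n m r)\<rparr>)
        (super_grassmannian n m r :: ('k, 'u, (nat \<Rightarrow> nat \<Rightarrow> 'u) set) superspace) G \<and>
      (\<forall>A. comm_superalgebra K A \<longrightarrow>
        (\<forall>x\<in>pts Gr A. G A (plucker n m r A x) = x) \<and>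
        (\<forall>y\<in>image_pts Gr (plucker n m r) A. plucker n m r A (G A y) = y))"
proof -
  define G where "G A = inv_into (pts Gr A) (plucker n m r A)" for A :: "('k, 'u) superalgebra"
  have inj: "inj_on (plucker n m r A) (pts Gr A)"
    if "comm_superalgebra K A" for A :: "('k, 'u) superalgebra"
  proof -
    interpret super_pluecker A n m r using that by (rule super_plueckerI)
    show ?thesis unfolding pts_grassmannian
    proof (rule inj_onI)
      fix x y
      assume "x \<in> plane A r ` frames n m r A" "y \<in> plane A r ` frames n m r A"
        and e: "plucker n m r A x = plucker n m r A y"
      then obtain U V where U: "U \<in> frames n m r A" "x = plane A r U"
        and V: "V \<in> frames n m r A" "y = plane A r V" by blast
      have "point (rows U) = point (rows V)"
        using e unfolding U(2) V(2) plucker_plane[OF U(1)] plucker_plane[OF V(1)] .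
      then show "x = y" unfolding U(2) V(2) by (rule plucker_injective[OF U(1) V(1)])
    qed
  qed
  have G: "G A (plucker n m r A x) = x" if "comm_superalgebra K A" "x \<in> pts Gr A" for A :: "('k,
    'u) superalgebra" and x
    unfolding G_def using inj[OF that(1)] that(2) by (rule inv_into_f_f)
  have "natural K (Pr\<lparr>pts := image_pts Gr (plucker n m r)\<rparr>) Gr G"
    unfolding natural_def
  proof (intro conjI allI impI)
    fix A :: "('k, 'u) superalgebra" and y
    assume h: "comm_superalgebra K A \<and> y \<in> pts (Pr\<lparr>pts := image_pts Gr (plucker n m r)\<rparr>) A"
    then have "y \<in> plucker n m r A ` pts Gr A" by (simp add: image_pts_def)
    then obtain x where "x \<in> pts Gr A" "y = plucker n m r A x" by blast
    then show "G A y \<in> pts Gr A" using G h by simp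
  next
    fix A B :: "('k, 'u) superalgebra" and f y
    assume h: "comm_superalgebra K A \<and> comm_superalgebra K B \<and> f \<in> superalgebra_hom K A B \<and>
      y \<in> pts (Pr\<lparr>pts := image_pts Gr (plucker n m r)\<rparr>) A"
    then have "y \<in> plucker n m r A ` pts Gr A" by (simp add: image_pts_def)
    then obtain x where x: "x \<in> pts Gr A" "y = plucker n m r A x" by blast
    have "plucker n m r B (pmap Gr A B f x) = pmap Pr A B f y"
      using natural_plucker h x unfolding natural_def by blast
    moreover have "pmap Gr A B f x \<in> pts Gr B"
      by (rule conjunct1[OF point_functor_grassmannian[unfolded point_functor_def], rule_format])
        (use h x in simp)
    ultimately have "G B (pmap Pr A B f y) = pmap Gr A B f x" using G[of B "pmap Gr A B f x"] h
      by simp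
    then show "G B (pmap (Pr\<lparr>pts := image_pts Gr (plucker n m r)\<rparr>) A B f y) = pmap Gr A B f (G A y)"
      using G x h by simp
  qed
  moreover have "plucker n m r A (G A y) = y"
    if h: "comm_superalgebra K A" "y \<in> image_pts Gr (plucker n m r) A" for A :: "('k, 'u)
      superalgebra" and y
  proof -
    obtain x where "x \<in> pts Gr A" "y = plucker n m r A x" using h(2) unfolding image_pts_def
      by blast
    then show ?thesis using G[OF h(1)] by simp
  qed
  ultimately show ?thesis using G by blast
qed

section \<open>The image as a locally closed subfunctor\<close>

lemma open_chart_points:
  assumes a: "is_chart n r a"
  shows "open_subfunctor K (proj_ext_power n m r :: ('k, 'u, (nat list \<Rightarrow> 'u) set set) superspace)
    (\<lambda>A. super_pluecker.chart_points A n m r a)"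
  unfolding open_subfunctor_def
proof (intro allI impI conjI ballI)
  fix A :: "('k, 'u) superalgebra" assume A: "comm_superalgebra K A"
  interpret dom: super_pluecker A n m r using A by (rule super_plueckerI)
  show "dom.chart_points a \<subseteq> pts Pr A"
    unfolding dom.chart_points_def dom.pts_proj by blast
  fix y assume "y \<in> pts Pr A"
  then obtain t where t: "t \<in> dom.nondegenerate" "y = dom.point t" unfolding dom.pts_proj by blast
  note tD = dom.nondegenerateD[OF t(1)]
  have D: "dom.coord a t \<in> part A 0"
    using dom.coordinate_part[of t a, OF tD(3)] is_chart_parity[OF a] by simp
  show "\<exists>S\<subseteq>even_part A. \<forall>B f. comm_superalgebra K B \<and> f \<in> superalgebra_hom K A B \<longrightarrow>
    (pmap Pr A B f y \<in> super_pluecker.chart_points B n m r a \<longleftrightarrow> Idl\<^bsub>B\<^esub> (f ` S) = carrier B)"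
  \<comment> \<open>A single element suffices: the coordinate at \<open>a\<close>, which is even
    because \<open>a\<close> has no odd letters.\<close>
  proof (intro exI[of _ "{dom.coord a t}"] conjI allI impI)
    show "{dom.coord a t} \<subseteq> even_part A" using D by (simp add: Defs.part_def)
    fix B :: "('k, 'u) superalgebra" and f
    assume h: "comm_superalgebra K B \<and> f \<in> superalgebra_hom K A B"
    interpret superalgebra_morphism A B n m r f using A h superalgebra_morphismI by blast
    have "pmap Pr A B f y \<in> cod.chart_points a \<longleftrightarrow> cod.coord a (\<lambda>w. f (t w)) \<in> Units B"
      unfolding t(2) pmap_point[OF tD(2)]
        by (rule cod.point_in_chart[OF push_nondegenerate[OF t(1)]])
    also have "cod.coord a (\<lambda>w. f (t w)) = f (dom.coord a t)"
      by (rule f_coordinate[symmetric]) (rule dom.T_coeff[OF tD(2)])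
    also have "f (dom.coord a t) \<in> Units B \<longleftrightarrow> Idl\<^bsub>B\<^esub> {f (dom.coord a t)} = carrier B"
      by (rule cod.ideal_generated_by_even[OF parity[OF D], symmetric])
    finally show "pmap Pr A B f y \<in> cod.chart_points a \<longleftrightarrow> Idl\<^bsub>B\<^esub> (f ` {dom.coord a t}) = carrier B"
      by simp
  qed
qed

lemma closed_image_in_chart:
  assumes a: "is_chart n r a"
  shows "closed_subfunctor K
    ((proj_ext_power n m r :: ('k, 'u, (nat list \<Rightarrow> 'u) set set) superspace)
      \<lparr>pts := \<lambda>A. super_pluecker.chart_points A n m r a\<rparr>)
    (\<lambda>A. super_pluecker.chart_points A n m r a \<inter> image_pts Gr (plucker n m r) A)"
  unfolding closed_subfunctor_def
proof (intro allI impI conjI ballI)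
  fix A :: "('k, 'u) superalgebra" assume A: "comm_superalgebra K A"
  interpret dom: super_pluecker A n m r using A by (rule super_plueckerI)
  show "dom.chart_points a \<inter> image_pts Gr (plucker n m r) A
      \<subseteq> pts (Pr\<lparr>pts := \<lambda>A. super_pluecker.chart_points A n m r a\<rparr>) A"
    by simp
  fix y assume "y \<in> pts (Pr\<lparr>pts := \<lambda>A. super_pluecker.chart_points A n m r a\<rparr>) A"
  then have "y \<in> dom.chart_points a" by simp
  then obtain t where t: "t \<in> dom.nondegenerate" "y = dom.point t"
    and unit: "dom.coord a t \<in> Units A"
    unfolding dom.chart_points_def by blast
  note tD = dom.nondegenerateD[OF t(1)]
  let ?c = "\<lambda>b. dom.coord b t \<ominus>\<^bsub>A\<^esub> dom.coord a t \<otimes>\<^bsub>A\<^esub> dom.coord b (dom.rows (dom.chart_matrix a t))"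
  have "\<exists>S\<subseteq>carrier A. \<forall>B f. comm_superalgebra K B \<and> f \<in> superalgebra_hom K A B \<longrightarrow>
    (pmap Pr A B f y \<in> super_pluecker.chart_points B n m r a \<inter> image_pts Gr (plucker n m r) B
      \<longleftrightarrow> f ` S \<subseteq> {\<zero>\<^bsub>B\<^esub>})"
  \<comment> \<open>The witnesses are the differences between the coordinates of \<open>t\<close>
    and those of the rescaled multivector of its chart matrix, one for each basis word. The chart
    condition itself persists over \<open>B\<close>, since \<open>f\<close> preserves units.\<close>
  proof (intro exI[of _ "?c ` basis_words n m r"] conjI allI impI)
    have "dom.coord b s \<in> carrier A" if "s \<in> carrier dom.T" for b s
      using that by (intro dom.coordinate_closed) simp
    then show "?c ` basis_words n m r \<subseteq> carrier A"
      using tD(2) dom.row_tensor_carrier[OF dom.chart_matrix_closed[OF a tD(3) unit]] by auto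
    fix B :: "('k, 'u) superalgebra" and f
    assume h: "comm_superalgebra K B \<and> f \<in> superalgebra_hom K A B"
    interpret superalgebra_morphism A B n m r f using A h superalgebra_morphismI by blast
    have "cod.coord a (\<lambda>w. f (t w)) = f (dom.coord a t)"
      by (rule f_coordinate[symmetric]) (rule dom.T_coeff[OF tD(2)])
    then have "cod.point (\<lambda>w. f (t w)) \<in> cod.chart_points a"
      using cod.point_in_chart[OF push_nondegenerate[OF t(1)]] f_Units(1)[OF unit] by simp
    then show "pmap Pr A B f y \<in> cod.chart_points a \<inter> image_pts Gr (plucker n m r) B \<longleftrightarrow>
        f ` (?c ` basis_words n m r) \<subseteq> {\<zero>\<^bsub>B\<^esub>}"
      unfolding t(2) pmap_point[OF tD(2)] using push_image_iff[OF t(1) a unit] by auto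
  qed
  then show "\<exists>S\<subseteq>carrier A. \<forall>B f. comm_superalgebra K B \<and> f \<in> superalgebra_hom K A B \<longrightarrow>
    (pmap (Pr\<lparr>pts := \<lambda>A. super_pluecker.chart_points A n m r a\<rparr>) A B f y
        \<in> super_pluecker.chart_points B n m r a \<inter> image_pts Gr (plucker n m r) B
      \<longleftrightarrow> f ` S \<subseteq> {\<zero>\<^bsub>B\<^esub>})"
    by simp
qed

text \<open>Every frame has an invertible minor in even columns, and the coordinate at these columns
  is then a unit.\<close>

lemma image_covered:
  fixes A :: "('k, 'u) superalgebra"
  assumes "comm_superalgebra K A"
  shows "image_pts Gr (plucker n m r) A \<subseteq> (\<Union>a\<in>{a. is_chart n r a}. super_pluecker.chart_points A n
    m r a)"
proof -
  interpret super_pluecker A n m r using assms by (rule super_plueckerI)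
  show ?thesis
  proof
    fix y assume "y \<in> image_pts Gr (plucker n m r) A"
    then obtain U where U: "U \<in> frames n m r A" "y = point (rows U)" unfolding image_pts_plucker
      by blast
    then obtain a where "is_chart n r a" "coord a (rows U) \<in> Units A" unfolding frames_iff by blast
    then show "y \<in> (\<Union>a\<in>{a. is_chart n r a}. chart_points a)"
      using point_in_chart[OF row_tensor_nondegenerate[OF U(1)]] U(2) by blast
  qed
qed

end

theorem theorem6:
  fixes K :: "'k ring" and n m r :: nat
  assumes "field K"
    and "\<And>k::nat. k > 0 \<Longrightarrow> [k] \<cdot>\<^bsub>K\<^esub> \<one>\<^bsub>K\<^esub> \<noteq> \<zero>\<^bsub>K\<^esub>"
    and "r \<le> n"
  shows "embedding K
    (super_grassmannian n m r :: ('k, 'u, (nat \<Rightarrow> nat \<Rightarrow> 'u) set) superspace)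
    (proj_ext_power n m r :: ('k, 'u, (nat list \<Rightarrow> 'u) set set) superspace)
    (plucker n m r)"
proof -
  interpret pluecker_base K n m r
    using assms(1) assms(2)[of 2] assms(3)
      by (intro pluecker_base.intro pluecker_base_axioms.intro) auto
  \<comment> \<open>One open subfunctor for each increasing choice of \<open>r\<close> even
    columns.\<close>
  let ?charts = "(\<lambda>a A. super_pluecker.chart_points A n m r a) ` {a. is_chart n r a}"
  have "\<exists>\<U>. (\<forall>U\<in>\<U>. open_subfunctor K Pr U \<and>
        closed_subfunctor K (Pr\<lparr>pts := U\<rparr>) (\<lambda>A. U A \<inter> image_pts Gr (plucker n m r) A)) \<and>
      (\<forall>A::('k, 'u) superalgebra. comm_superalgebra K A \<longrightarrow> image_pts Gr (plucker n m r) A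
        \<subseteq> (\<Union>U\<in>\<U>. U A))"
  proof (intro exI[of _ ?charts] conjI ballI allI impI)
    fix U :: "('k, 'u) superalgebra \<Rightarrow> (nat list \<Rightarrow> 'u) set set set"
    assume "U \<in> ?charts"
    then obtain a where a: "is_chart n r a" "U = (\<lambda>A. super_pluecker.chart_points A n m r a)"
      by blast
    show "open_subfunctor K Pr U" unfolding a(2) by (rule open_chart_points[OF a(1)])
    show "closed_subfunctor K (Pr\<lparr>pts := U\<rparr>) (\<lambda>A. U A \<inter> image_pts Gr (plucker n m r) A)"
      unfolding a(2) by (rule closed_image_in_chart[OF a(1)])
  next
    fix A :: "('k, 'u) superalgebra"
    assume "comm_superalgebra K A"
    then show "image_pts Gr (plucker n m r) A \<subseteq> (\<Union>U\<in>?charts. U A)"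
      using image_covered[of A] by simp
  qed
  then show ?thesis
    unfolding embedding_def
    by (intro conjI point_functor_grassmannian point_functor_projective natural_plucker
      plucker_inverse)
qed

end
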